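(* Let $X\subseteq\mathbb{R}^n$ be open, let $U$ be an open neighborhood of $X\times\{0\}$ in $\mathbb{R}^{n+1}$, and let $U_+=U\cap\mathbb{R}^{n+1}_+$. Let $$L=\frac{\partial}{\partial t}+\sum_{j=1}^n a_j(x,t)\frac{\partial}{\partial x_j}$$ where the complex-valued coefficients $a_j(x,t)$ are $C^\infty$ on $(X\times\{0\})\cup U_+$. Let $f$ be a locally integrable function on $U_+$ such that (i) $Lf\in L^1(U_+)$; (ii) for any compact set $K\subset X$ there exist $N=N(K)\in\mathbb{N}$ and $C=C(K)>0$ such that $$\int_K|f(x,t)|\,dx\le\frac{C}{t^N}\quad\text{as } t\to0^+ .$$ Then $\lim_{t\to0^+}f(\cdot,t)=bf$ exists in $\mathcal{D}'(X)$. Furthermore, if $X\times(0,T]\subseteq U_+$, then the distributions $\{f(\cdot,t):0\le t\le T\}$ (with $f(\cdot,0)=bf$) are uniformly bounded in $\mathcal{D}'(X)$.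
   Context: Points of $\mathbb{R}^{n+1}$ are written $(x,t)$, $x\in\mathbb{R}^n$, $t\in\mathbb{R}$, and $\mathbb{R}^{n+1}_+=\{t>0\}$. $Lf$ is taken in the sense of distributions. Smoothness on $(X\times\{0\})\cup U_+$ means smoothness up to the boundary $t=0$. Convention on $f(\cdot,t)$: when $f$ and $Lf$ are locally integrable, there is (on any cylinder $B\times I$ contained in $U_+$, with $B$ a ball in $x$-space and $I$ an open interval) a continuous map $t\mapsto F(t)$ with values in $\mathcal{D}'(B)$ such that for almost every $t$, $F(t)$ is the distribution given by the locally integrable function $x\mapsto f(x,t)$. For every $t>0$, $f(\cdot,t)$ denotes the distribution $F(t)$, and $\int f(x,t)\psi(x)\,dx$ means $\langle F(t),\psi\rangle$. *)

theory Defs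
  imports "HOL-Analysis.Analysis"
begin

definition dir_deriv :: "'a::euclidean_space \<Rightarrow> ('a \<Rightarrow> complex) \<Rightarrow> 'a \<Rightarrow> complex" where
  "dir_deriv e h = (\<lambda>x. frechet_derivative h (at x) e)"

(* A list of basis vectors plays the role of a multi-index; the head is differentiated last. *)
fun iter_deriv :: "'a::euclidean_space list \<Rightarrow> ('a \<Rightarrow> complex) \<Rightarrow> 'a \<Rightarrow> complex" where
  "iter_deriv [] h = h"
| "iter_deriv (e # es) h = dir_deriv e (iter_deriv es h)"

(* C^infinity on an open set: all iterated partial derivatives are (Frechet) differentiable,
   hence in particular continuous. *)
definition smooth_on :: "'a::euclidean_space set \<Rightarrow> ('a \<Rightarrow> complex) \<Rightarrow> bool" where
  "smooth_on \<Omega> h \<longleftrightarrow>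
     (\<forall>es. set es \<subseteq> Basis \<longrightarrow> (\<forall>x\<in>\<Omega>. iter_deriv es h differentiable (at x)))"

(* C^infinity up to the part \<Gamma> of the boundary of the open set \<Omega>: h is smooth in \<Omega>, and h and
   each of its partial derivatives extend continuously from \<Omega> to \<Gamma> \<union> \<Omega>, the extension of h
   being h itself. Derivatives are only ever taken at points of \<Omega>. *)
definition smooth_upto :: "'a::euclidean_space set \<Rightarrow> 'a set \<Rightarrow> ('a \<Rightarrow> complex) \<Rightarrow> bool" where
  "smooth_upto \<Gamma> \<Omega> h \<longleftrightarrow>
     smooth_on \<Omega> h \<and> continuous_on (\<Gamma> \<union> \<Omega>) h \<and>
     (\<forall>es. set es \<subseteq> Basis \<longrightarrow>
        (\<exists>g. continuous_on (\<Gamma> \<union> \<Omega>) g \<and> (\<forall>z\<in>\<Omega>. g z = iter_deriv es h z)))"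

definition test_functions :: "'a::euclidean_space set \<Rightarrow> ('a \<Rightarrow> complex) set" where
  "test_functions \<Omega> =
     {\<phi>. smooth_on UNIV \<phi> \<and> compact (closure {x. \<phi> x \<noteq> 0}) \<and> closure {x. \<phi> x \<noteq> 0} \<subseteq> \<Omega>}"

(* The sum over |\<alpha>| \<le> k of sup |D^\<alpha> \<phi>|. A multi-index is counted once per ordering of its
   entries, which changes the seminorm only up to a constant depending on k and the dimension. *)
definition Ck_seminorm :: "nat \<Rightarrow> ('a::euclidean_space \<Rightarrow> complex) \<Rightarrow> real" where
  "Ck_seminorm k \<phi> =
     (\<Sum>es | set es \<subseteq> Basis \<and> length es \<le> k. SUP x. norm (iter_deriv es \<phi> x))"

(* u \<in> D'(\<Omega>). The values of u off test_functions \<Omega> are irrelevant; consequently u restricts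
   to every smaller open set without any change of notation. *)
definition distribution :: "'a::euclidean_space set \<Rightarrow> (('a \<Rightarrow> complex) \<Rightarrow> complex) \<Rightarrow> bool" where
  "distribution \<Omega> u \<longleftrightarrow>
     (\<forall>\<phi>\<in>test_functions \<Omega>. \<forall>\<psi>\<in>test_functions \<Omega>. u (\<lambda>x. \<phi> x + \<psi> x) = u \<phi> + u \<psi>) \<and>
     (\<forall>c. \<forall>\<phi>\<in>test_functions \<Omega>. u (\<lambda>x. c * \<phi> x) = c * u \<phi>) \<and>
     (\<forall>K. compact K \<and> K \<subseteq> \<Omega> \<longrightarrow>
        (\<exists>C k. \<forall>\<phi>\<in>test_functions \<Omega>. closure {x. \<phi> x \<noteq> 0} \<subseteq> K \<longrightarrow>
           norm (u \<phi>) \<le> C * Ck_seminorm k \<phi>))"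

(* Over each compact set one seminorm estimate, with the same constant and order, serves the
   whole family. *)
definition uniformly_bounded_dists ::
    "'a::euclidean_space set \<Rightarrow> (('a \<Rightarrow> complex) \<Rightarrow> complex) set \<Rightarrow> bool" where
  "uniformly_bounded_dists \<Omega> \<F> \<longleftrightarrow>
     (\<forall>u\<in>\<F>. distribution \<Omega> u) \<and>
     (\<forall>K. compact K \<and> K \<subseteq> \<Omega> \<longrightarrow>
        (\<exists>C k. \<forall>u\<in>\<F>. \<forall>\<phi>\<in>test_functions \<Omega>. closure {x. \<phi> x \<noteq> 0} \<subseteq> K \<longrightarrow>
           norm (u \<phi>) \<le> C * Ck_seminorm k \<phi>))"

definition locally_integrable_on :: "('a::euclidean_space \<Rightarrow> complex) \<Rightarrow> 'a set \<Rightarrow> bool" where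
  "locally_integrable_on f \<Omega> \<longleftrightarrow>
     (\<forall>K. compact K \<and> K \<subseteq> \<Omega> \<longrightarrow> f absolutely_integrable_on K)"

(* The distribution given by f. If f is locally integrable on \<Omega> and \<phi> is a test function on \<Omega>,
   the integrand vanishes off \<Omega>, whatever f is there. *)
definition regular_dist :: "('a::euclidean_space \<Rightarrow> complex) \<Rightarrow> ('a \<Rightarrow> complex) \<Rightarrow> complex" where
  "regular_dist f \<phi> = (LINT x|lebesgue. f x * \<phi> x)"

definition dist_deriv ::
    "'a::euclidean_space \<Rightarrow> (('a \<Rightarrow> complex) \<Rightarrow> complex) \<Rightarrow> ('a \<Rightarrow> complex) \<Rightarrow> complex" where
  "dist_deriv e u = (\<lambda>\<phi>. - u (dir_deriv e \<phi>))"

definition dist_mult ::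
    "('a::euclidean_space \<Rightarrow> complex) \<Rightarrow> (('a \<Rightarrow> complex) \<Rightarrow> complex) \<Rightarrow> ('a \<Rightarrow> complex) \<Rightarrow> complex" where
  "dist_mult a u = (\<lambda>\<phi>. u (\<lambda>x. a x * \<phi> x))"

definition vector_field ::
    "('n::finite \<Rightarrow> (real^'n) \<times> real \<Rightarrow> complex) \<Rightarrow>
     (((real^'n) \<times> real \<Rightarrow> complex) \<Rightarrow> complex) \<Rightarrow> ((real^'n) \<times> real \<Rightarrow> complex) \<Rightarrow> complex" where
  "vector_field a u =
     (\<lambda>\<phi>. dist_deriv (0, 1) u \<phi> + (\<Sum>j\<in>UNIV. dist_mult (a j) (dist_deriv (axis j 1, 0) u) \<phi>))"

definition in_L1 ::
    "(('a::euclidean_space \<Rightarrow> complex) \<Rightarrow> complex) \<Rightarrow> 'a set \<Rightarrow> bool" where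
  "in_L1 u \<Omega> \<longleftrightarrow>
     (\<exists>g. g absolutely_integrable_on \<Omega> \<and> (\<forall>\<phi>\<in>test_functions \<Omega>. u \<phi> = regular_dist g \<phi>))"

definition upper_part :: "('a \<times> real) set \<Rightarrow> ('a \<times> real) set" where
  "upper_part U = {z \<in> U. snd z > 0}"

(* F t is a distribution on the whole slice of W at height t; its restrictions to the cylinders
   contained in W are weakly continuous in t and are given by f for almost every t. On test
   functions of the slice, F t is uniquely determined by these properties (partition of unity). *)
definition is_slice_family ::
    "((real^'n) \<times> real) set \<Rightarrow> ((real^'n) \<times> real \<Rightarrow> complex) \<Rightarrow>
     (real \<Rightarrow> (real^'n \<Rightarrow> complex) \<Rightarrow> complex) \<Rightarrow> bool" where
  "is_slice_family W f F \<longleftrightarrow>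
     (\<forall>t>0. distribution {x. (x, t) \<in> W} (F t)) \<and>
     (\<forall>c r \<alpha> \<beta>. r > 0 \<and> ball c r \<times> {\<alpha><..<\<beta>} \<subseteq> W \<longrightarrow>
        (\<forall>\<psi>\<in>test_functions (ball c r). continuous_on {\<alpha><..<\<beta>} (\<lambda>t. F t \<psi>)) \<and>
        (AE t in lebesgue. t \<in> {\<alpha><..<\<beta>} \<longrightarrow>
           locally_integrable_on (\<lambda>x. f (x, t)) (ball c r) \<and>
           (\<forall>\<psi>\<in>test_functions (ball c r). F t \<psi> = regular_dist (\<lambda>x. f (x, t)) \<psi>)))"

(* slice_dist W f t is f(.,t), for every (not just almost every) t > 0. *)
definition slice_dist ::
    "((real^'n) \<times> real) set \<Rightarrow> ((real^'n) \<times> real \<Rightarrow> complex) \<Rightarrow>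
     real \<Rightarrow> (real^'n \<Rightarrow> complex) \<Rightarrow> complex" where
  "slice_dist W f = (SOME F. is_slice_family W f F)"

end

theory Submission
  imports Defs
begin

text \<open>
  Pairing with a test function \<open>\<psi>\<close> in the \<open>x\<close>-variables turns the equation \<open>L f = g\<close> into the ordinary
  differential equation \<open>h' = k\<close> for \<open>h(t) = \<integral> f(x,t) \<psi>(x) dx\<close>, where
  \<open>k(t) = \<integral> g \<psi> + f \<Sum>\<^sub>j \<partial>\<^sub>j(a\<^sub>j \<psi>) dx\<close>. The lemma of du Bois-Reymond makes \<open>h\<close> absolutely continuous after a
  change on a null set. A countable \<open>C\<^sup>1\<close>-dense set of test functions gives one null set for all
  \<open>\<psi>\<close>, so the slices exist as distributions of order at most one; a partition of unity shows that they
  are determined by their restrictions to cylinders.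

  If the slices are \<open>O(t\<^sup>-\<^sup>p)\<close> in the dual of \<open>C\<^sup>m\<close>, uniformly over a compact set, then
  \<open>k(t) = O(t\<^sup>-\<^sup>p) + L\<^sup>1\<close> with one more derivative of \<open>\<psi>\<close>, because the \<open>a\<^sub>j\<close> are smooth up to \<open>t = 0\<close>.
  Integrating from \<open>t\<close> to a fixed time lowers the exponent to \<open>p - 1\<close>. Starting at \<open>p = N + 1/2\<close> avoids the
  logarithm, and \<open>p = 1/2\<close> is reached after \<open>N\<close> steps; then \<open>k\<close> is integrable up to \<open>t = 0\<close> and \<open>h\<close> converges.
\<close>

section \<open>Smooth functions\<close>

text \<open>\<open>slice_dist\<close> is an arbitrary choice among all families satisfying
  \<open>is_slice_family\<close>. So two things are proved separately: such a family exists, and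
  every such family \<open>F\<close> has a boundary value. The obstacle is that the function paired
  with f in k(t) depends on t itself. A bound for almost every t whose null set depends on the test
  function is useless there, hence the care to make exceptional sets uniform in the test function
  before exponents are lowered. A slice at a single time has order one by averaging: its value on
  \<psi> is at most the mean over a time interval plus the variation, and both are controlled by L^1
  norms of f and g and one derivative of \<psi>. Lowering the exponent keeps the compact set
  \<open>K\<close> fixed, since multiplying by a_j and differentiating does not enlarge supports;
  only the order of the seminorm grows, finitely often because N(K) is finite. Only x-derivatives of
  the coefficients enter, so only these are bounded up to t = 0.\<close>

lemma dir_deriv_eqI:
  assumes "(h has_derivative h') (at x)"
  shows "dir_deriv e h x = h' e"
  unfolding dir_deriv_def using frechet_derivative_at[OF assms] by simp

text \<open>No differentiability is assumed. \<open>frechet_derivative\<close> is a choice from the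
  set of derivatives at x, and functions that agree near x have the same set, so the same element is
  chosen.\<close>

lemma dir_deriv_cong:
  assumes "open \<Omega>" "x \<in> \<Omega>" "\<And>y. y \<in> \<Omega> \<Longrightarrow> f y = g y"
  shows "dir_deriv e f x = dir_deriv e g x"
proof -
  have "(f has_derivative D) (at x) \<longleftrightarrow> (g has_derivative D) (at x)" for D
    using has_derivative_transform_within_open[OF _ assms(1,2), of f D UNIV g]
      has_derivative_transform_within_open[OF _ assms(1,2), of g D UNIV f] assms(3) by auto
  then show ?thesis
    unfolding dir_deriv_def frechet_derivative_def by (simp only:)
qed

lemma iter_deriv_cong:
  assumes "open \<Omega>" "\<And>y. y \<in> \<Omega> \<Longrightarrow> f y = g y" "x \<in> \<Omega>"
  shows "iter_deriv es f x = iter_deriv es g x"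
  using assms(3)
proof (induction es arbitrary: x)
  case (Cons e es)
  show ?case
    using dir_deriv_cong[OF assms(1) Cons.prems, of "iter_deriv es f" "iter_deriv es g"] Cons.IH by simp
qed (simp add: assms)

lemma iter_deriv_append: "iter_deriv (es @ es') h = iter_deriv es (iter_deriv es' h)"
  by (induction es) auto

lemma iter_deriv_snoc: "iter_deriv (es @ [e]) h = iter_deriv es (dir_deriv e h)"
  by (simp add: iter_deriv_append)

lemma differentiable_cong_open:
  assumes "open \<Omega>" "x \<in> \<Omega>" "\<And>y. y \<in> \<Omega> \<Longrightarrow> f y = g y"
  shows "f differentiable (at x) \<longleftrightarrow> g differentiable (at x)"
  using has_derivative_transform_within_open[OF _ assms(1,2), of f _ UNIV g]
      has_derivative_transform_within_open[OF _ assms(1,2), of g _ UNIV f] assms(3)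
  unfolding differentiable_def by metis

text \<open>A truncation of smoothness that serves as induction parameter: the derivative of a
  product, an inverse or a composition is again built from such expressions, of one order
  less.\<close>

definition diff_times :: "nat \<Rightarrow> 'a::euclidean_space set \<Rightarrow> ('a \<Rightarrow> complex) \<Rightarrow> bool" where
  "diff_times k \<Omega> h \<longleftrightarrow>
     (\<forall>es. set es \<subseteq> Basis \<and> length es < k \<longrightarrow> (\<forall>x\<in>\<Omega>. iter_deriv es h differentiable (at x)))"

lemma smooth_on_iff_diff_times: "smooth_on \<Omega> h \<longleftrightarrow> (\<forall>k. diff_times k \<Omega> h)"
  unfolding smooth_on_def diff_times_def by (meson less_Suc_eq)

lemma diff_times_0 [simp]: "diff_times 0 \<Omega> h"
  by (simp add: diff_times_def)

text \<open>The head of a list is the outermost derivative, so the derivative applied first sits at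
  the end. Splitting off that last entry gives the recursion behind the closure lemmas.\<close>

lemma diff_times_Suc:
  "diff_times (Suc k) \<Omega> h \<longleftrightarrow>
     (\<forall>x\<in>\<Omega>. h differentiable (at x)) \<and> (\<forall>e\<in>Basis. diff_times k \<Omega> (dir_deriv e h))"
proof
  assume L: "diff_times (Suc k) \<Omega> h"
  show "(\<forall>x\<in>\<Omega>. h differentiable (at x)) \<and> (\<forall>e\<in>Basis. diff_times k \<Omega> (dir_deriv e h))"
  proof
    show "\<forall>x\<in>\<Omega>. h differentiable (at x)"
      using L[unfolded diff_times_def, rule_format, of "[]"] by simp
    show "\<forall>e\<in>Basis. diff_times k \<Omega> (dir_deriv e h)"
      unfolding diff_times_def
      using L[unfolded diff_times_def, rule_format, of "_ @ [_]"]
      by (auto simp: iter_deriv_snoc)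
  qed
next
  assume R: "(\<forall>x\<in>\<Omega>. h differentiable (at x)) \<and> (\<forall>e\<in>Basis. diff_times k \<Omega> (dir_deriv e h))"
  show "diff_times (Suc k) \<Omega> h"
    unfolding diff_times_def
  proof (intro allI impI ballI)
    fix es :: "'a list" and x assume es: "set es \<subseteq> Basis \<and> length es < Suc k" and x: "x \<in> \<Omega>"
    show "iter_deriv es h differentiable (at x)"
    proof (cases es rule: rev_cases)
      case Nil
      then show ?thesis using R x by simp
    next
      case (snoc es' e)
      then show ?thesis
        using R es x by (auto simp: iter_deriv_snoc diff_times_def)
    qed
  qed
qed

lemma diff_times_SucD: "diff_times (Suc k) \<Omega> h \<Longrightarrow> diff_times k \<Omega> h"
  unfolding diff_times_def by auto

lemma diff_times_cong:
  assumes "open \<Omega>" "\<And>x. x \<in> \<Omega> \<Longrightarrow> f x = g x"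
  shows "diff_times k \<Omega> f \<longleftrightarrow> diff_times k \<Omega> g"
proof -
  have "iter_deriv es f differentiable (at x) \<longleftrightarrow> iter_deriv es g differentiable (at x)"
    if "x \<in> \<Omega>" for es :: "'a list" and x
    by (rule differentiable_cong_open[OF assms(1) that iter_deriv_cong[OF assms]])
  then show ?thesis
    unfolding diff_times_def by blast
qed

lemma smooth_on_cong:
  assumes "open \<Omega>" "\<And>x. x \<in> \<Omega> \<Longrightarrow> f x = g x"
  shows "smooth_on \<Omega> f \<longleftrightarrow> smooth_on \<Omega> g"
  using diff_times_cong[OF assms] by (simp add: smooth_on_iff_diff_times)

lemma smooth_on_subset: "smooth_on \<Omega> h \<Longrightarrow> \<Omega>' \<subseteq> \<Omega> \<Longrightarrow> smooth_on \<Omega>' h"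
  unfolding smooth_on_def by blast

lemma smooth_on_Un: "smooth_on \<Omega> h \<Longrightarrow> smooth_on \<Omega>' h \<Longrightarrow> smooth_on (\<Omega> \<union> \<Omega>') h"
  unfolding smooth_on_def by blast

lemma smooth_on_iff_dir_deriv:
  "smooth_on \<Omega> h \<longleftrightarrow>
     (\<forall>x\<in>\<Omega>. h differentiable (at x)) \<and> (\<forall>e\<in>Basis. smooth_on \<Omega> (dir_deriv e h))"
  unfolding smooth_on_iff_diff_times
  by (metis diff_times_0 diff_times_Suc not0_implies_Suc)

lemma smooth_on_iter_deriv:
  "smooth_on \<Omega> h \<Longrightarrow> set es \<subseteq> Basis \<Longrightarrow> smooth_on \<Omega> (iter_deriv es h)"
  unfolding smooth_on_def by (metis (no_types, lifting) Un_subset_iff iter_deriv_append set_append)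

lemma smooth_on_dir_deriv: "smooth_on \<Omega> h \<Longrightarrow> e \<in> Basis \<Longrightarrow> smooth_on \<Omega> (dir_deriv e h)"
  using smooth_on_iff_dir_deriv by blast

lemma smooth_on_differentiable: "smooth_on \<Omega> h \<Longrightarrow> x \<in> \<Omega> \<Longrightarrow> h differentiable (at x)"
  using smooth_on_iff_dir_deriv by blast

lemma smooth_on_continuous: "smooth_on \<Omega> h \<Longrightarrow> continuous_on \<Omega> h"
  by (meson continuous_at_imp_continuous_on differentiable_imp_continuous_within smooth_on_differentiable)

lemma dir_deriv_const [simp]: "dir_deriv e (\<lambda>x. c) x = 0"
  by (rule dir_deriv_eqI) (rule has_derivative_const)

lemma dir_deriv_works:
  "h differentiable (at x) \<Longrightarrow> (h has_derivative (\<lambda>e. dir_deriv e h x)) (at x)"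
  unfolding dir_deriv_def using frechet_derivative_works by blast

lemma dir_deriv_add:
  "f differentiable (at x) \<Longrightarrow> g differentiable (at x) \<Longrightarrow>
     dir_deriv e (\<lambda>x. f x + g x) x = dir_deriv e f x + dir_deriv e g x"
  by (rule dir_deriv_eqI) (intro has_derivative_add dir_deriv_works)

lemma dir_deriv_mult:
  "f differentiable (at x) \<Longrightarrow> g differentiable (at x) \<Longrightarrow>
     dir_deriv e (\<lambda>x. f x * g x) x = f x * dir_deriv e g x + dir_deriv e f x * g x"
  by (rule dir_deriv_eqI) (intro has_derivative_mult dir_deriv_works)

lemma diff_times_SucI:
  assumes "open \<Omega>" "\<And>x. x \<in> \<Omega> \<Longrightarrow> (h has_derivative (\<lambda>e. h' e x)) (at x)"
    and "\<And>e. e \<in> Basis \<Longrightarrow> diff_times k \<Omega> (h' e)"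
  shows "diff_times (Suc k) \<Omega> h"
proof -
  have "diff_times k \<Omega> (dir_deriv e h)" if "e \<in> Basis" for e
    using assms(3)[OF that] diff_times_cong[OF assms(1), of "dir_deriv e h" "h' e"]
      dir_deriv_eqI[OF assms(2)] by blast
  moreover have "\<forall>x\<in>\<Omega>. h differentiable (at x)"
    using assms(2) differentiableI by blast
  ultimately show ?thesis
    by (simp add: diff_times_Suc)
qed

lemma diff_times_Suc_works:
  "diff_times (Suc k) \<Omega> h \<Longrightarrow> x \<in> \<Omega> \<Longrightarrow> (h has_derivative (\<lambda>e. dir_deriv e h x)) (at x)"
  by (simp add: diff_times_Suc dir_deriv_works)

lemma diff_times_dir_deriv: "diff_times (Suc k) \<Omega> h \<Longrightarrow> e \<in> Basis \<Longrightarrow> diff_times k \<Omega> (dir_deriv e h)"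
  by (simp add: diff_times_Suc)

lemma diff_times_const: "diff_times k \<Omega> (\<lambda>x. c)"
proof (induction k arbitrary: c)
  case (Suc k)
  have "dir_deriv e (\<lambda>x::'a. c) = (\<lambda>x. 0)" for e by auto
  with Suc show ?case by (simp add: diff_times_Suc)
qed simp

lemma diff_times_add:
  assumes "open \<Omega>"
  shows "diff_times k \<Omega> f \<Longrightarrow> diff_times k \<Omega> g \<Longrightarrow> diff_times k \<Omega> (\<lambda>x. f x + g x)"
proof (induction k arbitrary: f g)
  case (Suc k)
  show ?case
    by (rule diff_times_SucI[OF assms has_derivative_add[OF Suc.prems[THEN diff_times_Suc_works]]])
      (use Suc diff_times_dir_deriv in blast)+
qed simp

lemma diff_times_mult:
  assumes "open \<Omega>"
  shows "diff_times k \<Omega> f \<Longrightarrow> diff_times k \<Omega> g \<Longrightarrow> diff_times k \<Omega> (\<lambda>x. f x * g x)"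
proof (induction k arbitrary: f g)
  case (Suc k)
  show ?case
  proof (rule diff_times_SucI[OF assms has_derivative_mult[OF Suc.prems[THEN diff_times_Suc_works]]])
    fix e :: 'a assume "e \<in> Basis"
    then show "diff_times k \<Omega> (\<lambda>x. f x * dir_deriv e g x + dir_deriv e f x * g x)"
      using Suc.prems diff_times_dir_deriv diff_times_SucD
      by (intro diff_times_add[OF assms] Suc.IH) blast+
  qed
qed simp

text \<open>The derivative of 1/f is - (1/f) f' (1/f), where 1/f occurs undifferentiated, so the
  induction hypothesis one order below applies to it.\<close>

lemma diff_times_inverse:
  assumes "open \<Omega>" "\<And>x. x \<in> \<Omega> \<Longrightarrow> f x \<noteq> 0"
  shows "diff_times k \<Omega> f \<Longrightarrow> diff_times k \<Omega> (\<lambda>x. inverse (f x))"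
proof (induction k)
  case (Suc k)
  show ?case
  proof (rule diff_times_SucI[OF assms(1)])
    show "((\<lambda>x. inverse (f x)) has_derivative
        (\<lambda>e. (-1) * (inverse (f x) * dir_deriv e f x * inverse (f x)))) (at x)" if "x \<in> \<Omega>" for x
      using Deriv.has_derivative_inverse[OF assms(2)[OF that] diff_times_Suc_works[OF Suc.prems that]] by simp
    show "diff_times k \<Omega> (\<lambda>x. (-1) * (inverse (f x) * dir_deriv e f x * inverse (f x)))"
      if "e \<in> Basis" for e
      using Suc that diff_times_dir_deriv diff_times_SucD
      by (intro diff_times_mult[OF assms(1)] diff_times_const) blast+
  qed
qed simp

lemma smooth_on_const: "smooth_on \<Omega> (\<lambda>x. c)"
  by (simp add: smooth_on_iff_diff_times diff_times_const)

lemma smooth_on_add: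
  "open \<Omega> \<Longrightarrow> smooth_on \<Omega> f \<Longrightarrow> smooth_on \<Omega> g \<Longrightarrow> smooth_on \<Omega> (\<lambda>x. f x + g x)"
  by (simp add: smooth_on_iff_diff_times diff_times_add)

lemma smooth_on_mult:
  "open \<Omega> \<Longrightarrow> smooth_on \<Omega> f \<Longrightarrow> smooth_on \<Omega> g \<Longrightarrow> smooth_on \<Omega> (\<lambda>x. f x * g x)"
  by (simp add: smooth_on_iff_diff_times diff_times_mult)

lemma smooth_on_inverse:
  "open \<Omega> \<Longrightarrow> (\<And>x. x \<in> \<Omega> \<Longrightarrow> f x \<noteq> 0) \<Longrightarrow> smooth_on \<Omega> f \<Longrightarrow> smooth_on \<Omega> (\<lambda>x. inverse (f x))"
  by (simp add: smooth_on_iff_diff_times diff_times_inverse)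

lemma smooth_on_sum:
  "open \<Omega> \<Longrightarrow> (\<And>i. i \<in> I \<Longrightarrow> smooth_on \<Omega> (f i)) \<Longrightarrow> smooth_on \<Omega> (\<lambda>x. \<Sum>i\<in>I. f i x)"
  by (induction I rule: infinite_finite_induct) (auto intro: smooth_on_const smooth_on_add)

lemma iter_deriv_add:
  assumes "open \<Omega>" "smooth_on \<Omega> f" "smooth_on \<Omega> g" "set es \<subseteq> Basis" "x \<in> \<Omega>"
  shows "iter_deriv es (\<lambda>x. f x + g x) x = iter_deriv es f x + iter_deriv es g x"
  using assms(4,5)
proof (induction es arbitrary: x)
  case (Cons e es)
  have "dir_deriv e (iter_deriv es (\<lambda>x. f x + g x)) x =
      dir_deriv e (\<lambda>x. iter_deriv es f x + iter_deriv es g x) x"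
    using Cons by (intro dir_deriv_cong[OF assms(1)]) auto
  also have "\<dots> = dir_deriv e (iter_deriv es f) x + dir_deriv e (iter_deriv es g) x"
    using Cons assms by (intro dir_deriv_add) (auto simp: smooth_on_def)
  finally show ?case by simp
qed simp

lemma iter_deriv_const_eq: "iter_deriv es (\<lambda>x. c) x = (if es = [] then c else 0)"
proof (induction es arbitrary: x)
  case (Cons e es)
  have "iter_deriv es (\<lambda>x::'a. c) = (\<lambda>x. if es = [] then c else 0)"
    using Cons.IH by auto
  then show ?case by simp
qed simp

lemma iter_deriv_cmult:
  assumes "open \<Omega>" "smooth_on \<Omega> f" "set es \<subseteq> Basis" "x \<in> \<Omega>"
  shows "iter_deriv es (\<lambda>x. c * f x) x = c * iter_deriv es f x"
  using assms(3,4)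
proof (induction es arbitrary: x)
  case (Cons e es)
  have "dir_deriv e (iter_deriv es (\<lambda>x. c * f x)) x = dir_deriv e (\<lambda>x. c * iter_deriv es f x) x"
    using Cons by (intro dir_deriv_cong[OF assms(1)]) auto
  also have "\<dots> = c * dir_deriv e (iter_deriv es f) x"
    using Cons assms by (subst dir_deriv_mult) (auto simp: smooth_on_def)
  finally show ?case by simp
qed simp

lemma iter_deriv_sum:
  assumes "open \<Omega>" "finite I" "\<And>i. i \<in> I \<Longrightarrow> smooth_on \<Omega> (f i)" "set es \<subseteq> Basis" "x \<in> \<Omega>"
  shows "iter_deriv es (\<lambda>x. \<Sum>i\<in>I. f i x) x = (\<Sum>i\<in>I. iter_deriv es (f i) x)"
  using assms(2,3)
proof (induction I rule: finite_induct)
  case empty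
  show ?case using iter_deriv_const_eq[of es 0 x] by auto
next
  case (insert i I)
  then show ?case
    by (simp add: iter_deriv_add[OF assms(1) _ _ assms(4,5)] smooth_on_sum[OF assms(1)])
qed

text \<open>Leibniz rule without binomial coefficients: stripping the innermost derivative splits a
  product into two, so n derivatives give 2^n terms, each a derivative of \<open>b\<close> times a
  derivative of \<psi>. The bounds pass to \<open>dir_deriv e b\<close> and
  \<open>dir_deriv e \<psi>\<close> because they cover lists of the full length.\<close>

lemma norm_iter_deriv_mult_le:
  assumes "open \<Omega>" "x \<in> \<Omega>" "set es \<subseteq> Basis" "smooth_on \<Omega> b" "smooth_on \<Omega> \<psi>"
    and "\<And>es'. set es' \<subseteq> Basis \<Longrightarrow> length es' \<le> length es \<Longrightarrow> norm (iter_deriv es' b x) \<le> A"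
    and "\<And>es'. set es' \<subseteq> Basis \<Longrightarrow> length es' \<le> length es \<Longrightarrow> norm (iter_deriv es' \<psi> x) \<le> P"
  shows "norm (iter_deriv es (\<lambda>x. b x * \<psi> x) x) \<le> 2 ^ length es * A * P"
  using assms(3-7)
proof (induction es arbitrary: b \<psi> rule: rev_induct)
  case Nil
  show ?case using Nil(4)[of "[]"] Nil(5)[of "[]"] by (auto simp: norm_mult intro!: mult_mono order_trans[OF norm_ge_zero])
next
  case (snoc e es)
  have e: "e \<in> Basis" "set es \<subseteq> Basis" using snoc.prems by auto
  have *: "iter_deriv (es @ [e]) (\<lambda>x. b x * \<psi> x) x =
      iter_deriv es (\<lambda>x. b x * dir_deriv e \<psi> x) x + iter_deriv es (\<lambda>x. dir_deriv e b x * \<psi> x) x"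
  proof -
    have "iter_deriv (es @ [e]) (\<lambda>x. b x * \<psi> x) x =
        iter_deriv es (\<lambda>x. b x * dir_deriv e \<psi> x + dir_deriv e b x * \<psi> x) x"
      unfolding iter_deriv_snoc
      using snoc.prems assms(1,2)
      by (intro iter_deriv_cong[OF assms(1)]) (auto intro!: dir_deriv_mult smooth_on_differentiable)
    also have "\<dots> = iter_deriv es (\<lambda>x. b x * dir_deriv e \<psi> x) x + iter_deriv es (\<lambda>x. dir_deriv e b x * \<psi> x) x"
      using snoc.prems assms(1,2) e by (intro iter_deriv_add smooth_on_mult smooth_on_dir_deriv) auto
    finally show ?thesis .
  qed
  have "norm (iter_deriv es (\<lambda>x. b x * dir_deriv e \<psi> x) x) \<le> 2 ^ length es * A * P"
    using snoc.prems e
    by (intro snoc.IH smooth_on_dir_deriv) (auto simp flip: iter_deriv_snoc)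
  moreover have "norm (iter_deriv es (\<lambda>x. dir_deriv e b x * \<psi> x) x) \<le> 2 ^ length es * A * P"
    using snoc.prems e
    by (intro snoc.IH smooth_on_dir_deriv) (auto simp flip: iter_deriv_snoc)
  ultimately have "norm (iter_deriv es (\<lambda>x. b x * dir_deriv e \<psi> x) x +
      iter_deriv es (\<lambda>x. dir_deriv e b x * \<psi> x) x) \<le> 2 ^ length es * A * P + 2 ^ length es * A * P"
    by (rule norm_triangle_mono)
  then show ?case
    unfolding * by (simp add: ac_simps)
qed

section \<open>Flat functions and bump functions\<close>

text \<open>The family is closed under differentiation up to linear combinations, which makes
  compositions with it smooth by induction on the order.\<close>

definition flat_exp :: "nat \<Rightarrow> real \<Rightarrow> real" where
  "flat_exp k t = (if t > 0 then exp (- (1 / t)) / t ^ k else 0)"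

lemma flat_exp_DERIV:
  "(flat_exp k has_real_derivative (flat_exp (k + 2) t - k * flat_exp (k + 1) t)) (at t)"
proof -
  consider "t > 0" | "t < 0" | "t = 0" by linarith
  then show ?thesis
  proof cases
    case 1
    have "((\<lambda>t. exp (- (1 / t)) / t ^ k) has_real_derivative
        (flat_exp (k + 2) t - k * flat_exp (k + 1) t)) (at t)"
      using 1
      apply (cases k)
       apply (auto intro!: derivative_eq_intros simp: flat_exp_def divide_simps power2_eq_square)
       apply (simp_all add: algebra_simps)
      subgoal for n by (cases n) auto
      done
    then show ?thesis
      by (rule DERIV_cong_ev[THEN iffD1, rotated 3])
        (use 1 in \<open>auto simp: flat_exp_def eventually_nhds intro!: exI[of _ "{0<..}"]\<close>)
  next
    case 2
    have "((\<lambda>t. 0) has_real_derivative 0) (at t)" by simp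
    then show ?thesis
      by (rule DERIV_cong_ev[THEN iffD1, rotated 3])
        (use 2 in \<open>auto simp: flat_exp_def eventually_nhds intro!: exI[of _ "{..<0}"]\<close>)
  next
    case 3
    have "((\<lambda>y. flat_exp k y / y) \<longlongrightarrow> 0) (at_right 0)"
    proof -
      \<comment> \<open>Substituting 1/y for y turns exp(-1/y)/y^(k+1) into y^(k+1)/exp y, which
        tends to 0 at infinity.\<close>
      have "((\<lambda>y::real. y ^ (k + 1) / exp y) \<longlongrightarrow> 0) at_top"
        by (rule tendsto_power_div_exp_0)
      then have "((\<lambda>y. inverse y ^ (k + 1) / exp (inverse y)) \<longlongrightarrow> 0) (at_right (0::real))"
        by (rule filterlim_compose) (rule filterlim_inverse_at_top_right)
      then show ?thesis
        by (rule Lim_transform_eventually)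
          (auto simp: flat_exp_def eventually_at_right_field field_simps exp_minus intro!: exI[of _ 1])
    qed
    moreover have "((\<lambda>y. flat_exp k y / y) \<longlongrightarrow> 0) (at_left 0)"
      by (rule Lim_transform_eventually[OF tendsto_const])
        (auto simp: flat_exp_def eventually_at_left_field intro!: exI[of _ "-1"])
    ultimately have "((\<lambda>y. flat_exp k y / y) \<longlongrightarrow> 0) (at 0)"
      by (simp add: filterlim_split_at_real)
    then show ?thesis
      using 3 by (simp add: has_field_derivative_iff flat_exp_def)
  qed
qed

lemma diff_times_flat_exp:
  fixes q :: "'a::euclidean_space \<Rightarrow> real"
  assumes "open \<Omega>" "diff_times m \<Omega> (\<lambda>x. of_real (q x))"
  shows "diff_times m \<Omega> (\<lambda>x. of_real (flat_exp k (q x)))"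
  using assms(2)
proof (induction m arbitrary: k)
  case (Suc m)
  let ?Q = "\<lambda>x. complex_of_real (q x)"
  have d: "((\<lambda>x. complex_of_real (flat_exp k (q x))) has_derivative
      (\<lambda>e. (of_real (flat_exp (k + 2) (q x)) + (- of_nat k) * of_real (flat_exp (k + 1) (q x))) * dir_deriv e ?Q x)) (at x)"
    if "x \<in> \<Omega>" for x
  proof -
    have Q: "(?Q has_derivative (\<lambda>e. dir_deriv e ?Q x)) (at x)"
      using Suc.prems that by (intro dir_deriv_works) (auto simp: diff_times_Suc)
    from has_derivative_Re[OF this] have q: "(q has_derivative (\<lambda>e. Re (dir_deriv e ?Q x))) (at x)"
      by simp
    \<comment> \<open>\<open>flat_exp\<close> is a function of a real variable, so the chain rule
      runs through the real part. Nothing is lost, because the derivative of a real-valued q is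
      real.\<close>
    have im: "Im (dir_deriv e ?Q x) = 0" for e
    proof -
      have "((\<lambda>x. 0::real) has_derivative (\<lambda>e. Im (dir_deriv e ?Q x))) (at x)"
        using has_derivative_Im[OF Q] by simp
      from has_derivative_unique[OF this has_derivative_const] show ?thesis by metis
    qed
    have "((\<lambda>x. flat_exp k (q x)) has_derivative
        (\<lambda>e. (flat_exp (k + 2) (q x) - k * flat_exp (k + 1) (q x)) * Re (dir_deriv e ?Q x))) (at x)"
      using has_derivative_compose[OF q flat_exp_DERIV[THEN has_field_derivative_imp_has_derivative]] .
    from has_derivative_of_real[OF this] show ?thesis
      by (rule has_derivative_eq_rhs) (use im in \<open>auto simp: complex_eq_iff fun_eq_iff\<close>)
  qed
  show ?case
  proof (rule diff_times_SucI[OF assms(1) d])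
    fix e :: 'a assume "e \<in> Basis"
    then show "diff_times m \<Omega> (\<lambda>x. (of_real (flat_exp (k + 2) (q x)) +
        (- of_nat k) * of_real (flat_exp (k + 1) (q x))) * dir_deriv e ?Q x)"
      using Suc.prems diff_times_dir_deriv diff_times_SucD
      by (intro diff_times_mult[OF assms(1)] diff_times_add[OF assms(1)] diff_times_const Suc.IH) blast+
  qed
qed simp

lemma smooth_on_flat_exp:
  "open \<Omega> \<Longrightarrow> smooth_on \<Omega> (\<lambda>x. of_real (q x)) \<Longrightarrow> smooth_on \<Omega> (\<lambda>x. of_real (flat_exp k (q x)))"
  by (simp add: smooth_on_iff_diff_times diff_times_flat_exp)

lemma smooth_on_inner: "smooth_on \<Omega> (\<lambda>x. of_real (x \<bullet> v))"
proof -
  have d: "((\<lambda>x. complex_of_real (x \<bullet> v)) has_derivative (\<lambda>e. of_real (e \<bullet> v))) (at x)" for x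
    by (auto intro!: derivative_eq_intros)
  have "dir_deriv e (\<lambda>x. complex_of_real (x \<bullet> v)) = (\<lambda>x. of_real (e \<bullet> v))" for e
    using dir_deriv_eqI[OF d] by auto
  then show ?thesis
    using d by (subst smooth_on_iff_dir_deriv) (auto simp: smooth_on_const differentiable_def)
qed

text \<open>The standard mollifier exp(-1/(r^2 - |x - c|^2)), extended by 0 and not
  normalised.\<close>

definition bump :: "'a::euclidean_space \<Rightarrow> real \<Rightarrow> 'a \<Rightarrow> real" where
  "bump c r x = flat_exp 0 (r\<^sup>2 - (norm (x - c))\<^sup>2)"

lemma smooth_on_bump: "smooth_on UNIV (\<lambda>x. of_real (bump c r x))"
proof -
  \<comment> \<open>Expanded into linear functionals, the squared distance is smooth by the closure
    rules for sums and products.\<close>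
  have *: "complex_of_real (r\<^sup>2 - (norm (x - c))\<^sup>2) =
      of_real (r\<^sup>2 - c \<bullet> c) + (of_real (x \<bullet> (2 *\<^sub>R c)) +
      (\<Sum>b\<in>Basis. (-1) * (of_real (x \<bullet> b) * of_real (x \<bullet> b))))" for x
    unfolding power2_norm_eq_inner
    by (simp add: inner_diff inner_commute algebra_simps sum_negf flip: of_real_mult of_real_sum)
      (use euclidean_inner[of x x] in \<open>simp add: inner_commute\<close>)
  show ?thesis
    unfolding bump_def
    by (intro smooth_on_flat_exp open_UNIV, subst *)
      (intro smooth_on_add smooth_on_sum smooth_on_mult smooth_on_inner smooth_on_const open_UNIV)
qed

lemma flat_exp_pos_iff: "flat_exp k t > 0 \<longleftrightarrow> t > 0"
  by (simp add: flat_exp_def)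

lemma flat_exp_nonneg: "flat_exp k t \<ge> 0"
  by (simp add: flat_exp_def)

lemma bump_nonneg: "bump c r x \<ge> 0"
  by (simp add: bump_def flat_exp_nonneg)

lemma bump_pos_iff: "r > 0 \<Longrightarrow> bump c r x > 0 \<longleftrightarrow> x \<in> ball c r"
  unfolding bump_def flat_exp_pos_iff
  by (simp add: dist_norm norm_minus_commute not_le[symmetric] power_mono_iff)

abbreviation supp :: "('a::topological_space \<Rightarrow> complex) \<Rightarrow> 'a set" where
  "supp \<phi> \<equiv> closure {x. \<phi> x \<noteq> 0}"

lemma supp_subset_closed: "closed K \<Longrightarrow> (\<And>x. x \<notin> K \<Longrightarrow> \<phi> x = 0) \<Longrightarrow> supp \<phi> \<subseteq> K"
  by (intro closure_minimal) auto

lemma not_in_supp: "x \<notin> supp \<phi> \<Longrightarrow> \<phi> x = 0"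
  by (metis (mono_tags, lifting) closure_subset mem_Collect_eq subsetD)

lemma supp_mem: "\<phi> x \<noteq> 0 \<Longrightarrow> x \<in> supp \<phi>"
  using not_in_supp by blast

text \<open>Smoothness is local: \<open>\<Omega>\<close> and the complement of \<open>K\<close> form
  an open cover, and h is smooth on the first set and zero on the second.\<close>

lemma smooth_on_UNIV_extend:
  assumes "open \<Omega>" "smooth_on \<Omega> h" "closed K" "K \<subseteq> \<Omega>" "\<And>x. x \<notin> K \<Longrightarrow> h x = 0"
  shows "smooth_on UNIV h"
proof -
  have "smooth_on (-K) h"
    using smooth_on_cong[of "-K" h "\<lambda>x. 0"] assms by (auto simp: smooth_on_const)
  with assms(2) have "smooth_on (\<Omega> \<union> (-K)) h" by (rule smooth_on_Un)
  moreover have "\<Omega> \<union> (-K) = UNIV" using assms by auto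
  ultimately show ?thesis by simp
qed

lemma test_functionsI:
  "smooth_on UNIV \<phi> \<Longrightarrow> compact K \<Longrightarrow> K \<subseteq> \<Omega> \<Longrightarrow> (\<And>x. x \<notin> K \<Longrightarrow> \<phi> x = 0) \<Longrightarrow> \<phi> \<in> test_functions \<Omega>"
  using supp_subset_closed[OF compact_imp_closed, of K \<phi>] compact_Int_closed[of K "supp \<phi>"]
  by (simp add: test_functions_def Int_absorb1 subset_trans)

lemma test_functions_smooth: "\<phi> \<in> test_functions \<Omega> \<Longrightarrow> smooth_on UNIV \<phi>"
  by (simp add: test_functions_def)

lemma test_functions_compact: "\<phi> \<in> test_functions \<Omega> \<Longrightarrow> compact (supp \<phi>)"
  by (simp add: test_functions_def)

lemma test_functions_supp: "\<phi> \<in> test_functions \<Omega> \<Longrightarrow> supp \<phi> \<subseteq> \<Omega>"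
  by (simp add: test_functions_def)

lemma test_functions_outside: "\<phi> \<in> test_functions \<Omega> \<Longrightarrow> x \<notin> \<Omega> \<Longrightarrow> \<phi> x = 0"
  using test_functions_supp not_in_supp by blast

section \<open>Test functions and seminorms\<close>

lemma test_functions_mono: "\<phi> \<in> test_functions \<Omega> \<Longrightarrow> supp \<phi> \<subseteq> \<Omega>' \<Longrightarrow> \<phi> \<in> test_functions \<Omega>'"
  by (simp add: test_functions_def)

lemma test_functions_zero: "(\<lambda>x. 0) \<in> test_functions \<Omega>"
  by (rule test_functionsI[of _ "{}"]) (auto simp: smooth_on_const)

lemma test_functions_add:
  assumes "\<phi> \<in> test_functions \<Omega>" "\<psi> \<in> test_functions \<Omega>"
  shows "(\<lambda>x. \<phi> x + \<psi> x) \<in> test_functions \<Omega>"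
proof (rule test_functionsI[of _ "supp \<phi> \<union> supp \<psi>"])
  show "\<phi> x + \<psi> x = 0" if "x \<notin> supp \<phi> \<union> supp \<psi>" for x
    using that not_in_supp[of x \<phi>] not_in_supp[of x \<psi>] by simp
qed (use assms in \<open>auto intro!: smooth_on_add simp: test_functions_def\<close>)

text \<open>The factor \<open>b\<close> may take any values off \<open>\<Omega>\<close>: the product
  vanishes off the support of \<phi>, hence near every point outside
  \<open>\<Omega>\<close>.\<close>

lemma test_functions_mult:
  assumes "\<phi> \<in> test_functions \<Omega>" "open \<Omega>" "smooth_on \<Omega> b"
  shows "(\<lambda>x. b x * \<phi> x) \<in> test_functions \<Omega>"
proof (rule test_functionsI[of _ "supp \<phi>"])
  show z: "b x * \<phi> x = 0" if "x \<notin> supp \<phi>" for x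
    using that not_in_supp[of x \<phi>] by simp
  show "smooth_on UNIV (\<lambda>x. b x * \<phi> x)"
    using assms test_functions_smooth[OF assms(1)]
    by (intro smooth_on_UNIV_extend[OF assms(2), of _ "supp \<phi>"] smooth_on_mult z)
      (auto simp: test_functions_def intro: smooth_on_subset)
qed (use assms in \<open>auto simp: test_functions_def\<close>)

lemma test_functions_cmult:
  assumes "\<phi> \<in> test_functions \<Omega>"
  shows "(\<lambda>x. c * \<phi> x) \<in> test_functions \<Omega>"
proof (rule test_functionsI[of _ "supp \<phi>"])
  show "smooth_on UNIV (\<lambda>x. c * \<phi> x)"
    using test_functions_smooth[OF assms] by (intro smooth_on_mult smooth_on_const open_UNIV)
  show "c * \<phi> x = 0" if "x \<notin> supp \<phi>" for x
    using that not_in_supp[of x \<phi>] by simp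
qed (use assms in \<open>auto simp: test_functions_def\<close>)

lemma test_functions_sum:
  "(\<And>i. i \<in> I \<Longrightarrow> \<phi> i \<in> test_functions \<Omega>) \<Longrightarrow> (\<lambda>x. \<Sum>i\<in>I. \<phi> i x) \<in> test_functions \<Omega>"
  by (induction I rule: infinite_finite_induct) (auto intro: test_functions_zero test_functions_add)

lemma iter_deriv_outside_supp:
  assumes "x \<notin> supp \<phi>"
  shows "iter_deriv es \<phi> x = 0"
proof -
  have "iter_deriv es \<phi> x = iter_deriv es (\<lambda>x. 0) x"
    using assms by (intro iter_deriv_cong[of "- supp \<phi>"]) (auto intro: not_in_supp)
  then show ?thesis
    by (simp add: iter_deriv_const_eq)
qed

lemma test_functions_iter_deriv:
  "\<phi> \<in> test_functions \<Omega> \<Longrightarrow> set es \<subseteq> Basis \<Longrightarrow> iter_deriv es \<phi> \<in> test_functions \<Omega>"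
  by (rule test_functionsI[of _ "supp \<phi>"])
    (auto simp: test_functions_def intro: smooth_on_iter_deriv iter_deriv_outside_supp)

lemma test_functions_dir_deriv:
  "\<phi> \<in> test_functions \<Omega> \<Longrightarrow> e \<in> Basis \<Longrightarrow> dir_deriv e \<phi> \<in> test_functions \<Omega>"
  using test_functions_iter_deriv[of \<phi> \<Omega> "[e]"] by simp

lemma test_functions_continuous: "\<phi> \<in> test_functions \<Omega> \<Longrightarrow> continuous_on A \<phi>"
  using smooth_on_continuous[OF test_functions_smooth] continuous_on_subset by blast

lemma test_functions_bounded:
  assumes "\<phi> \<in> test_functions \<Omega>"
  obtains B where "\<And>x. norm (\<phi> x) \<le> B" "B \<ge> 0"
proof -
  have "compact (\<phi> ` supp \<phi>)"
    using assms by (intro compact_continuous_image test_functions_continuous test_functions_compact)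
  then obtain B where B: "\<And>x. x \<in> supp \<phi> \<Longrightarrow> norm (\<phi> x) \<le> B"
    by (force simp: bounded_iff dest: compact_imp_bounded)
  show ?thesis
  proof (rule that[of "max B 0"])
    show "norm (\<phi> x) \<le> max B 0" for x
      using B[of x] not_in_supp[of x \<phi>] by (cases "x \<in> supp \<phi>") auto
  qed simp
qed

text \<open>The suprema in \<open>Ck_seminorm\<close> are taken in the reals, so they carry
  information only for bounded ranges; compact support provides the bound.\<close>

lemma iter_deriv_bdd_above:
  assumes "\<phi> \<in> test_functions \<Omega>" "set es \<subseteq> Basis"
  shows "bdd_above (range (\<lambda>x. norm (iter_deriv es \<phi> x)))"
  using test_functions_bounded[OF test_functions_iter_deriv[OF assms]] by (metis bdd_above.I2)

section \<open>The C^k seminorms\<close>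

definition multi_indices :: "nat \<Rightarrow> 'a::euclidean_space list set" where
  "multi_indices k = {es. set es \<subseteq> Basis \<and> length es \<le> k}"

lemma finite_multi_indices: "finite (multi_indices k)"
  unfolding multi_indices_def by (rule finite_lists_length_le) simp

lemma Nil_in_multi_indices: "[] \<in> multi_indices k"
  by (simp add: multi_indices_def)

lemma Ck_seminorm_alt: "Ck_seminorm k \<phi> = (\<Sum>es\<in>multi_indices k. SUP x. norm (iter_deriv es \<phi> x))"
  by (simp add: Ck_seminorm_def multi_indices_def)

lemma SUP_norm_nonneg:
  assumes "bdd_above (range (\<lambda>x. norm (h x)))"
  shows "0 \<le> (SUP x. norm (h x))"
  using cSUP_upper[OF UNIV_I assms] norm_ge_zero order_trans by blast

lemma Ck_seminorm_nonneg: "\<phi> \<in> test_functions \<Omega> \<Longrightarrow> 0 \<le> Ck_seminorm k \<phi>"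
  unfolding Ck_seminorm_alt
  by (intro sum_nonneg SUP_norm_nonneg iter_deriv_bdd_above) (auto simp: multi_indices_def)

lemma norm_iter_deriv_le_Ck_seminorm:
  assumes "\<phi> \<in> test_functions \<Omega>" "es \<in> multi_indices k"
  shows "norm (iter_deriv es \<phi> x) \<le> Ck_seminorm k \<phi>"
proof -
  have "norm (iter_deriv es \<phi> x) \<le> (SUP x. norm (iter_deriv es \<phi> x))"
    using assms by (intro cSUP_upper iter_deriv_bdd_above) (auto simp: multi_indices_def)
  also have "\<dots> \<le> Ck_seminorm k \<phi>"
    unfolding Ck_seminorm_alt using assms
    by (intro member_le_sum finite_multi_indices SUP_norm_nonneg iter_deriv_bdd_above)
      (auto simp: multi_indices_def)
  finally show ?thesis .
qed

lemma norm_le_Ck_seminorm: "\<phi> \<in> test_functions \<Omega> \<Longrightarrow> norm (\<phi> x) \<le> Ck_seminorm k \<phi>"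
  using norm_iter_deriv_le_Ck_seminorm[OF _ Nil_in_multi_indices] by simp

lemma Ck_seminorm_mono:
  assumes "\<phi> \<in> test_functions \<Omega>" "k \<le> k'"
  shows "Ck_seminorm k \<phi> \<le> Ck_seminorm k' \<phi>"
  unfolding Ck_seminorm_alt using assms
  by (intro sum_mono2 finite_multi_indices SUP_norm_nonneg iter_deriv_bdd_above)
    (auto simp: multi_indices_def)

lemma Ck_seminorm_le:
  fixes \<phi> :: "'a::euclidean_space \<Rightarrow> complex" and B :: real
  assumes "\<And>es x. es \<in> multi_indices k \<Longrightarrow> norm (iter_deriv es \<phi> x) \<le> B"
  shows "Ck_seminorm k \<phi> \<le> card (multi_indices k :: 'a list set) * B"
proof -
  have "Ck_seminorm k \<phi> \<le> (\<Sum>es\<in>(multi_indices k :: 'a list set). B)"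
    unfolding Ck_seminorm_alt using assms by (intro sum_mono cSUP_least) auto
  then show ?thesis by simp
qed

text \<open>One derivative is lost, and \<open>2 ^ Suc k\<close> counts the Leibniz terms of order k
  + 1. Bounds on \<open>b\<close> over the support of \<psi> suffice, since off the support the
  product vanishes on a neighbourhood.\<close>

lemma Ck_seminorm_dir_deriv_mult_le:
  fixes \<psi> :: "'a::euclidean_space \<Rightarrow> complex"
  assumes "\<psi> \<in> test_functions \<Omega>" "open \<Omega>" "smooth_on \<Omega> b" "e \<in> Basis" "A \<ge> 0"
    and "\<And>es x. es \<in> multi_indices (Suc k) \<Longrightarrow> x \<in> supp \<psi> \<Longrightarrow> norm (iter_deriv es b x) \<le> A"
  shows "Ck_seminorm k (dir_deriv e (\<lambda>x. b x * \<psi> x)) \<le>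
    card (multi_indices k :: 'a list set) * (2 ^ Suc k * A * Ck_seminorm (Suc k) \<psi>)"
proof (rule Ck_seminorm_le)
  fix es x assume es: "es \<in> (multi_indices k :: 'a list set)"
  show "norm (iter_deriv es (dir_deriv e (\<lambda>x. b x * \<psi> x)) x) \<le> 2 ^ Suc k * A * Ck_seminorm (Suc k) \<psi>"
  proof (cases "x \<in> supp \<psi>")
    case True
    then have x: "x \<in> \<Omega>" using assms(1) test_functions_supp by blast
    have "norm (iter_deriv (es @ [e]) (\<lambda>x. b x * \<psi> x) x) \<le> 2 ^ length (es @ [e]) * A * Ck_seminorm (Suc k) \<psi>"
      using es assms(1) True
      by (intro norm_iter_deriv_mult_le[OF assms(2) x _ assms(3) smooth_on_subset[OF test_functions_smooth]] assms(6)
         norm_iter_deriv_le_Ck_seminorm)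
        (auto simp: multi_indices_def \<open>e \<in> Basis\<close>)
    also have "\<dots> \<le> 2 ^ Suc k * A * Ck_seminorm (Suc k) \<psi>"
      using es assms Ck_seminorm_nonneg[OF assms(1)]
      by (intro mult_right_mono) (auto simp: multi_indices_def)
    finally show ?thesis by (simp add: iter_deriv_snoc)
  next
    case False
    have "supp (\<lambda>x. b x * \<psi> x) \<subseteq> supp \<psi>"
      by (intro supp_subset_closed) (auto intro: not_in_supp)
    with False have "iter_deriv (es @ [e]) (\<lambda>x. b x * \<psi> x) x = 0"
      by (intro iter_deriv_outside_supp) auto
    then show ?thesis
      using assms Ck_seminorm_nonneg[OF assms(1)] by (simp add: iter_deriv_snoc)
  qed
qed

section \<open>Distributions, partitions of unity and countable dense families\<close>

lemma
  assumes "distribution \<Omega> u"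
  shows distribution_add: "\<phi> \<in> test_functions \<Omega> \<Longrightarrow> \<psi> \<in> test_functions \<Omega> \<Longrightarrow> u (\<lambda>x. \<phi> x + \<psi> x) = u \<phi> + u \<psi>"
    and distribution_cmult: "\<phi> \<in> test_functions \<Omega> \<Longrightarrow> u (\<lambda>x. c * \<phi> x) = c * u \<phi>"
    and distribution_bound: "compact K \<Longrightarrow> K \<subseteq> \<Omega> \<Longrightarrow>
           \<exists>C k. \<forall>\<phi>\<in>test_functions \<Omega>. supp \<phi> \<subseteq> K \<longrightarrow> norm (u \<phi>) \<le> C * Ck_seminorm k \<phi>"
  using assms unfolding distribution_def by blast+

lemma distribution_sum:
  assumes "distribution \<Omega> u" "\<And>i. i \<in> I \<Longrightarrow> \<phi> i \<in> test_functions \<Omega>"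
  shows "u (\<lambda>x. \<Sum>i\<in>I. \<phi> i x) = (\<Sum>i\<in>I. u (\<phi> i))"
  using assms(2)
proof (induction I rule: infinite_finite_induct)
  case (insert i I)
  then show ?case
    using distribution_add[OF assms(1), of "\<phi> i" "\<lambda>x. \<Sum>i\<in>I. \<phi> i x"] by (simp add: test_functions_sum)
qed (use distribution_cmult[OF assms(1) test_functions_zero, of 0] in simp_all)

text \<open>The finite set \<open>C\<close> is chosen from \<open>K\<close> and \<epsilon> before
  \<psi>. This order of quantifiers allows the null sets attached to single balls to be united
  before any test function is fixed.\<close>

lemma test_function_partition:
  fixes K :: "'a::euclidean_space set"
  assumes "compact K" "\<epsilon> > 0"
  obtains C where "finite C" "C \<subseteq> K"
    "\<And>\<psi> \<Omega>. \<psi> \<in> test_functions \<Omega> \<Longrightarrow> supp \<psi> \<subseteq> K \<Longrightarrow>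
      \<exists>\<psi>s. (\<forall>c\<in>C. \<psi>s c \<in> test_functions (ball c \<epsilon>) \<and> supp (\<psi>s c) \<subseteq> supp \<psi>) \<and>
        \<psi> = (\<lambda>x. \<Sum>c\<in>C. \<psi>s c x)"
proof -
  obtain C where C: "C \<subseteq> K" "finite C" "K \<subseteq> (\<Union>c\<in>C. ball c (\<epsilon>/2))"
  proof -
    have "K \<subseteq> (\<Union>y\<in>K. ball y (\<epsilon>/2))" using assms(2) by force
    then show ?thesis
      using compactE_image[OF assms(1), of K "\<lambda>y. ball y (\<epsilon>/2)"] that by (metis open_ball)
  qed
  \<comment> \<open>\<open>B\<close> is nonzero on \<open>Q\<close>, the union of the half-radius
    balls, which contains \<open>K\<close>; dividing the bumps by \<open>B\<close> gives weights
    with sum 1 there. The radius \<epsilon>/2 leaves room for the closed supports inside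
    \<open>ball c \<epsilon>\<close>.\<close>
  define B where "B x = (\<Sum>c\<in>C. complex_of_real (bump c (\<epsilon>/2) x))" for x
  define Q where "Q = (\<Union>c\<in>C. ball c (\<epsilon>/2))"
  have B: "B x \<noteq> 0" if "x \<in> Q" for x
  proof -
    from that obtain c where c: "c \<in> C" "x \<in> ball c (\<epsilon>/2)" by (auto simp: Q_def)
    have "0 < (\<Sum>c\<in>C. bump c (\<epsilon>/2) x)"
      using c C assms(2) by (intro sum_pos2[of _ c]) (auto simp: bump_pos_iff bump_nonneg simp del: mem_ball)
    then show ?thesis unfolding B_def of_real_sum[symmetric] by (simp only: of_real_eq_0_iff)
  qed
  have Bs: "smooth_on Q (\<lambda>x. inverse (B x))"
  proof (rule smooth_on_inverse)
    show "smooth_on Q B"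
      unfolding B_def by (intro smooth_on_sum smooth_on_subset[OF smooth_on_bump]) (auto simp: Q_def)
  qed (use B in \<open>auto simp: Q_def\<close>)
  show ?thesis
  proof (rule that[OF C(2,1)])
    fix \<psi> \<Omega> assume \<psi>: "\<psi> \<in> test_functions \<Omega>" "supp \<psi> \<subseteq> K"
    define \<psi>s where "\<psi>s c x = of_real (bump c (\<epsilon>/2) x) * (inverse (B x) * \<psi> x)" for c x
    have \<psi>Q: "\<psi> \<in> test_functions Q"
      using \<psi> C(3) by (intro test_functions_mono[OF \<psi>(1)]) (auto simp: Q_def)
    have in_Q: "\<psi>s c \<in> test_functions Q" for c
      unfolding \<psi>s_def
      by (intro test_functions_mult \<psi>Q Bs smooth_on_subset[OF smooth_on_bump]) (auto simp: Q_def)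
    have sub: "supp (\<psi>s c) \<subseteq> supp \<psi>" for c
      by (intro supp_subset_closed) (auto simp: \<psi>s_def intro: not_in_supp)
    have "\<psi>s c \<in> test_functions (ball c \<epsilon>)" for c
    proof (rule test_functions_mono[OF in_Q])
      have "supp (\<psi>s c) \<subseteq> cball c (\<epsilon>/2)"
      proof (rule supp_subset_closed)
        fix x assume "x \<notin> cball c (\<epsilon>/2)"
        then have "\<not> bump c (\<epsilon>/2) x > 0" using assms(2) by (simp add: bump_pos_iff)
        with bump_nonneg[of c "\<epsilon>/2" x] show "\<psi>s c x = 0" by (simp add: \<psi>s_def)
      qed simp
      then show "supp (\<psi>s c) \<subseteq> ball c \<epsilon>"
        using assms(2) by auto
    qed
    moreover have "\<psi> x = (\<Sum>c\<in>C. \<psi>s c x)" for x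
    proof (cases "x \<in> Q")
      case True
      then show ?thesis
        using B[OF True] by (simp add: \<psi>s_def sum_distrib_right[symmetric] B_def[symmetric])
    next
      case False
      then have "\<psi> x = 0" using \<psi>Q test_functions_supp not_in_supp by blast
      then show ?thesis by (simp add: \<psi>s_def)
    qed
    ultimately show "\<exists>\<psi>s. (\<forall>c\<in>C. \<psi>s c \<in> test_functions (ball c \<epsilon>) \<and> supp (\<psi>s c) \<subseteq> supp \<psi>) \<and>
        \<psi> = (\<lambda>x. \<Sum>c\<in>C. \<psi>s c x)"
      using sub by (intro exI[of _ \<psi>s]) (simp add: fun_eq_iff)
  qed
qed

text \<open>The members of \<open>D\<close> must lie in \<open>S\<close>, so a dense set of some
  larger space does not help directly. Functions with a common modulus of continuity are sorted
  instead by their values on a finite net, rounded to a grid. There are countably many such codes,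
  and one function is kept for each. All indices in \<open>L\<close> are approximated at
  once.\<close>

lemma countable_uniformly_dense:
  fixes \<Phi> :: "'s \<Rightarrow> 'i \<Rightarrow> 'a::metric_space \<Rightarrow> complex"
  assumes "compact K" "finite L" "\<And>s i. s \<in> S \<Longrightarrow> i \<in> L \<Longrightarrow> continuous_on K (\<Phi> s i)"
  obtains D where "countable D" "D \<subseteq> S"
    "\<And>s \<epsilon>. s \<in> S \<Longrightarrow> \<epsilon> > 0 \<Longrightarrow> \<exists>s'\<in>D. \<forall>i\<in>L. \<forall>x\<in>K. dist (\<Phi> s i x) (\<Phi> s' i x) < \<epsilon>"
proof -
  have "\<exists>N. finite N \<and> N \<subseteq> K \<and> K \<subseteq> (\<Union>y\<in>N. ball y (1 / real (Suc m)))" for m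
  proof -
    have "K \<subseteq> (\<Union>y\<in>K. ball y (1 / real (Suc m)))" by force
    then show ?thesis
      using compactE_image[OF assms(1), of K "\<lambda>y. ball y (1 / real (Suc m))"] by (metis open_ball)
  qed
  from choice[OF allI[OF this]] obtain N
    where N': "\<forall>m. finite (N m) \<and> N m \<subseteq> K \<and> K \<subseteq> (\<Union>y\<in>N m. ball y (1 / real (Suc m)))"
    by (rule exE)
  then have N: "\<And>m. finite (N m)" "\<And>m. N m \<subseteq> K" "\<And>m. K \<subseteq> (\<Union>y\<in>N m. ball y (1 / real (Suc m)))"
    by (blast+)
  \<comment> \<open>\<open>A n m\<close> collects the functions that vary by less than 1/(n+1) over
    distances below 1/(m+1). For fixed n, uniform continuity puts every member of \<open>S\<close>
    into some \<open>A n m\<close>.\<close>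
  define A where "A n m = {s\<in>S. \<forall>i\<in>L. \<forall>x\<in>K. \<forall>y\<in>K. dist x y < 1 / real (Suc m) \<longrightarrow>
      dist (\<Phi> s i x) (\<Phi> s i y) < 1 / real (Suc n)}" for n m
  define code where "code n m s = restrict (\<lambda>(i, y).
      (\<lfloor>real (Suc n) * Re (\<Phi> s i y)\<rfloor>, \<lfloor>real (Suc n) * Im (\<Phi> s i y)\<rfloor>)) (L \<times> N m)" for n m s
  \<comment> \<open>One representative in \<open>A n m\<close> for each code that occurs; it lies in
    \<open>S\<close> automatically.\<close>
  define D where "D = (\<Union>n m. inv_into (A n m) (code n m) ` (code n m ` A n m))"
  have "countable (code n m ` A n m)" for n m
  proof (rule countable_subset)
    show "code n m ` A n m \<subseteq> (\<Pi>\<^sub>E _\<in>L \<times> N m. (UNIV :: (int \<times> int) set))"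
      by (intro image_subsetI) (simp only: code_def restrict_PiE_iff UNIV_I ball_triv simp_thms)
    show "countable (\<Pi>\<^sub>E _\<in>L \<times> N m. (UNIV :: (int \<times> int) set))"
      by (intro countable_PiE finite_cartesian_product assms(2) N(1) countableI_type)
  qed
  then have "countable (inv_into (A n m) (code n m) ` (code n m ` A n m))" for n m
    by (rule countable_image)
  then have "countable D" unfolding D_def by (intro countable_UN countableI_type)
  moreover have "D \<subseteq> S"
  proof -
    have "inv_into (A n m) (code n m) c \<in> A n m" if "c \<in> code n m ` A n m" for n m c
      using that by (rule inv_into_into)
    moreover have "A n m \<subseteq> S" for n m by (auto simp: A_def)
    ultimately show ?thesis unfolding D_def by blast
  qed
  moreover have "\<exists>s'\<in>D. \<forall>i\<in>L. \<forall>x\<in>K. dist (\<Phi> s i x) (\<Phi> s' i x) < \<epsilon>" if s: "s \<in> S" "\<epsilon> > 0" for s \<epsilon>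
  proof -
    \<comment> \<open>The factor 4 is 1 + 2 + 1: the oscillation of s between x and the net point y,
      the rounding errors of the real and imaginary parts at y, and the oscillation of s' from y
      back to x.\<close>
    obtain n where n: "4 / real (Suc n) < \<epsilon>"
    proof -
      obtain n where "inverse (real (Suc n)) < \<epsilon> / 4" using reals_Archimedean[of "\<epsilon>/4"] s(2) by auto
      then show ?thesis by (intro that[of n]) (simp add: field_simps)
    qed
    have "\<exists>d>0. \<forall>x\<in>K. \<forall>y\<in>K. dist x y < d \<longrightarrow> dist (\<Phi> s i x) (\<Phi> s i y) < 1 / real (Suc n)" if "i \<in> L" for i
      using compact_uniformly_continuous[OF assms(3)[OF s(1) that] assms(1)]
      unfolding uniformly_continuous_on_def
      by (drule_tac x="1 / real (Suc n)" in spec) (simp add: dist_commute)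
    then have "\<forall>i\<in>L. \<exists>d>0. \<forall>x\<in>K. \<forall>y\<in>K. dist x y < d \<longrightarrow> dist (\<Phi> s i x) (\<Phi> s i y) < 1 / real (Suc n)"
      by blast
    from bchoice[OF this] obtain d where "\<forall>i\<in>L. d i > 0 \<and>
      (\<forall>x\<in>K. \<forall>y\<in>K. dist x y < d i \<longrightarrow> dist (\<Phi> s i x) (\<Phi> s i y) < 1 / real (Suc n))"
      by (rule exE)
    then have d: "\<And>i. i \<in> L \<Longrightarrow> d i > 0"
      "\<And>i x y. i \<in> L \<Longrightarrow> x \<in> K \<Longrightarrow> y \<in> K \<Longrightarrow> dist x y < d i \<Longrightarrow> dist (\<Phi> s i x) (\<Phi> s i y) < 1 / real (Suc n)"
      by blast+
    have "\<exists>d'>0. \<forall>i\<in>L. d' \<le> d i"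
      using d(1) assms(2) by (intro exI[of _ "Min (insert 1 (d ` L))"]) auto
    then obtain d' where d': "d' > 0" "\<And>i. i \<in> L \<Longrightarrow> d' \<le> d i" by auto
    obtain m where m: "inverse (real (Suc m)) < d'" using reals_Archimedean[OF d'(1)] by auto
    have sA: "s \<in> A n m"
      unfolding A_def
    proof (intro CollectI conjI ballI impI s(1))
      fix i x y assume *: "i \<in> L" "x \<in> K" "y \<in> K" "dist x y < 1 / real (Suc m)"
      then have "dist x y < d i" using m d'(2)[of i] by (simp add: inverse_eq_divide)
      with * show "dist (\<Phi> s i x) (\<Phi> s i y) < 1 / real (Suc n)" by (intro d(2))
    qed
    define s' where "s' = inv_into (A n m) (code n m) (code n m s)"
    have s'A: "s' \<in> A n m" and code: "code n m s' = code n m s"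
      using sA by (auto simp: s'_def intro: inv_into_into f_inv_into_f)
    have "s' \<in> D" using sA by (auto simp: D_def s'_def)
    moreover have "dist (\<Phi> s i x) (\<Phi> s' i x) < \<epsilon>" if i: "i \<in> L" and x: "x \<in> K" for i x
    proof -
      obtain y where y: "y \<in> N m" "dist y x < 1 / real (Suc m)" using N(3)[of m] x by auto
      have yK: "y \<in> K" using y N(2) by auto
      have fl: "\<bar>a - b\<bar> \<le> 1 / real (Suc n)" if "\<lfloor>real (Suc n) * a\<rfloor> = \<lfloor>real (Suc n) * b\<rfloor>" for a b
      proof -
        have "\<bar>real (Suc n) * a - real (Suc n) * b\<bar> < 1" using that by linarith
        then have "real (Suc n) * \<bar>a - b\<bar> < 1"
          by (metis abs_mult abs_of_nat right_diff_distrib)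
        then show ?thesis by (simp add: field_simps)
      qed
      have "code n m s' (i, y) = code n m s (i, y)" using code by simp
      then have eq: "\<lfloor>real (Suc n) * Re (\<Phi> s i y)\<rfloor> = \<lfloor>real (Suc n) * Re (\<Phi> s' i y)\<rfloor>"
        "\<lfloor>real (Suc n) * Im (\<Phi> s i y)\<rfloor> = \<lfloor>real (Suc n) * Im (\<Phi> s' i y)\<rfloor>"
        using i y by (simp_all add: code_def del: of_nat_Suc)
      have "\<bar>Re (\<Phi> s i y - \<Phi> s' i y)\<bar> \<le> 1 / real (Suc n)" "\<bar>Im (\<Phi> s i y - \<Phi> s' i y)\<bar> \<le> 1 / real (Suc n)"
        using fl[OF eq(1)] fl[OF eq(2)] by simp_all
      then have "dist (\<Phi> s i y) (\<Phi> s' i y) \<le> 2 / real (Suc n)"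
        using cmod_le[of "\<Phi> s i y - \<Phi> s' i y"] by (simp add: dist_norm)
      moreover have "dist (\<Phi> s i x) (\<Phi> s i y) < 1 / real (Suc n)" "dist (\<Phi> s' i x) (\<Phi> s' i y) < 1 / real (Suc n)"
        using sA s'A i x yK y by (auto simp: A_def dist_commute)
      moreover have "dist (\<Phi> s i x) (\<Phi> s' i x) \<le> dist (\<Phi> s i x) (\<Phi> s i y) + dist (\<Phi> s i y) (\<Phi> s' i y) + dist (\<Phi> s' i x) (\<Phi> s' i y)"
        using dist_triangle[of "\<Phi> s i x" "\<Phi> s' i x" "\<Phi> s i y"] dist_triangle[of "\<Phi> s i y" "\<Phi> s' i x" "\<Phi> s' i y"]
        by (simp add: dist_commute)
      moreover have "2 / real (Suc n) = 2 * (1 / real (Suc n))" "4 / real (Suc n) = 4 * (1 / real (Suc n))"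
        by simp_all
      ultimately have "dist (\<Phi> s i x) (\<Phi> s' i x) < 4 / real (Suc n)" by linarith
      then show ?thesis using n by simp
    qed
    ultimately show ?thesis by blast
  qed
  ultimately show ?thesis using that by blast
qed

text \<open>All derivatives up to order k are approximated simultaneously on \<open>K\<close>; off
  \<open>K\<close> they vanish for both functions. The difference is written as a sum with a
  multiple by -1 to match the linearity lemmas for distributions.\<close>

lemma countable_Ck_dense:
  fixes K :: "'a::euclidean_space set"
  assumes "compact K"
  obtains D where "countable D" "D \<subseteq> {\<phi>\<in>test_functions \<Omega>. supp \<phi> \<subseteq> K}"
    "\<And>\<phi> \<epsilon>. \<phi> \<in> test_functions \<Omega> \<Longrightarrow> supp \<phi> \<subseteq> K \<Longrightarrow> \<epsilon> > 0 \<Longrightarrow>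
       \<exists>\<phi>'\<in>D. Ck_seminorm k (\<lambda>x. \<phi> x + (-1) * \<phi>' x) < \<epsilon>"
proof -
  let ?S = "{\<phi>\<in>test_functions \<Omega>. supp \<phi> \<subseteq> K}"
  let ?n = "real (card (multi_indices k :: 'a list set))"
  have "continuous_on K (iter_deriv es \<phi>)" if "\<phi> \<in> ?S" "es \<in> multi_indices k" for \<phi> es
    using that test_functions_continuous[OF test_functions_iter_deriv] by (auto simp: multi_indices_def)
  from countable_uniformly_dense[of K "multi_indices k" ?S "\<lambda>\<phi> es. iter_deriv es \<phi>", OF assms finite_multi_indices this]
  obtain D where D: "countable D" "D \<subseteq> ?S"
    "\<And>\<phi> \<epsilon>. \<phi> \<in> ?S \<Longrightarrow> \<epsilon> > 0 \<Longrightarrow>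
      \<exists>\<phi>'\<in>D. \<forall>es\<in>multi_indices k. \<forall>x\<in>K. dist (iter_deriv es \<phi> x) (iter_deriv es \<phi>' x) < \<epsilon>"
    by blast
  show ?thesis
  proof (rule that[OF D(1,2)])
    fix \<phi> and \<epsilon> :: real assume \<phi>: "\<phi> \<in> test_functions \<Omega>" "supp \<phi> \<subseteq> K" and \<epsilon>: "\<epsilon> > 0"
    \<comment> \<open>The seminorm is a sum over \<open>?n\<close> multi-indices; the extra 1 makes
      the final inequality strict.\<close>
    define \<delta> where "\<delta> = \<epsilon> / (?n + 1)"
    have \<delta>: "\<delta> > 0" "?n * \<delta> < \<epsilon>" using \<epsilon> by (auto simp: \<delta>_def field_simps)
    obtain \<phi>' where \<phi>': "\<phi>' \<in> D"
      "\<And>es x. es \<in> multi_indices k \<Longrightarrow> x \<in> K \<Longrightarrow> dist (iter_deriv es \<phi> x) (iter_deriv es \<phi>' x) < \<delta>"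
      using D(3)[of \<phi> \<delta>] \<phi> \<delta> by blast
    have \<phi>'S: "\<phi>' \<in> test_functions \<Omega>" "supp \<phi>' \<subseteq> K" using \<phi>'(1) D(2) by auto
    have "Ck_seminorm k (\<lambda>x. \<phi> x + (-1) * \<phi>' x) \<le> ?n * \<delta>"
    proof (rule Ck_seminorm_le)
      fix es x assume es: "es \<in> (multi_indices k :: 'a list set)"
      then have B: "set es \<subseteq> Basis" by (auto simp: multi_indices_def)
      have s: "smooth_on UNIV \<phi>" "smooth_on UNIV \<phi>'" using \<phi> \<phi>'S test_functions_smooth by auto
      have "iter_deriv es (\<lambda>x. \<phi> x + (-1) * \<phi>' x) x = iter_deriv es \<phi> x + iter_deriv es (\<lambda>x. (-1) * \<phi>' x) x"
        by (rule iter_deriv_add[OF open_UNIV s(1) smooth_on_mult[OF open_UNIV smooth_on_const s(2)] B UNIV_I])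
      also have "iter_deriv es (\<lambda>x. (-1) * \<phi>' x) x = (-1) * iter_deriv es \<phi>' x"
        by (rule iter_deriv_cmult[OF open_UNIV s(2) B UNIV_I])
      finally have eq: "norm (iter_deriv es (\<lambda>x. \<phi> x + (-1) * \<phi>' x) x) = dist (iter_deriv es \<phi> x) (iter_deriv es \<phi>' x)"
        by (simp add: dist_norm)
      show "norm (iter_deriv es (\<lambda>x. \<phi> x + (-1) * \<phi>' x) x) \<le> \<delta>"
      proof (cases "x \<in> K")
        case True
        then show ?thesis unfolding eq using \<phi>'(2)[OF es True] by simp
      next
        case False
        then have "iter_deriv es \<phi> x = 0" "iter_deriv es \<phi>' x = 0"
          using \<phi>(2) \<phi>'S(2) by (auto intro!: iter_deriv_outside_supp)
        then show ?thesis unfolding eq using \<delta>(1) by simp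
      qed
    qed
    with \<delta>(2) have "Ck_seminorm k (\<lambda>x. \<phi> x + (-1) * \<phi>' x) < \<epsilon>" by linarith
    with \<phi>'(1) show "\<exists>\<phi>'\<in>D. Ck_seminorm k (\<lambda>x. \<phi> x + (-1) * \<phi>' x) < \<epsilon>" by blast
  qed
qed

text \<open>A smooth substitute for the indicator of (p, q), found without convolution: if E > 0
  exactly on (p, q), then n E / (1 + n E) is smooth, stays in [0, 1] and tends to the indicator as n
  grows.\<close>

definition plateau :: "real \<Rightarrow> real \<Rightarrow> nat \<Rightarrow> real \<Rightarrow> real" where
  "plateau p q n t = real n * flat_exp 0 ((t - p) * (q - t)) / (1 + real n * flat_exp 0 ((t - p) * (q - t)))"

lemma plateau_range: "0 \<le> plateau p q n t" "plateau p q n t \<le> 1"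
  using mult_nonneg_nonneg[OF of_nat_0_le_iff[of n] flat_exp_nonneg[of 0 "(t - p) * (q - t)"]]
  by (auto simp: plateau_def divide_simps)

lemma plateau_outside: "t \<notin> {p<..<q} \<Longrightarrow> p < q \<Longrightarrow> plateau p q n t = 0"
  by (auto simp: plateau_def flat_exp_def zero_less_mult_iff)

lemma plateau_tendsto:
  assumes "p < q"
  shows "(\<lambda>n. plateau p q n t) \<longlonglongrightarrow> indicator {p<..<q} t"
proof (cases "t \<in> {p<..<q}")
  case True
  define E where "E = flat_exp 0 ((t - p) * (q - t))"
  have "E > 0" using True by (simp add: E_def flat_exp_pos_iff)
  have "filterlim (\<lambda>n. 1 + real n * E) at_top sequentially"
    by (intro filterlim_tendsto_add_at_top[OF tendsto_const] filterlim_at_top_mult_tendsto_pos[OF tendsto_const]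
        filterlim_real_sequentially \<open>E > 0\<close>)
  then have "(\<lambda>n. 1 - 1 / (1 + real n * E)) \<longlonglongrightarrow> 1 - 0"
    by (intro tendsto_diff tendsto_const real_tendsto_divide_at_top[OF tendsto_const])
  moreover have "1 - 1 / (1 + real n * E) = real n * E / (1 + real n * E)" for n
  proof -
    have "1 + real n * E > 0" using \<open>E > 0\<close> by (intro add_pos_nonneg) auto
    then show ?thesis by (simp add: field_simps)
  qed
  ultimately have "(\<lambda>n. real n * E / (1 + real n * E)) \<longlonglongrightarrow> 1"
    by simp
  with True show ?thesis by (simp add: plateau_def E_def[symmetric])
next
  case False
  then show ?thesis using plateau_outside[OF False assms] by simp
qed

lemma plateau_test:
  assumes "p < q" "{p..q} \<subseteq> \<Omega>"
  shows "(\<lambda>t. of_real (plateau p q n t)) \<in> test_functions \<Omega>"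
proof (rule test_functionsI[OF _ compact_Icc assms(2)])
  let ?E = "\<lambda>t. complex_of_real (flat_exp 0 ((t - p) * (q - t)))"
  have E: "smooth_on UNIV ?E"
  proof (rule smooth_on_flat_exp[OF open_UNIV])
    have "(\<lambda>t. complex_of_real ((t - p) * (q - t))) =
        (\<lambda>t. (of_real (t \<bullet> 1) + of_real (- p)) * (of_real q + of_real (t \<bullet> (-1))))"
      by (simp add: fun_eq_iff)
    then show "smooth_on UNIV (\<lambda>t. complex_of_real ((t - p) * (q - t)))"
      by (simp only:) (intro smooth_on_add smooth_on_mult smooth_on_inner smooth_on_const open_UNIV)
  qed
  have "(\<lambda>t. complex_of_real (plateau p q n t)) = (\<lambda>t. of_nat n * ?E t * inverse (1 + of_nat n * ?E t))"
    by (auto simp: plateau_def divide_inverse)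
  moreover have "1 + of_nat n * ?E t \<noteq> 0" for t
  proof -
    have "0 < 1 + real n * flat_exp 0 ((t - p) * (q - t))"
      by (intro add_pos_nonneg mult_nonneg_nonneg flat_exp_nonneg) auto
    then have "complex_of_real (1 + real n * flat_exp 0 ((t - p) * (q - t))) \<noteq> 0"
      by (subst of_real_eq_0_iff) linarith
    then show ?thesis by simp
  qed
  ultimately show "smooth_on UNIV (\<lambda>t. complex_of_real (plateau p q n t))"
    using E by (simp only:) (intro smooth_on_add smooth_on_mult smooth_on_inverse smooth_on_const open_UNIV; simp)
qed (use assms plateau_outside in auto)

section \<open>The lemma of du Bois-Reymond\<close>

lemma lebesgue_borel_representative:
  fixes f :: "'a::euclidean_space \<Rightarrow> complex"
  assumes "f \<in> borel_measurable lebesgue"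
  obtains f' where "f' \<in> borel_measurable borel" "AE x in lborel. f x = f' x"
proof -
  have "(\<lambda>x. Re (f x)) \<in> borel_measurable lebesgue" "(\<lambda>x. Im (f x)) \<in> borel_measurable lebesgue"
    using assms by auto
  from this[THEN completion_ex_borel_measurable_real] obtain r i where
    ri: "r \<in> borel_measurable lborel" "AE x in lborel. Re (f x) = r x"
      "i \<in> borel_measurable lborel" "AE x in lborel. Im (f x) = i x"
    by blast
  show ?thesis
  proof (rule that)
    show "(\<lambda>x. Complex (r x) (i x)) \<in> borel_measurable borel"
      using ri(1,3) unfolding Complex_eq by simp
    show "AE x in lborel. f x = Complex (r x) (i x)"
      using ri(2,4) by eventually_elim (simp add: complex_eq_iff)
  qed
qed

lemma lebesgue_AE_lborel: "(AE x in lebesgue. P x) \<longleftrightarrow> (AE x in lborel. P x)"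
  by (rule AE_completion_iff)

lemma lebesgue_integral_AE_eq:
  fixes f g :: "'a::euclidean_space \<Rightarrow> complex"
  assumes "AE x in lborel. f x = g x" "g \<in> borel_measurable borel"
  shows "integrable lebesgue f \<longleftrightarrow> integrable lborel g"
    and "integral\<^sup>L lebesgue f = integral\<^sup>L lborel g"
proof -
  have g: "g \<in> borel_measurable lebesgue"
    using assms(2) by (simp add: measurable_completion)
  have AE: "AE x in lebesgue. f x = g x" "AE x in lebesgue. g x = f x"
    using assms(1) by (auto simp: lebesgue_AE_lborel eq_commute)
  have f: "f \<in> borel_measurable lebesgue"
    by (rule borel_measurable_AE[OF g AE(2)])
  have "integrable lebesgue f \<longleftrightarrow> integrable lebesgue g"
    by (rule integrable_cong_AE[OF f g AE(1)])
  then show "integrable lebesgue f \<longleftrightarrow> integrable lborel g"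
    using assms(2) by (simp add: integrable_completion)
  have "integral\<^sup>L lebesgue f = integral\<^sup>L lebesgue g"
    by (rule integral_cong_AE[OF f g AE(1)])
  then show "integral\<^sup>L lebesgue f = integral\<^sup>L lborel g"
    using assms(2) by (simp add: integral_completion)
qed

text \<open>The completed product measure is not the product of the completed measures, so Fubini is
  applied to a Borel representative. The integral over x is the inner one, which later gives slices
  at fixed time.\<close>

lemma lebesgue_Fubini:
  fixes F :: "'a::euclidean_space \<times> 'b::euclidean_space \<Rightarrow> complex"
  assumes "integrable lebesgue F"
  shows "AE y in lebesgue. integrable lebesgue (\<lambda>x. F (x, y))"
    and "integrable lebesgue (\<lambda>y. LINT x|lebesgue. F (x, y))"
    and "(LINT y|lebesgue. LINT x|lebesgue. F (x, y)) = integral\<^sup>L lebesgue F"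
proof -
  obtain F' where F': "F' \<in> borel_measurable borel" "AE z in lborel. F z = F' z"
    using lebesgue_borel_representative[OF borel_measurable_integrable[OF assms]] by blast
  have int: "integrable lborel F'"
    using assms lebesgue_integral_AE_eq(1)[OF F'(2,1)] by simp
  then have int': "integrable (lborel \<Otimes>\<^sub>M lborel) (\<lambda>(x, y). F' (x, y))"
    by (simp add: lborel_prod split_def)
  \<comment> \<open>The set where F and F' differ need not be Borel. It is enclosed in a Borel null
    set, because exchanging the two AE quantifiers requires measurability.\<close>
  obtain N where N: "N \<in> null_sets lborel" "{z. F z \<noteq> F' z} \<subseteq> N"
    using F'(2) by (auto elim!: AE_E simp: null_sets_def)
  have Nm: "N \<in> sets (lborel \<Otimes>\<^sub>M lborel)"
    using N(1) unfolding lborel_prod by auto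
  have "AE z in (lborel :: ('a \<times> 'b) measure). z \<notin> N" using N(1) by (rule AE_not_in)
  then have "AE z in (lborel :: 'a measure) \<Otimes>\<^sub>M (lborel :: 'b measure). z \<notin> N"
    unfolding lborel_prod .
  then have "AE x in (lborel :: 'a measure). AE y in (lborel :: 'b measure). (x, y) \<notin> N"
    by (rule lborel_pair.AE_pair)
  moreover have "{z \<in> space (lborel \<Otimes>\<^sub>M lborel). (fst z, snd z) \<notin> N} \<in> sets (lborel \<Otimes>\<^sub>M lborel)"
  proof -
    have "{z \<in> space (lborel \<Otimes>\<^sub>M lborel). (fst z, snd z) \<notin> N} = space (lborel \<Otimes>\<^sub>M lborel) - N"
      by auto
    then show ?thesis using sets.compl_sets[OF Nm] by (simp only:)
  qed
  ultimately have AE: "AE y in (lborel :: 'b measure). AE x in (lborel :: 'a measure). (x, y) \<notin> N"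
    by (subst (asm) lborel_pair.AE_commute)
  have sl: "(\<lambda>x. F' (x, y)) \<in> borel_measurable borel" for y
    using F'(1) by measurable
  have eq: "AE y in lborel. (integrable lebesgue (\<lambda>x. F (x, y)) \<longleftrightarrow> integrable lborel (\<lambda>x. F' (x, y))) \<and>
      (LINT x|lebesgue. F (x, y)) = (LINT x|lborel. F' (x, y))"
    using AE
  proof eventually_elim
    case (elim y)
    have "AE x in lborel. F (x, y) = F' (x, y)"
      using elim by eventually_elim (use N(2) in auto)
    from lebesgue_integral_AE_eq[OF this sl] show ?case by simp
  qed
  have "AE y in lborel. integrable lborel (\<lambda>x. F' (x, y))"
    using lborel_pair.AE_integrable_snd[of "\<lambda>x y. F' (x, y)"] int' by simp
  then show "AE y in lebesgue. integrable lebesgue (\<lambda>x. F (x, y))"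
    unfolding lebesgue_AE_lborel using eq by eventually_elim simp
  have int2: "integrable lborel (\<lambda>y. LINT x|lborel. F' (x, y))"
    using lborel_pair.integrable_snd[of "\<lambda>x y. F' (x, y)"] int' by simp
  have eq': "AE y in lborel. (LINT x|lebesgue. F (x, y)) = (LINT x|lborel. F' (x, y))"
    using eq by eventually_elim simp
  note * = lebesgue_integral_AE_eq[OF eq' borel_measurable_integrable[OF int2, simplified]]
  show "integrable lebesgue (\<lambda>y. LINT x|lebesgue. F (x, y))"
    using *(1) int2 by simp
  have "(LINT y|lborel. LINT x|lborel. F' (x, y)) = integral\<^sup>L (lborel \<Otimes>\<^sub>M lborel) (\<lambda>(x, y). F' (x, y))"
    using lborel_pair.integral_snd[of "\<lambda>x y. F' (x, y)"] int' by simp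
  also have "\<dots> = integral\<^sup>L lborel F'"
    by (simp add: lborel_prod split_def)
  also have "\<dots> = integral\<^sup>L lebesgue F"
    using lebesgue_integral_AE_eq(2)[OF F'(2,1)] by simp
  finally show "(LINT y|lebesgue. LINT x|lebesgue. F (x, y)) = integral\<^sup>L lebesgue F"
    using *(2) by simp
qed

text \<open>Closed intervals generate the Borel sets, and the sets over which v integrates to 0 are
  closed under complements and countable disjoint unions; a function with vanishing integral over
  every Borel set is 0 almost everywhere. This is done inside compact subintervals, countably many
  of which fill the open one.\<close>

lemma AE_zero_if_interval_integrals_zero:
  fixes v :: "real \<Rightarrow> complex"
  assumes v: "integrable lborel v"
    and zero: "\<And>p q. \<alpha> < p \<Longrightarrow> p < q \<Longrightarrow> q < \<beta> \<Longrightarrow> (LINT t:{p<..<q}|lborel. v t) = 0"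
  shows "AE t in lborel. t \<in> {\<alpha><..<\<beta>} \<longrightarrow> v t = 0"
proof -
  \<comment> \<open>Degenerate intervals are included, since intersecting [a, b] with [p, q] may
    leave a point or nothing.\<close>
  have closed: "(LINT t:{p..q}|lborel. v t) = 0" if "\<alpha> < p" "q < \<beta>" for p q
  proof (cases "p < q")
    case True
    have "(LINT t:{p..q}|lborel. v t) = (LINT t:{p<..<q}|lborel. v t)"
    proof (rule set_integral_cong_set)
      show "AE x in lborel. (x \<in> {p<..<q}) = (x \<in> {p..q})"
        using AE_lborel_singleton[of p] AE_lborel_singleton[of q] by eventually_elim auto
    qed (use borel_measurable_integrable[OF v] in \<open>auto simp: set_borel_measurable_def\<close>)
    then show ?thesis using zero True that by simp
  next
    case False
    have "AE x in lborel. indicator {p..q} x *\<^sub>R v x = 0"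
      using AE_lborel_singleton[of p] by eventually_elim (use False in \<open>auto simp: indicator_def\<close>)
    then show ?thesis
      unfolding set_lebesgue_integral_def by (rule integral_eq_zero_AE)
  qed
  have "AE t in lborel. indicator {p..q} t *\<^sub>R v t = 0" if pq: "\<alpha> < p" "q < \<beta>" for p q
  proof (rule sigma_finite_measure.density_zero[OF sigma_finite_lborel])
    let ?v = "\<lambda>t. indicator {p..q} t *\<^sub>R v t"
    show int: "integrable lborel ?v"
      using v by (intro integrable_mult_indicator) auto
    have set_int: "set_integrable lborel A ?v" if "A \<in> sets borel" for A
      unfolding set_integrable_def using v that by (intro integrable_mult_indicator) auto
    \<comment> \<open>The integral over a complement is the total minus the integral over the set,
      so the total must be 0 as well.\<close>
    have whole: "(LINT t|lborel. ?v t) = 0"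
      using closed[OF pq] by (simp add: set_lebesgue_integral_def)
    fix A :: "real set" assume "A \<in> sets lborel"
    then have "A \<in> sets borel" by simp
    then show "set_lebesgue_integral lborel A ?v = 0"
    proof (induction A rule: borel_set_induct)
      case empty
      show ?case by (simp add: set_lebesgue_integral_def)
    next
      case (interval a b)
      have "set_lebesgue_integral lborel {a..b} ?v = (LINT t:{max a p..min b q}|lborel. v t)"
        unfolding set_lebesgue_integral_def by (intro Bochner_Integration.integral_cong) (auto simp: indicator_def)
      then show ?case using closed[of "max a p" "min b q"] pq by simp
    next
      case (compl A)
      have "0 = set_lebesgue_integral lborel (A \<union> (- A)) ?v"
        using whole by (simp add: set_lebesgue_integral_def)
      also have "\<dots> = set_lebesgue_integral lborel A ?v + set_lebesgue_integral lborel (- A) ?v"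
        using compl by (intro set_integral_Un set_int) auto
      finally show ?case using compl by simp
    next
      case (union A)
      have "set_lebesgue_integral lborel (\<Union>i. A i) ?v = (\<Sum>i. set_lebesgue_integral lborel (A i) ?v)"
        using union by (intro lebesgue_integral_countable_add set_int) (auto simp: disjoint_family_on_def)
      then show ?case using union by simp
    qed
  qed
  then have "AE t in lborel. \<forall>n::nat. indicator {\<alpha> + 1 / real (Suc n)..\<beta> - 1 / real (Suc n)} t *\<^sub>R v t = 0"
    unfolding AE_all_countable by simp
  then show ?thesis
  proof eventually_elim
    case (elim t)
    show ?case
    proof
      assume t: "t \<in> {\<alpha><..<\<beta>}"
      then have "min (t - \<alpha>) (\<beta> - t) > 0" by auto
      then obtain n where n: "inverse (real (Suc n)) < min (t - \<alpha>) (\<beta> - t)"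
        using reals_Archimedean by blast
      then have "t \<in> {\<alpha> + 1 / real (Suc n)..\<beta> - 1 / real (Suc n)}"
        unfolding inverse_eq_divide by (simp del: of_nat_Suc)
      then show "v t = 0" using elim[rule_format, of n] by (simp del: of_nat_Suc)
    qed
  qed
qed

text \<open>Plateau functions turn test functions into indicators of intervals, by dominated
  convergence with majorant |v|.\<close>

lemma AE_zero_if_test_integrals_zero:
  fixes v :: "real \<Rightarrow> complex"
  assumes v: "integrable lborel v"
    and zero: "\<And>\<omega>. \<omega> \<in> test_functions {\<alpha><..<\<beta>} \<Longrightarrow> (LINT t|lborel. v t * \<omega> t) = 0"
  shows "AE t in lborel. t \<in> {\<alpha><..<\<beta>} \<longrightarrow> v t = 0"
proof (rule AE_zero_if_interval_integrals_zero[OF v])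
  fix p q assume pq: "\<alpha> < p" "p < q" "q < \<beta>"
  let ?P = "\<lambda>n t. complex_of_real (plateau p q n t)"
  have test: "?P n \<in> test_functions {\<alpha><..<\<beta>}" for n
    using pq by (intro plateau_test) auto
  have [measurable]: "v \<in> borel_measurable borel" using v by auto
  have Pm [measurable]: "?P n \<in> borel_measurable borel" for n
    by (intro borel_measurable_continuous_onI test_functions_continuous[OF test])
  have "(\<lambda>n. LINT t|lborel. v t * ?P n t) \<longlonglongrightarrow> (LINT t|lborel. v t * of_real (indicator {p<..<q} t))"
  proof (rule integral_dominated_convergence[where w = "\<lambda>t. norm (v t)"])
    show "AE t in lborel. (\<lambda>n. v t * ?P n t) \<longlonglongrightarrow> v t * of_real (indicator {p<..<q} t)"
      using plateau_tendsto[OF pq(2)] by (intro AE_I2 tendsto_intros) auto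
    show "AE t in lborel. norm (v t * ?P n t) \<le> norm (v t)" for n
      using plateau_range[of p q n] by (auto simp: norm_mult intro!: mult_left_le)
  qed (use v in auto)
  moreover have "(LINT t|lborel. v t * ?P n t) = 0" for n
    by (rule zero[OF test])
  ultimately have "(LINT t|lborel. v t * of_real (indicator {p<..<q} t)) = 0"
    by (simp add: LIMSEQ_const_iff)
  then show "(LINT t:{p<..<q}|lborel. v t) = 0"
    by (simp add: set_lebesgue_integral_def scaleR_conv_of_real mult.commute)
qed

section \<open>Primitives of test functions and weak derivatives on an interval\<close>

lemma compact_in_open_interval:
  fixes K :: "real set"
  assumes "compact K" "K \<subseteq> {\<alpha><..<\<beta>}" "\<alpha> < \<beta>"
  obtains p q where "\<alpha> < p" "p < q" "q < \<beta>" "K \<subseteq> {p..q}"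
proof (cases "K = {}")
  case True
  obtain p where p: "\<alpha> < p" "p < \<beta>" using dense assms(3) by blast
  obtain q where "p < q" "q < \<beta>" using dense p(2) by blast
  then show ?thesis using that p True by blast
next
  case False
  obtain l where l: "l \<in> K" "\<forall>x\<in>K. l \<le> x" using compact_attains_inf[OF assms(1) False] by blast
  obtain u where u: "u \<in> K" "\<forall>x\<in>K. x \<le> u" using compact_attains_sup[OF assms(1) False] by blast
  obtain p where p: "\<alpha> < p" "p < l" using dense l(1) assms(2) by (metis greaterThanLessThan_iff subsetD)
  obtain q where q: "u < q" "q < \<beta>" using dense u(1) assms(2) by (metis greaterThanLessThan_iff subsetD)
  have "K \<subseteq> {p..q}"
  proof
    fix x assume "x \<in> K"
    then have "l \<le> x" "x \<le> u" using l u by auto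
    then show "x \<in> {p..q}" using p q by auto
  qed
  moreover have "p < q" using l u p q by force
  ultimately show ?thesis using that p q by blast
qed

lemma test_function_integrable: "\<omega> \<in> test_functions \<Omega> \<Longrightarrow> integrable lborel \<omega>"
  for \<omega> :: "'a::euclidean_space \<Rightarrow> complex"
proof -
  assume \<omega>: "\<omega> \<in> test_functions \<Omega>"
  have "set_integrable lborel (supp \<omega>) \<omega>"
    unfolding set_integrable_def
    by (rule borel_integrable_compact[OF test_functions_compact[OF \<omega>] test_functions_continuous[OF \<omega>]])
  moreover have "(\<lambda>x. indicator (supp \<omega>) x *\<^sub>R \<omega> x) = \<omega>"
  proof
    show "indicator (supp \<omega>) x *\<^sub>R \<omega> x = \<omega> x" for x
      using not_in_supp[of x \<omega>] by (cases "x \<in> supp \<omega>") auto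
  qed
  ultimately show ?thesis by (simp add: set_integrable_def)
qed

text \<open>To the left of the support of w the primitive is 0; to the right it equals the total
  integral, so mean value zero is exactly what gives compact support.\<close>

lemma test_function_antiderivative:
  fixes w :: "real \<Rightarrow> complex"
  assumes w: "w \<in> test_functions {\<alpha><..<\<beta>}" and "(LINT t|lborel. w t) = 0" and "\<alpha> < \<beta>"
  defines "\<eta> \<equiv> (\<lambda>s. LINT t:{..s}|lborel. w t)"
  shows "\<eta> \<in> test_functions {\<alpha><..<\<beta>}" and "dir_deriv 1 \<eta> = w"
proof -
  obtain p q where pq: "\<alpha> < p" "p < q" "q < \<beta>" "supp w \<subseteq> {p..q}"
    using compact_in_open_interval[OF test_functions_compact[OF w] test_functions_supp[OF w] \<open>\<alpha> < \<beta>\<close>] by blast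
  have w0: "w t = 0" if "t \<notin> {p..q}" for t
    using that pq(4) by (intro not_in_supp) auto
  have \<eta>: "\<eta> s = integral {a..s} w" if "a < p" for a s
  proof -
    have "\<eta> s = (LINT t:{a..s}|lborel. w t)"
      unfolding \<eta>_def set_lebesgue_integral_def
      by (intro Bochner_Integration.integral_cong) (use w0 that in \<open>auto simp: indicator_def\<close>)
    also have "\<dots> = integral {a..s} w"
      by (intro set_borel_integral_eq_integral)
        (auto simp: set_integrable_def intro!: integrable_mult_indicator test_function_integrable[OF w])
    finally show ?thesis .
  qed
  have "(\<eta> has_vector_derivative w s) (at s)" for s
  proof -
    \<comment> \<open>A base point left of both s and the support: the integral from minus infinity
      becomes one over a bounded interval that has s in its interior.\<close>
    define a where "a = min p s - 1"
    have "((\<lambda>u. integral {a..u} w) has_vector_derivative w s) (at s within {a..s + 1})"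
      by (intro integral_has_vector_derivative test_functions_continuous[OF w]) (auto simp: a_def)
    then have "((\<lambda>u. integral {a..u} w) has_vector_derivative w s) (at s)"
      by (subst (asm) at_within_Icc_at) (auto simp: a_def)
    moreover have "\<eta> = (\<lambda>u. integral {a..u} w)"
      using \<eta>[of a] by (auto simp: a_def)
    ultimately show ?thesis by simp
  qed
  then have d: "(\<eta> has_derivative (\<lambda>e. e *\<^sub>R w s)) (at s)" for s
    by (simp add: has_vector_derivative_def)
  show D: "dir_deriv 1 \<eta> = w"
    using dir_deriv_eqI[OF d] by auto
  show "\<eta> \<in> test_functions {\<alpha><..<\<beta>}"
  proof (rule test_functionsI[of _ "{p..q}"])
    show "smooth_on UNIV \<eta>"
      using d D test_functions_smooth[OF w] by (subst smooth_on_iff_dir_deriv) (auto simp: differentiable_def)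
    fix s assume "s \<notin> {p..q}"
    then consider "s < p" | "s > q" by force
    then show "\<eta> s = 0"
    proof cases
      case 1
      have "\<eta> s = (LINT t|(lborel :: real measure). 0)"
        unfolding \<eta>_def set_lebesgue_integral_def
        by (intro Bochner_Integration.integral_cong) (use w0 1 in \<open>auto simp: indicator_def\<close>)
      then show ?thesis by simp
    next
      case 2
      have "\<eta> s = (LINT t|lborel. w t)"
        unfolding \<eta>_def set_lebesgue_integral_def
        by (intro Bochner_Integration.integral_cong) (use w0 2 in \<open>auto simp: indicator_def\<close>)
      then show ?thesis using assms by simp
    qed
  qed (use pq in auto)
qed

text \<open>Fubini on the triangle \<^term>\<open>\<alpha> \<le> s \<and> s \<le> t\<close> replaces integration by parts.\<close>

lemma integral_primitive_mult_test:
  fixes k :: "real \<Rightarrow> complex"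
  assumes k: "integrable lborel k"
    and w: "w \<in> test_functions {\<alpha><..<\<beta>}" "(LINT t|lborel. w t) = 0" "\<alpha> < \<beta>"
  shows "integrable lborel (\<lambda>t. (LINT s:{\<alpha>..t}|lborel. k s) * w t)"
    and "(LINT t|lborel. (LINT s:{\<alpha>..t}|lborel. k s) * w t) = - (LINT s|lborel. k s * (LINT t:{..s}|lborel. w t))"
proof -
  define G :: "real \<Rightarrow> real \<Rightarrow> complex"
    where "G = (\<lambda>s t. of_bool (\<alpha> \<le> s \<and> s \<le> t) * (k s * w t))"
  have [measurable]: "k \<in> borel_measurable borel" "w \<in> borel_measurable borel"
    using k test_function_integrable[OF w(1)] by auto
  have wi: "integrable lborel w" by (rule test_function_integrable[OF w(1)])
  have "integrable (lborel \<Otimes>\<^sub>M lborel) (\<lambda>(s, t). k s * w t)"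
  proof (rule lborel_pair.Fubini_integrable)
    show "integrable lborel (\<lambda>s. LINT t|lborel. norm (case (s, t) of (s, t) \<Rightarrow> k s * w t))"
      using k wi by (simp add: norm_mult)
    show "AE s in lborel. integrable lborel (\<lambda>t. case (s, t) of (s, t) \<Rightarrow> k s * w t)"
      using wi by simp
  qed measurable
  then have G: "integrable (lborel \<Otimes>\<^sub>M lborel) (case_prod G)"
  proof (rule Bochner_Integration.integrable_bound)
    show "case_prod G \<in> borel_measurable (lborel \<Otimes>\<^sub>M lborel)"
      unfolding G_def by measurable
  qed (auto simp: G_def)
  have in1: "(LINT s|lborel. G s t) = (LINT s:{\<alpha>..t}|lborel. k s) * w t" for t
  proof -
    have "(LINT s|lborel. G s t) = (LINT s|lborel. (indicator {\<alpha>..t} s *\<^sub>R k s) * w t)"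
      by (intro Bochner_Integration.integral_cong) (auto simp: G_def indicator_def)
    then show ?thesis unfolding set_lebesgue_integral_def by (simp only: integral_mult_left_zero)
  qed
  have in2: "(LINT t|lborel. G s t) = - (k s * (LINT t:{..s}|lborel. w t))" for s
  proof (cases "\<alpha> \<le> s")
    case True
    have "(LINT t|lborel. G s t) = (LINT t|lborel. k s * (indicator {s..} t *\<^sub>R w t))"
      using True by (intro Bochner_Integration.integral_cong) (auto simp: G_def indicator_def)
    also have "\<dots> = k s * (LINT t:{s..}|lborel. w t)"
      unfolding set_lebesgue_integral_def by (simp only: integral_mult_right_zero)
    also have "(LINT t:{s..}|lborel. w t) = (LINT t:{s<..}|lborel. w t)"
    proof (rule set_integral_cong_set)
      show "AE x in lborel. (x \<in> {s<..}) = (x \<in> {s..})"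
        using AE_lborel_singleton[of s] by eventually_elim auto
    qed (auto simp: set_borel_measurable_def)
    \<comment> \<open>As w has mean zero, its integral beyond s is minus its integral up to s; this
      is the source of the sign.\<close>
    also have "(LINT t:{s<..}|lborel. w t) = - (LINT t:{..s}|lborel. w t)"
    proof -
      have "(LINT t:{..s} \<union> {s<..}|lborel. w t) = (LINT t:{..s}|lborel. w t) + (LINT t:{s<..}|lborel. w t)"
        by (intro set_integral_Un) (auto simp: set_integrable_def intro!: integrable_mult_indicator wi)
      moreover have "{..s} \<union> {s<..} = UNIV" by auto
      ultimately show ?thesis
        using w(2) by (simp add: set_lebesgue_integral_def add_eq_0_iff2)
    qed
    finally show ?thesis by simp
  next
    case False
    have "(LINT t:{..s}|lborel. w t) = (LINT t|(lborel :: real measure). 0)"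
      unfolding set_lebesgue_integral_def
    proof (intro Bochner_Integration.integral_cong refl)
      show "indicator {..s} t *\<^sub>R w t = 0" for t
        using False test_functions_outside[OF w(1), of t] by (auto simp: indicator_def)
    qed
    moreover have "(LINT t|lborel. G s t) = (LINT t|(lborel :: real measure). 0)"
      using False by (intro Bochner_Integration.integral_cong) (auto simp: G_def)
    ultimately show ?thesis by simp
  qed
  show "integrable lborel (\<lambda>t. (LINT s:{\<alpha>..t}|lborel. k s) * w t)"
    using lborel_pair.integrable_snd[OF G] by (simp add: in1)
  have "(LINT t|lborel. LINT s|lborel. G s t) = (LINT s|lborel. LINT t|lborel. G s t)"
    by (rule lborel_pair.Fubini_integral[OF G])
  then show "(LINT t|lborel. (LINT s:{\<alpha>..t}|lborel. k s) * w t) = - (LINT s|lborel. k s * (LINT t:{..s}|lborel. w t))"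
    by (simp add: in1 in2)
qed

lemma integrable_mult_test:
  assumes "integrable lborel v" "\<omega> \<in> test_functions \<Omega>"
  shows "integrable lborel (\<lambda>t. v t * \<omega> t)"
proof -
  obtain B where B: "\<And>x. norm (\<omega> x) \<le> B" "B \<ge> 0"
    using test_functions_bounded[OF assms(2)] by blast
  have [measurable]: "v \<in> borel_measurable borel" "\<omega> \<in> borel_measurable borel"
    using assms(1) test_function_integrable[OF assms(2)] by auto
  show ?thesis
  proof (rule Bochner_Integration.integrable_bound)
    show "integrable lborel (\<lambda>t. of_real B * v t)" using assms(1) by simp
    show "AE t in lborel. norm (v t * \<omega> t) \<le> norm (of_real B * v t)"
      using B by (intro AE_I2) (simp add: norm_mult mult.commute[of "norm (v _)"] mult_right_mono)
  qed measurable
qed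

text \<open>If all test functions had integral 0, the fundamental lemma would make the indicator of
  the interval vanish almost everywhere. No integral has to be computed.\<close>

lemma test_function_integral_nonzero:
  assumes "\<alpha> < (\<beta>::real)"
  obtains \<omega> where "\<omega> \<in> test_functions {\<alpha><..<\<beta>}" "(LINT t|lborel. \<omega> t) \<noteq> 0"
proof (rule ccontr)
  assume "\<not> thesis"
  with that have zero: "(LINT t|lborel. \<omega> t) = 0" if "\<omega> \<in> test_functions {\<alpha><..<\<beta>}" for \<omega>
    using that by blast
  have "AE t in lborel. t \<in> {\<alpha><..<\<beta>} \<longrightarrow> complex_of_real (indicator {\<alpha><..<\<beta>} t) = 0"
  proof (rule AE_zero_if_test_integrals_zero)
    show "integrable lborel (\<lambda>t. complex_of_real (indicator {\<alpha><..<\<beta>} t))"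
      using assms by (intro integrable_of_real integrable_real_indicator) auto
    fix \<omega> assume \<omega>: "\<omega> \<in> test_functions {\<alpha><..<\<beta>}"
    have "complex_of_real (indicator {\<alpha><..<\<beta>} t) * \<omega> t = \<omega> t" for t
      using test_functions_outside[OF \<omega>, of t] by (cases "t \<in> {\<alpha><..<\<beta>}") auto
    then show "(LINT t|lborel. complex_of_real (indicator {\<alpha><..<\<beta>} t) * \<omega> t) = 0"
      using zero[OF \<omega>] by (simp only:)
  qed
  then have "AE t in lborel. t \<notin> {\<alpha><..<\<beta>}"
    by eventually_elim auto
  then have "emeasure lborel {\<alpha><..<\<beta>} = 0"
    by (subst (asm) AE_iff_null_sets[symmetric]) auto
  then show False using assms by simp
qed

text \<open>Every test function of mean zero is a derivative, so h minus the primitive of k is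
  orthogonal to all of them. Any test function differs from one of mean zero by a multiple of a
  fixed \<open>\<omega>1\<close>, and that multiple produces the constant c.\<close>

lemma du_Bois_Reymond_lborel:
  fixes h k :: "real \<Rightarrow> complex"
  assumes h: "integrable lborel h" and k: "integrable lborel k" and "\<alpha> < \<beta>"
    and weak: "\<And>\<eta>. \<eta> \<in> test_functions {\<alpha><..<\<beta>} \<Longrightarrow>
      (LINT t|lborel. h t * dir_deriv 1 \<eta> t) + (LINT t|lborel. k t * \<eta> t) = 0"
  shows "\<exists>c. AE t in lborel. t \<in> {\<alpha><..<\<beta>} \<longrightarrow> h t = c + (LINT s:{\<alpha>..t}|lborel. k s)"
proof -
  define P where "P t = (LINT s:{\<alpha>..t}|lborel. k s)" for t
  have [measurable]: "h \<in> borel_measurable borel" "k \<in> borel_measurable borel"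
    using h k by auto
  have P_alt: "P = (\<lambda>t. LINT s|lborel. of_bool (\<alpha> \<le> s \<and> s \<le> t) * k s)"
    unfolding P_def set_lebesgue_integral_def
    by (intro ext Bochner_Integration.integral_cong) (auto simp: indicator_def)
  have [measurable]: "P \<in> borel_measurable borel"
    unfolding P_alt by measurable
  have P_le: "norm (P t) \<le> (LINT s|lborel. norm (k s))" for t
    unfolding P_alt
  proof (rule order_trans[OF integral_norm_bound])
    have i: "integrable lborel (\<lambda>s. of_bool (\<alpha> \<le> s \<and> s \<le> t) * k s)"
      by (rule Bochner_Integration.integrable_bound[OF k]) auto
    show "(LINT s|lborel. norm (of_bool (\<alpha> \<le> s \<and> s \<le> t) * k s)) \<le> (LINT s|lborel. norm (k s))"
      by (rule integral_mono[OF integrable_norm[OF i] integrable_norm[OF k]]) (simp add: norm_mult)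
  qed
  \<comment> \<open>The cut-off makes the difference integrable on the whole line, since
    \<open>P\<close> is merely known to be bounded.\<close>
  define V where "V t = indicator {\<alpha><..<\<beta>} t *\<^sub>R (h t - P t)" for t
  have "integrable lborel (\<lambda>t. indicator {\<alpha><..<\<beta>} t *\<^sub>R P t)"
  proof (rule Bochner_Integration.integrable_bound)
    show "integrable lborel (\<lambda>t. indicator {\<alpha><..<\<beta>} t * (LINT s|lborel. norm (k s)))"
      using \<open>\<alpha> < \<beta>\<close> by (intro integrable_mult_left integrable_real_indicator) auto
    show "AE t in lborel. norm (indicator {\<alpha><..<\<beta>} t *\<^sub>R P t) \<le> norm (indicator {\<alpha><..<\<beta>} t * (LINT s|lborel. norm (k s)))"
      using order_trans[OF P_le abs_ge_self] by (intro AE_I2) (auto simp: indicator_def)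
  qed measurable
  moreover have "integrable lborel (\<lambda>t. indicator {\<alpha><..<\<beta>} t *\<^sub>R h t)"
    using h by (intro integrable_mult_indicator) auto
  ultimately have V: "integrable lborel V"
    unfolding V_def scaleR_diff_right by (rule Bochner_Integration.integrable_diff[rotated])
  obtain \<omega>1 where \<omega>1: "\<omega>1 \<in> test_functions {\<alpha><..<\<beta>}" "(LINT t|lborel. \<omega>1 t) \<noteq> 0"
    using test_function_integral_nonzero[OF \<open>\<alpha> < \<beta>\<close>] by blast
  have orth: "(LINT t|lborel. V t * w t) = 0"
    if w: "w \<in> test_functions {\<alpha><..<\<beta>}" "(LINT t|lborel. w t) = 0" for w
  proof -
    define \<eta> where "\<eta> = (\<lambda>s. LINT t:{..s}|lborel. w t)"
    have \<eta>: "\<eta> \<in> test_functions {\<alpha><..<\<beta>}" "dir_deriv 1 \<eta> = w"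
      using test_function_antiderivative[OF w \<open>\<alpha> < \<beta>\<close>] by (simp_all add: \<eta>_def)
    have "V t * w t = h t * w t - P t * w t" for t
      using test_functions_outside[OF w(1), of t]
      by (cases "t \<in> {\<alpha><..<\<beta>}") (auto simp: V_def algebra_simps)
    then have "(LINT t|lborel. V t * w t) = (LINT t|lborel. h t * w t) - (LINT t|lborel. P t * w t)"
      using integral_primitive_mult_test(1)[OF k w \<open>\<alpha> < \<beta>\<close>] integrable_mult_test[OF h w(1)]
      by (simp add: P_def)
    also have "\<dots> = (LINT t|lborel. h t * w t) + (LINT s|lborel. k s * \<eta> s)"
      using integral_primitive_mult_test(2)[OF k w \<open>\<alpha> < \<beta>\<close>] by (simp add: P_def \<eta>_def)
    also have "\<dots> = 0" using weak[OF \<eta>(1)] \<eta>(2) by simp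
    finally show ?thesis .
  qed
  \<comment> \<open>If \<open>V\<close> is constant on the interval, pairing with
    \<open>\<omega>1\<close> determines the constant.\<close>
  define c where "c = (LINT t|lborel. V t * \<omega>1 t) / (LINT t|lborel. \<omega>1 t)"
  define v where "v t = V t - c * of_real (indicator {\<alpha><..<\<beta>} t)" for t
  have "AE t in lborel. t \<in> {\<alpha><..<\<beta>} \<longrightarrow> v t = 0"
  proof (rule AE_zero_if_test_integrals_zero)
    have I: "integrable lborel (\<lambda>t. c * complex_of_real (indicator {\<alpha><..<\<beta>} t))"
      using \<open>\<alpha> < \<beta>\<close> by (intro integrable_mult_right integrable_of_real integrable_real_indicator) auto
    show "integrable lborel v"
      unfolding v_def by (intro Bochner_Integration.integrable_diff V I)
    fix \<omega> assume \<omega>: "\<omega> \<in> test_functions {\<alpha><..<\<beta>}"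
    define l where "l = (LINT t|lborel. \<omega> t) / (LINT t|lborel. \<omega>1 t)"
    have w: "(\<lambda>t. \<omega> t + (- l) * \<omega>1 t) \<in> test_functions {\<alpha><..<\<beta>}"
      by (intro test_functions_add test_functions_cmult \<omega> \<omega>1)
    have "(LINT t|lborel. \<omega> t + (- l) * \<omega>1 t) = (LINT t|lborel. \<omega> t) + (- l) * (LINT t|lborel. \<omega>1 t)"
      using test_function_integrable[OF \<omega>] test_function_integrable[OF \<omega>1(1)] by simp
    also have "\<dots> = 0" using \<omega>1(2) by (simp add: l_def)
    finally have "(LINT t|lborel. V t * (\<omega> t + (- l) * \<omega>1 t)) = 0" by (rule orth[OF w])
    moreover have "V t * (\<omega> t + (- l) * \<omega>1 t) = V t * \<omega> t - l * (V t * \<omega>1 t)" for t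
      by (simp add: algebra_simps)
    ultimately have "(LINT t|lborel. V t * \<omega> t) = l * (LINT t|lborel. V t * \<omega>1 t)"
      using integrable_mult_test[OF V \<omega>] integrable_mult_test[OF V \<omega>1(1)] by simp
    also have "\<dots> = c * (LINT t|lborel. \<omega> t)" by (simp add: c_def l_def)
    finally have "(LINT t|lborel. V t * \<omega> t) - c * (LINT t|lborel. \<omega> t) = 0" by simp
    moreover have "v t * \<omega> t = V t * \<omega> t - c * \<omega> t" for t
      using test_functions_outside[OF \<omega>, of t]
      by (cases "t \<in> {\<alpha><..<\<beta>}") (auto simp: v_def algebra_simps)
    ultimately show "(LINT t|lborel. v t * \<omega> t) = 0"
      using integrable_mult_test[OF V \<omega>] test_function_integrable[OF \<omega>] by simp
  qed
  then show ?thesis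
    by (intro exI[of _ c], eventually_elim) (auto simp: v_def V_def P_def)
qed

text \<open>Slices of a Lebesgue measurable function are only Lebesgue measurable, so both functions
  are replaced by Borel representatives before the previous lemma applies.\<close>

lemma du_Bois_Reymond:
  fixes h k :: "real \<Rightarrow> complex"
  assumes h: "integrable lebesgue h" and k: "integrable lebesgue k" and "\<alpha> < \<beta>"
    and weak: "\<And>\<eta>. \<eta> \<in> test_functions {\<alpha><..<\<beta>} \<Longrightarrow>
      (LINT t|lebesgue. h t * dir_deriv 1 \<eta> t) + (LINT t|lebesgue. k t * \<eta> t) = 0"
  shows "\<exists>c. AE t in lebesgue. t \<in> {\<alpha><..<\<beta>} \<longrightarrow> h t = c + (LINT s:{\<alpha>..t}|lebesgue. k s)"
proof -
  obtain h' where h': "h' \<in> borel_measurable borel" "AE x in lborel. h x = h' x"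
    using lebesgue_borel_representative[OF borel_measurable_integrable[OF h]] by blast
  obtain k' where k': "k' \<in> borel_measurable borel" "AE x in lborel. k x = k' x"
    using lebesgue_borel_representative[OF borel_measurable_integrable[OF k]] by blast
  have "\<exists>c. AE t in lborel. t \<in> {\<alpha><..<\<beta>} \<longrightarrow> h' t = c + (LINT s:{\<alpha>..t}|lborel. k' s)"
  proof (rule du_Bois_Reymond_lborel[OF _ _ \<open>\<alpha> < \<beta>\<close>])
    show "integrable lborel h'" using h lebesgue_integral_AE_eq(1)[OF h'(2,1)] by simp
    show "integrable lborel k'" using k lebesgue_integral_AE_eq(1)[OF k'(2,1)] by simp
    fix \<eta> :: "real \<Rightarrow> complex" assume \<eta>: "\<eta> \<in> test_functions {\<alpha><..<\<beta>}"
    have m: "\<eta> \<in> borel_measurable borel" "dir_deriv 1 \<eta> \<in> borel_measurable borel"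
      using test_function_integrable[OF \<eta>] test_function_integrable[OF test_functions_dir_deriv[OF \<eta>, of 1]] by auto
    have "AE t in lborel. h t * dir_deriv 1 \<eta> t = h' t * dir_deriv 1 \<eta> t"
      using h'(2) by eventually_elim simp
    from lebesgue_integral_AE_eq(2)[OF this] have
      "(LINT t|lebesgue. h t * dir_deriv 1 \<eta> t) = (LINT t|lborel. h' t * dir_deriv 1 \<eta> t)"
      using m h'(1) by auto
    moreover have "AE t in lborel. k t * \<eta> t = k' t * \<eta> t"
      using k'(2) by eventually_elim simp
    from lebesgue_integral_AE_eq(2)[OF this] have
      "(LINT t|lebesgue. k t * \<eta> t) = (LINT t|lborel. k' t * \<eta> t)"
      using m k'(1) by auto
    ultimately show "(LINT t|lborel. h' t * dir_deriv 1 \<eta> t) + (LINT t|lborel. k' t * \<eta> t) = 0"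
      using weak[OF \<eta>] by simp
  qed
  then obtain c where c: "AE t in lborel. t \<in> {\<alpha><..<\<beta>} \<longrightarrow> h' t = c + (LINT s:{\<alpha>..t}|lborel. k' s)"
    by blast
  have eq: "(LINT s:{\<alpha>..t}|lebesgue. k s) = (LINT s:{\<alpha>..t}|lborel. k' s)" for t
  proof -
    have "AE s in lborel. indicator {\<alpha>..t} s *\<^sub>R k s = indicator {\<alpha>..t} s *\<^sub>R k' s"
      using k'(2) by eventually_elim simp
    moreover have "(\<lambda>s. indicator {\<alpha>..t} s *\<^sub>R k' s) \<in> borel_measurable borel"
      using k'(1) by measurable
    ultimately show ?thesis
      unfolding set_lebesgue_integral_def by (rule lebesgue_integral_AE_eq(2))
  qed
  have "AE t in lborel. t \<in> {\<alpha><..<\<beta>} \<longrightarrow> h t = c + (LINT s:{\<alpha>..t}|lebesgue. k s)"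
    using c h'(2) by eventually_elim (simp add: eq)
  then show ?thesis unfolding lebesgue_AE_lborel by blast
qed

section \<open>The equation for the slices\<close>

lemma compact_norm_bound:
  fixes b :: "'a::topological_space \<Rightarrow> 'b::real_normed_vector"
  assumes "compact S" "continuous_on S b"
  obtains B where "B > 0" "\<And>z. z \<in> S \<Longrightarrow> norm (b z) \<le> B"
proof -
  have "bounded (b ` S)"
    by (intro compact_imp_bounded compact_continuous_image assms)
  then show ?thesis
    unfolding bounded_pos using that by blast
qed

lemma dir_deriv_zero: "h differentiable (at x) \<Longrightarrow> dir_deriv 0 h x = 0"
  using linear_0[OF has_derivative_linear[OF dir_deriv_works]] by blast

section \<open>Products and slices of smooth functions\<close>

lemma has_derivative_compose_linear:
  assumes "bounded_linear p" "\<psi> differentiable (at (p z))"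
  shows "((\<lambda>z. \<psi> (p z)) has_derivative (\<lambda>e. dir_deriv (p e) \<psi> (p z))) (at z)"
  by (rule has_derivative_compose[OF bounded_linear_imp_has_derivative[OF assms(1)] dir_deriv_works[OF assms(2)]])

text \<open>\<open>diff_times\<close> controls derivatives in basis directions only, so
  \<open>p\<close> must send basis vectors to basis vectors or to 0, as the two projections of a
  product do.\<close>

lemma smooth_on_compose_linear:
  assumes p: "bounded_linear p" "\<And>e. e \<in> Basis \<Longrightarrow> p e \<in> Basis \<or> p e = 0"
    and "smooth_on UNIV \<psi>"
  shows "smooth_on UNIV (\<lambda>z. \<psi> (p z))"
proof -
  have "diff_times k UNIV (\<lambda>z. \<psi> (p z))" if "diff_times k UNIV \<psi>" for k
    using that
  proof (induction k arbitrary: \<psi>)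
    case (Suc k)
    have diff: "\<psi> differentiable (at x)" for x using Suc.prems by (simp add: diff_times_Suc)
    show ?case
    proof (rule diff_times_SucI[OF open_UNIV has_derivative_compose_linear[OF p(1) diff]])
      fix e :: 'a assume "e \<in> Basis"
      with p(2) consider "p e \<in> Basis" | "p e = 0" by blast
      then show "diff_times k UNIV (\<lambda>z. dir_deriv (p e) \<psi> (p z))"
      proof cases
        case 1
        then show ?thesis using Suc by (intro Suc.IH) (simp add: diff_times_Suc)
      next
        case 2
        then show ?thesis by (simp add: dir_deriv_zero[OF diff] diff_times_const)
      qed
    qed
  qed simp
  then show ?thesis
    using assms(3) by (simp add: smooth_on_iff_diff_times)
qed

lemma fst_Basis: "e \<in> Basis \<Longrightarrow> fst e \<in> Basis \<or> fst e = 0"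
  and snd_Basis: "e \<in> Basis \<Longrightarrow> snd e \<in> Basis \<or> snd e = 0"
  by (auto simp: Basis_prod_def)

lemma smooth_on_fst: "smooth_on UNIV \<psi> \<Longrightarrow> smooth_on UNIV (\<lambda>z. \<psi> (fst z))"
  by (rule smooth_on_compose_linear[OF bounded_linear_fst fst_Basis])

lemma smooth_on_snd: "smooth_on UNIV \<psi> \<Longrightarrow> smooth_on UNIV (\<lambda>z. \<psi> (snd z))"
  by (rule smooth_on_compose_linear[OF bounded_linear_snd snd_Basis])

lemma test_functions_Times:
  assumes "\<psi> \<in> test_functions A" "\<eta> \<in> test_functions I" "supp \<psi> \<times> supp \<eta> \<subseteq> W"
  shows "(\<lambda>z. \<psi> (fst z) * \<eta> (snd z)) \<in> test_functions W"
proof (rule test_functionsI[OF _ compact_Times assms(3)])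
  show "smooth_on UNIV (\<lambda>z. \<psi> (fst z) * \<eta> (snd z))"
    using assms by (intro smooth_on_mult smooth_on_fst smooth_on_snd test_functions_smooth open_UNIV) auto
  show "\<psi> (fst z) * \<eta> (snd z) = 0" if "z \<notin> supp \<psi> \<times> supp \<eta>" for z
    using that not_in_supp[of "fst z" \<psi>] not_in_supp[of "snd z" \<eta>] by (cases z) auto
qed (use assms test_functions_compact in auto)

lemma open_slice: "open W \<Longrightarrow> open {x. (x, t) \<in> W}"
  by (rule open_vimage[of W "\<lambda>x. (x, t)", unfolded vimage_def]) (auto intro: continuous_intros)

lemma slice_has_derivative:
  assumes "b differentiable (at (x, t))"
  shows "((\<lambda>x. b (x, t)) has_derivative (\<lambda>e. dir_deriv (e, 0) b (x, t))) (at x)"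
proof -
  have "((\<lambda>x. (x, t)) has_derivative (\<lambda>e. (e, 0))) (at x)"
    by (intro has_derivative_Pair has_derivative_ident has_derivative_const)
  from has_derivative_compose[OF this dir_deriv_works[OF assms]] show ?thesis .
qed

text \<open>Transfers bounds on derivatives of the coefficients in the full space to the slices at
  frozen time, where the seminorms live.\<close>

lemma iter_deriv_slice:
  assumes "open W" "smooth_on W b" "set es \<subseteq> Basis" "(x, t) \<in> W"
  shows "iter_deriv es (\<lambda>x. b (x, t)) x = iter_deriv (map (\<lambda>e. (e, 0)) es) b (x, t)"
  using assms(3,4)
proof (induction es arbitrary: x)
  case (Cons e es)
  have "dir_deriv e (iter_deriv es (\<lambda>x. b (x, t))) x =
      dir_deriv e (\<lambda>x. iter_deriv (map (\<lambda>e. (e, 0)) es) b (x, t)) x"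
    using Cons by (intro dir_deriv_cong[OF open_slice[OF assms(1)]]) auto
  also have "\<dots> = dir_deriv (e, 0) (iter_deriv (map (\<lambda>e. (e, 0)) es) b) (x, t)"
  proof (rule dir_deriv_eqI[OF slice_has_derivative])
    have "set (map (\<lambda>e. (e, 0)) es) \<subseteq> Basis" using Cons.prems by (auto simp: Basis_prod_def)
    then show "iter_deriv (map (\<lambda>e. (e, 0)) es) b differentiable (at (x, t))"
      using assms(2) Cons.prems by (intro smooth_on_differentiable[OF smooth_on_iter_deriv])
  qed
  finally show ?case by simp
qed simp

lemma smooth_on_slice:
  assumes "open W" "smooth_on W b"
  shows "smooth_on {x. (x, t) \<in> W} (\<lambda>x. b (x, t))"
  unfolding smooth_on_def
proof (intro allI impI ballI)
  fix es :: "'a list" and x assume es: "set es \<subseteq> Basis" and x: "x \<in> {x. (x, t) \<in> W}"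
  have "set (map (\<lambda>e. (e, 0)) es) \<subseteq> Basis" using es by (auto simp: Basis_prod_def)
  then have "(\<lambda>x. iter_deriv (map (\<lambda>e. (e, 0)) es) b (x, t)) differentiable (at x)"
    using assms(2) x
    by (intro differentiableI[OF slice_has_derivative] smooth_on_differentiable[OF smooth_on_iter_deriv]) auto
  then show "iter_deriv es (\<lambda>x. b (x, t)) differentiable (at x)"
    using differentiable_cong_open[OF open_slice[OF assms(1)] x, of "iter_deriv es (\<lambda>x. b (x, t))"]
      iter_deriv_slice[OF assms es] by auto
qed

section \<open>Integration slice by slice\<close>

definition slice_mass :: "'a::euclidean_space set \<Rightarrow> ('a \<times> real \<Rightarrow> complex) \<Rightarrow> real \<Rightarrow> real" where
  "slice_mass K f t = (LINT x:K|lebesgue. norm (f (x, t)))"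

lemma slice_mass_nonneg: "0 \<le> slice_mass K f t"
  unfolding slice_mass_def set_lebesgue_integral_def by (intro integral_nonneg_AE AE_I2) auto

lemma slice_mass_integrable:
  assumes "set_integrable lebesgue (K \<times> J) f"
  shows "AE t in lebesgue. t \<in> J \<longrightarrow> set_integrable lebesgue K (\<lambda>x. f (x, t))"
    and "set_integrable lebesgue J (slice_mass K f)"
proof -
  have *: "indicator (K \<times> J) (x, t) *\<^sub>R f (x, t) = indicator J t *\<^sub>R (indicator K x *\<^sub>R f (x, t))" for x t
    by (auto simp: indicator_def)
  show "AE t in lebesgue. t \<in> J \<longrightarrow> set_integrable lebesgue K (\<lambda>x. f (x, t))"
    using lebesgue_Fubini(1)[OF assms[unfolded set_integrable_def]] unfolding *
    by eventually_elim (auto simp: set_integrable_def)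
  \<comment> \<open>The Fubini lemma concerns complex functions; the norm is embedded and recovered
    as a real part.\<close>
  have "integrable lebesgue (\<lambda>z. complex_of_real (norm (indicator (K \<times> J) z *\<^sub>R f z)))"
    using integrable_norm[OF assms[unfolded set_integrable_def]] by (rule integrable_of_real)
  from integrable_Re[OF lebesgue_Fubini(2)[OF this]]
  have "integrable lebesgue (\<lambda>t. LINT x|lebesgue. norm (indicator J t *\<^sub>R (indicator K x *\<^sub>R f (x, t))))"
    by (simp only: * integral_complex_of_real Re_complex_of_real)
  moreover have "(LINT x|lebesgue. norm (indicator J t *\<^sub>R (indicator K x *\<^sub>R f (x, t)))) = indicator J t *\<^sub>R slice_mass K f t" for t
    by (simp add: slice_mass_def set_lebesgue_integral_def mult.assoc)
  ultimately show "set_integrable lebesgue J (slice_mass K f)"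
    by (simp only: set_integrable_def)
qed

lemma regular_dist_set:
  assumes "supp \<phi> \<subseteq> K"
  shows "regular_dist f \<phi> = (LINT x:K|lebesgue. f x * \<phi> x)"
  unfolding regular_dist_def set_lebesgue_integral_def
proof (intro Bochner_Integration.integral_cong refl)
  show "f x * \<phi> x = indicator K x *\<^sub>R (f x * \<phi> x)" for x
    using assms not_in_supp[of x \<phi>] by (cases "x \<in> K") auto
qed

lemma set_integrable_mult_bounded:
  fixes f \<phi> :: "'a::euclidean_space \<Rightarrow> complex"
  assumes "set_integrable lebesgue K f" "continuous_on K \<phi>" "\<And>x. x \<in> K \<Longrightarrow> norm (\<phi> x) \<le> B" "K \<in> sets lebesgue"
  shows "set_integrable lebesgue K (\<lambda>x. f x * \<phi> x)"
proof -
  have "(\<lambda>x. \<phi> x * f x) absolutely_integrable_on K"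
  proof (rule absolutely_integrable_bounded_measurable_product[where h = "(*)" and f = \<phi> and g = f])
    show "bilinear ((*) :: complex \<Rightarrow> _)" by (rule bilinear_times)
    show "\<phi> \<in> borel_measurable (lebesgue_on K)"
      by (rule continuous_imp_measurable_on_sets_lebesgue[OF assms(2,4)])
    show "bounded (\<phi> ` K)"
      using assms(3) by (intro boundedI[of _ B]) blast
  qed (rule assms)+
  then show ?thesis by (simp add: mult.commute)
qed

lemma norm_regular_dist_le:
  assumes "set_integrable lebesgue K f" "K \<in> sets lebesgue" "continuous_on K \<phi>" "supp \<phi> \<subseteq> K" "\<And>x. norm (\<phi> x) \<le> B"
  shows "norm (regular_dist f \<phi>) \<le> B * (LINT x:K|lebesgue. norm (f x))"
proof -
  have i: "set_integrable lebesgue K (\<lambda>x. f x * \<phi> x)"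
    using assms by (intro set_integrable_mult_bounded)
  have "norm (regular_dist f \<phi>) \<le> (LINT x:K|lebesgue. norm (f x * \<phi> x))"
    unfolding regular_dist_set[OF assms(4)] by (rule set_integral_norm_bound[OF i])
  also have "\<dots> \<le> (LINT x:K|lebesgue. B * norm (f x))"
    using assms(5) 
    by (intro set_integral_mono set_integrable_norm i set_integrable_mult_right assms(1))
      (simp add: norm_mult mult.commute mult_right_mono)
  finally show ?thesis by simp
qed

text \<open>As \<open>b\<close> vanishes for x off \<open>K\<close>, the cut-off to the cylinder
  reduces to a cut-off in t, and the inner integral becomes the full pairing
  \<open>regular_dist\<close>.\<close>

lemma Fubini_cylinder:
  fixes F b :: "'a::euclidean_space \<times> real \<Rightarrow> complex"
  assumes "compact K" "set_integrable lebesgue (K \<times> {\<alpha>..\<beta>}) F" "continuous_on (K \<times> {\<alpha>..\<beta>}) b"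
    and "\<And>z. fst z \<notin> K \<Longrightarrow> b z = 0"
  shows "integrable lebesgue (\<lambda>z. indicator {\<alpha>..\<beta>} (snd z) *\<^sub>R (F z * b z))"
    and "set_integrable lebesgue {\<alpha>..\<beta>} (\<lambda>t. regular_dist (\<lambda>x. F (x, t)) (\<lambda>x. b (x, t)))"
    and "(LINT z|lebesgue. indicator {\<alpha>..\<beta>} (snd z) *\<^sub>R (F z * b z)) =
      (LINT t:{\<alpha>..\<beta>}|lebesgue. regular_dist (\<lambda>x. F (x, t)) (\<lambda>x. b (x, t)))"
proof -
  have C: "compact (K \<times> {\<alpha>..\<beta>})" using assms(1) by (intro compact_Times) auto
  obtain B where B: "\<And>z. z \<in> K \<times> {\<alpha>..\<beta>} \<Longrightarrow> norm (b z) \<le> B"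
    using compact_norm_bound[OF C assms(3)] by blast
  have "K \<times> {\<alpha>..\<beta>} \<in> sets lebesgue"
    by (rule fmeasurableD[OF lmeasurable_compact[OF C]])
  from set_integrable_mult_bounded[OF assms(2,3) B this]
  have "integrable lebesgue (\<lambda>z. indicator (K \<times> {\<alpha>..\<beta>}) z *\<^sub>R (F z * b z))"
    by (simp only: set_integrable_def)
  moreover have "(\<lambda>z. indicator (K \<times> {\<alpha>..\<beta>}) z *\<^sub>R (F z * b z)) = (\<lambda>z. indicator {\<alpha>..\<beta>} (snd z) *\<^sub>R (F z * b z))"
  proof
    show "indicator (K \<times> {\<alpha>..\<beta>}) z *\<^sub>R (F z * b z) = indicator {\<alpha>..\<beta>} (snd z) *\<^sub>R (F z * b z)" for z
      using assms(4)[of z] by (cases z; cases "fst z \<in> K") (auto simp: indicator_def)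
  qed
  ultimately show I: "integrable lebesgue (\<lambda>z. indicator {\<alpha>..\<beta>} (snd z) *\<^sub>R (F z * b z))"
    by simp
  have eq: "(LINT x|lebesgue. indicator {\<alpha>..\<beta>} (snd (x, t)) *\<^sub>R (F (x, t) * b (x, t))) =
      indicator {\<alpha>..\<beta>} t *\<^sub>R regular_dist (\<lambda>x. F (x, t)) (\<lambda>x. b (x, t))" for t
    by (simp add: regular_dist_def)
  show "set_integrable lebesgue {\<alpha>..\<beta>} (\<lambda>t. regular_dist (\<lambda>x. F (x, t)) (\<lambda>x. b (x, t)))"
    using lebesgue_Fubini(2)[OF I] unfolding eq set_integrable_def .
  show "(LINT z|lebesgue. indicator {\<alpha>..\<beta>} (snd z) *\<^sub>R (F z * b z)) =
      (LINT t:{\<alpha>..\<beta>}|lebesgue. regular_dist (\<lambda>x. F (x, t)) (\<lambda>x. b (x, t)))"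
    using lebesgue_Fubini(3)[OF I, symmetric] unfolding eq set_lebesgue_integral_def .
qed

lemma regular_dist_cmult: "regular_dist f (\<lambda>x. \<phi> x * c) = regular_dist f \<phi> * c"
  unfolding regular_dist_def mult.assoc[symmetric] by (rule integral_mult_left_zero)

text \<open>The interior theory, on an arbitrary open set \<open>W\<close> and without reference to
  t = 0; \<open>g\<close> is the function representing \<open>L f\<close>.\<close>

locale transport_equation =
  fixes W :: "((real^'n) \<times> real) set"
    and a :: "'n \<Rightarrow> (real^'n) \<times> real \<Rightarrow> complex"
    and f g :: "(real^'n) \<times> real \<Rightarrow> complex"
  assumes open_W: "open W"
    and smooth_a: "\<And>j. smooth_on W (a j)"
    and f_loc: "locally_integrable_on f W"
    and g_int: "g absolutely_integrable_on W"
    and weak: "\<And>\<phi>. \<phi> \<in> test_functions W \<Longrightarrow> vector_field a (regular_dist f) \<phi> = regular_dist g \<phi>"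
begin

text \<open>Minus the formal transpose of the spatial part of \<open>L\<close>. The derivative is
  taken in the full space rather than slice by slice, which yields the joint continuity in (x, t)
  that Fubini uses.\<close>

definition adj :: "(real^'n \<Rightarrow> complex) \<Rightarrow> (real^'n) \<times> real \<Rightarrow> complex" where
  "adj \<psi> z = (\<Sum>j\<in>UNIV. dir_deriv (axis j 1, 0) (\<lambda>z. a j z * \<psi> (fst z)) z)"

text \<open>The expected t-derivative of the pairing of f(.,t) with \<psi>, with the x-derivatives
  moved from f to a_j \<psi>.\<close>

definition slice_deriv :: "(real^'n \<Rightarrow> complex) \<Rightarrow> real \<Rightarrow> complex" where
  "slice_deriv \<psi> t = regular_dist (\<lambda>x. g (x, t)) \<psi> + regular_dist (\<lambda>x. f (x, t)) (\<lambda>x. adj \<psi> (x, t))"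

lemma axis_zero_in_Basis: "(axis j 1, 0) \<in> (Basis :: ((real^'n) \<times> real) set)"
  by (auto simp: Basis_prod_def axis_in_Basis_iff)

lemma smooth_a_mult: "smooth_on UNIV \<psi> \<Longrightarrow> smooth_on W (\<lambda>z. a j z * \<psi> (fst z))"
  by (intro smooth_on_mult open_W smooth_a smooth_on_subset[OF smooth_on_fst]) auto

lemma continuous_adj_term:
  "smooth_on UNIV \<psi> \<Longrightarrow> continuous_on W (dir_deriv (axis j 1, 0) (\<lambda>z. a j z * \<psi> (fst z)))"
  by (intro smooth_on_continuous smooth_on_dir_deriv smooth_a_mult axis_zero_in_Basis)

lemma adj_term_outside:
  assumes "fst z \<notin> supp \<psi>"
  shows "dir_deriv e (\<lambda>z. a j z * \<psi> (fst z)) z = 0"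
proof -
  have "open (fst -` (- supp \<psi>) :: ((real^'n) \<times> real) set)"
    by (intro open_vimage_fst) auto
  then have "dir_deriv e (\<lambda>z. a j z * \<psi> (fst z)) z = dir_deriv e (\<lambda>z. 0) z"
    using assms by (intro dir_deriv_cong) (auto intro: not_in_supp)
  then show ?thesis by simp
qed

lemma adj_outside: "fst z \<notin> supp \<psi> \<Longrightarrow> adj \<psi> z = 0"
  by (simp add: adj_def adj_term_outside)

lemma continuous_adj: "smooth_on UNIV \<psi> \<Longrightarrow> continuous_on W (adj \<psi>)"
  unfolding adj_def by (intro continuous_on_sum continuous_adj_term)

lemma f_cylinder:
  "compact K \<Longrightarrow> K \<times> {\<alpha>..\<beta>} \<subseteq> W \<Longrightarrow> set_integrable lebesgue (K \<times> {\<alpha>..\<beta>}) f"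
  using f_loc by (auto simp: locally_integrable_on_def compact_Times)

lemma g_cylinder:
  "compact K \<Longrightarrow> J \<in> sets borel \<Longrightarrow> K \<times> J \<subseteq> W \<Longrightarrow> set_integrable lebesgue (K \<times> J) g"
  by (rule set_integrable_subset[OF g_int sets_completionI_sets])
    (simp_all add: borel_Times borel_closed compact_imp_closed)

text \<open>The equation is tested with \<psi>(x) \<eta>(t). The t-derivative falls on \<eta>; in
  the spatial terms \<eta> is a constant factor, which leaves \<open>adj \<psi>\<close>. All
  derivatives in \<open>vector_field\<close> carry a minus sign, so after moving them across, the
  integrals add up to 0.\<close>

lemma weak_product:
  assumes \<psi>: "smooth_on UNIV \<psi>" "supp \<psi> \<subseteq> K" and K: "compact K" "K \<times> {\<alpha>..\<beta>} \<subseteq> W"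
    and \<eta>: "\<eta> \<in> test_functions {\<alpha><..<\<beta>}"
  shows "(LINT t:{\<alpha>..\<beta>}|lebesgue. regular_dist (\<lambda>x. f (x, t)) \<psi> * dir_deriv 1 \<eta> t) +
    (LINT t:{\<alpha>..\<beta>}|lebesgue. slice_deriv \<psi> t * \<eta> t) = 0"
proof -
  define I where "I z = (indicator {\<alpha>..\<beta>} (snd z) :: real)" for z :: "(real^'n) \<times> real"
  define D where "D j = dir_deriv (axis j 1, 0) (\<lambda>z. a j z * \<psi> (fst z))" for j
  have \<psi>t: "\<psi> \<in> test_functions UNIV"
    using \<psi> K by (intro test_functionsI[of _ K]) (auto intro: not_in_supp)
  have \<eta>s: "smooth_on UNIV \<eta>" by (rule test_functions_smooth[OF \<eta>])
  have \<eta>0: "\<eta> t = 0" "dir_deriv 1 \<eta> t = 0" if "t \<notin> {\<alpha>..\<beta>}" for t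
    using that test_functions_outside[OF \<eta>, of t] test_functions_outside[OF test_functions_dir_deriv[OF \<eta>, of 1], of t]
    by auto
  define \<phi> where "\<phi> z = \<psi> (fst z) * \<eta> (snd z)" for z
  have sub: "supp \<psi> \<times> supp \<eta> \<subseteq> W"
    using \<psi>(2) K(2) test_functions_supp[OF \<eta>] by force
  have \<phi>: "\<phi> \<in> test_functions W"
    unfolding \<phi>_def by (rule test_functions_Times[OF \<psi>t \<eta> sub])
  have d1: "dir_deriv (0, 1) \<phi> z = \<psi> (fst z) * dir_deriv 1 \<eta> (snd z)" for z
  proof -
    have "(\<phi> has_derivative (\<lambda>e. \<psi> (fst z) * dir_deriv (snd e) \<eta> (snd z) + dir_deriv (fst e) \<psi> (fst z) * \<eta> (snd z))) (at z)"
      unfolding \<phi>_def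
      by (intro has_derivative_mult has_derivative_compose_linear bounded_linear_fst bounded_linear_snd
          smooth_on_differentiable[OF \<psi>(1)] smooth_on_differentiable[OF \<eta>s] UNIV_I)
    from dir_deriv_eqI[OF this] show ?thesis
      by (simp add: dir_deriv_zero smooth_on_differentiable[OF \<psi>(1)])
  qed
  \<comment> \<open>Off \<open>W\<close> the coefficients are arbitrary, but there both sides are 0,
    because the product of the supports is closed and lies in \<open>W\<close>.\<close>
  have d2: "dir_deriv (axis j 1, 0) (\<lambda>z. a j z * \<phi> z) z = D j z * \<eta> (snd z)" for j z
  proof (cases "z \<in> W")
    case True
    have "((\<lambda>z. a j z * \<psi> (fst z) * \<eta> (snd z)) has_derivative
        (\<lambda>e. a j z * \<psi> (fst z) * dir_deriv (snd e) \<eta> (snd z) +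
          dir_deriv e (\<lambda>z. a j z * \<psi> (fst z)) z * \<eta> (snd z))) (at z)"
      by (intro has_derivative_mult[of "\<lambda>z. a j z * \<psi> (fst z)"] has_derivative_compose_linear bounded_linear_snd
          dir_deriv_works smooth_on_differentiable[OF smooth_a_mult[OF \<psi>(1)]]
          smooth_on_differentiable[OF \<eta>s] UNIV_I True)
    from dir_deriv_eqI[OF this, of "(axis j 1, 0)"] show ?thesis
      by (simp add: \<phi>_def D_def mult.assoc dir_deriv_zero smooth_on_differentiable[OF \<eta>s])
  next
    case False
    have "open (- (supp \<psi> \<times> supp \<eta>))" by (intro open_Compl closed_Times) auto
    then have "dir_deriv (axis j 1, 0) (\<lambda>z. a j z * \<phi> z) z = dir_deriv (axis j 1, 0) (\<lambda>z. 0) z"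
      using False sub
      by (intro dir_deriv_cong[of "- (supp \<psi> \<times> supp \<eta>)"]) (auto simp: \<phi>_def intro: supp_mem)
    moreover have "D j z * \<eta> (snd z) = 0"
    proof (cases "fst z \<in> supp \<psi>")
      case True
      then have "snd z \<notin> supp \<eta>" using False sub by (cases z) auto
      then show ?thesis using not_in_supp[of "snd z" \<eta>] by simp
    next
      case False
      then show ?thesis unfolding D_def by (simp add: adj_term_outside)
    qed
    ultimately show ?thesis by simp
  qed
  have cont: "continuous_on (K \<times> {\<alpha>..\<beta>}) (\<lambda>z. b z * \<theta> (snd z))"
    if "continuous_on W b" "continuous_on UNIV \<theta>" for b and \<theta> :: "real \<Rightarrow> complex"
    using that K(2)
    by (intro continuous_on_mult continuous_on_subset[OF that(1)] continuous_on_compose2[OF that(2)] continuous_on_snd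
        continuous_on_id) auto
  have c\<psi>: "continuous_on W (\<lambda>z. \<psi> (fst z))"
    by (rule continuous_on_subset[OF smooth_on_continuous[OF smooth_on_fst[OF \<psi>(1)]]]) auto
  have c\<eta>: "continuous_on UNIV \<eta>" "continuous_on UNIV (dir_deriv 1 \<eta>)"
    using smooth_on_continuous[OF \<eta>s] smooth_on_continuous[OF smooth_on_dir_deriv[OF \<eta>s, of 1]] by auto
  have z1: "\<psi> (fst z) * \<theta> = 0" if "fst z \<notin> K" for z \<theta>
    using that \<psi>(2) not_in_supp[of "fst z" \<psi>] by auto
  have z2: "D j z * \<theta> = 0" if "fst z \<notin> K" for j z \<theta>
    using that \<psi>(2) adj_term_outside[of z \<psi>] by (auto simp: D_def)
  have z3: "adj \<psi> z * \<theta> = 0" if "fst z \<notin> K" for z \<theta>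
    using that \<psi>(2) adj_outside[of z \<psi>] by auto
  have gK: "set_integrable lebesgue (K \<times> {\<alpha>..\<beta>}) g" by (rule g_cylinder[OF K(1) _ K(2)]) simp
  have F1: "set_integrable lebesgue {\<alpha>..\<beta>} (\<lambda>t. regular_dist (\<lambda>x. f (x, t)) \<psi> * dir_deriv 1 \<eta> t)"
    "(LINT z|lebesgue. indicator {\<alpha>..\<beta>} (snd z) *\<^sub>R (f z * (\<psi> (fst z) * dir_deriv 1 \<eta> (snd z)))) =
      (LINT t:{\<alpha>..\<beta>}|lebesgue. regular_dist (\<lambda>x. f (x, t)) \<psi> * dir_deriv 1 \<eta> t)"
    using Fubini_cylinder(2,3)[where b = "\<lambda>z. \<psi> (fst z) * dir_deriv 1 \<eta> (snd z)", OF K(1) f_cylinder[OF K] cont[OF c\<psi> c\<eta>(2)] z1]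
    by (simp_all add: regular_dist_cmult)
  have F2: "set_integrable lebesgue {\<alpha>..\<beta>} (\<lambda>t. regular_dist (\<lambda>x. g (x, t)) \<psi> * \<eta> t)"
    "(LINT z|lebesgue. indicator {\<alpha>..\<beta>} (snd z) *\<^sub>R (g z * (\<psi> (fst z) * \<eta> (snd z)))) =
      (LINT t:{\<alpha>..\<beta>}|lebesgue. regular_dist (\<lambda>x. g (x, t)) \<psi> * \<eta> t)"
    using Fubini_cylinder(2,3)[where b = "\<lambda>z. \<psi> (fst z) * \<eta> (snd z)", OF K(1) gK cont[OF c\<psi> c\<eta>(1)] z1]
    by (simp_all add: regular_dist_cmult)
  have F3: "set_integrable lebesgue {\<alpha>..\<beta>} (\<lambda>t. regular_dist (\<lambda>x. f (x, t)) (\<lambda>x. adj \<psi> (x, t)) * \<eta> t)"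
    "(LINT z|lebesgue. indicator {\<alpha>..\<beta>} (snd z) *\<^sub>R (f z * (adj \<psi> z * \<eta> (snd z)))) =
      (LINT t:{\<alpha>..\<beta>}|lebesgue. regular_dist (\<lambda>x. f (x, t)) (\<lambda>x. adj \<psi> (x, t)) * \<eta> t)"
    using Fubini_cylinder(2,3)[where b = "\<lambda>z. adj \<psi> z * \<eta> (snd z)", OF K(1) f_cylinder[OF K] cont[OF continuous_adj[OF \<psi>(1)] c\<eta>(1)] z3]
    by (simp_all add: regular_dist_cmult)
  have F4: "integrable lebesgue (\<lambda>z. I z *\<^sub>R (f z * (D j z * \<eta> (snd z))))" for j
    unfolding I_def D_def
    by (rule Fubini_cylinder(1)[OF K(1) f_cylinder[OF K] cont[OF continuous_adj_term[OF \<psi>(1)] c\<eta>(1)]])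
      (use z2 in \<open>auto simp: D_def\<close>)
  have w: "- (LINT z|lebesgue. f z * dir_deriv (0, 1) \<phi> z) +
      (\<Sum>j\<in>UNIV. - (LINT z|lebesgue. f z * dir_deriv (axis j 1, 0) (\<lambda>z. a j z * \<phi> z) z)) =
      (LINT z|lebesgue. g z * \<phi> z)"
    using weak[OF \<phi>] by (simp add: vector_field_def dist_deriv_def dist_mult_def regular_dist_def)
  have e1: "f z * dir_deriv (0, 1) \<phi> z = I z *\<^sub>R (f z * (\<psi> (fst z) * dir_deriv 1 \<eta> (snd z)))" for z
    unfolding d1 I_def using \<eta>0(2)[of "snd z"] by (cases "snd z \<in> {\<alpha>..\<beta>}") auto
  have e2: "f z * dir_deriv (axis j 1, 0) (\<lambda>z. a j z * \<phi> z) z = I z *\<^sub>R (f z * (D j z * \<eta> (snd z)))" for j z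
    unfolding d2 I_def using \<eta>0(1)[of "snd z"] by (cases "snd z \<in> {\<alpha>..\<beta>}") auto
  have e3: "g z * \<phi> z = I z *\<^sub>R (g z * (\<psi> (fst z) * \<eta> (snd z)))" for z
    unfolding \<phi>_def I_def using \<eta>0(1)[of "snd z"] by (cases "snd z \<in> {\<alpha>..\<beta>}") auto
  have aux: "A + (G + B) = 0" if "- A + - S = G" "S = B" for A S G B :: complex
    using that by auto
  have "(\<Sum>j\<in>UNIV. LINT z|lebesgue. I z *\<^sub>R (f z * (D j z * \<eta> (snd z)))) =
      (LINT z|lebesgue. (\<Sum>j\<in>UNIV. I z *\<^sub>R (f z * (D j z * \<eta> (snd z)))))"
    by (rule Bochner_Integration.integral_sum[symmetric]) (rule F4)
  also have "\<dots> = (LINT z|lebesgue. I z *\<^sub>R (f z * (adj \<psi> z * \<eta> (snd z))))"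
    by (simp add: adj_def D_def scaleR_sum_right sum_distrib_left sum_distrib_right)
  finally have "(LINT z|lebesgue. I z *\<^sub>R (f z * (\<psi> (fst z) * dir_deriv 1 \<eta> (snd z)))) +
      ((LINT z|lebesgue. I z *\<^sub>R (g z * (\<psi> (fst z) * \<eta> (snd z)))) +
       (LINT z|lebesgue. I z *\<^sub>R (f z * (adj \<psi> z * \<eta> (snd z))))) = 0"
    by (rule aux[OF w[unfolded e1 e2 e3 sum_negf]])
  then have "(LINT t:{\<alpha>..\<beta>}|lebesgue. regular_dist (\<lambda>x. f (x, t)) \<psi> * dir_deriv 1 \<eta> t) +
      ((LINT t:{\<alpha>..\<beta>}|lebesgue. regular_dist (\<lambda>x. g (x, t)) \<psi> * \<eta> t) +
       (LINT t:{\<alpha>..\<beta>}|lebesgue. regular_dist (\<lambda>x. f (x, t)) (\<lambda>x. adj \<psi> (x, t)) * \<eta> t)) = 0"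
    unfolding I_def F1(2) F2(2) F3(2) .
  moreover have "(LINT t:{\<alpha>..\<beta>}|lebesgue. slice_deriv \<psi> t * \<eta> t) =
      (LINT t:{\<alpha>..\<beta>}|lebesgue. regular_dist (\<lambda>x. g (x, t)) \<psi> * \<eta> t) +
       (LINT t:{\<alpha>..\<beta>}|lebesgue. regular_dist (\<lambda>x. f (x, t)) (\<lambda>x. adj \<psi> (x, t)) * \<eta> t)"
    unfolding slice_deriv_def distrib_right by (rule set_integral_add(2)[OF F2(1) F3(1)])
  ultimately show ?thesis by simp
qed

lemma slice_integrable:
  assumes \<psi>: "smooth_on UNIV \<psi>" "supp \<psi> \<subseteq> K" and K: "compact K" "K \<times> {\<alpha>..\<beta>} \<subseteq> W"
  shows "set_integrable lebesgue {\<alpha>..\<beta>} (\<lambda>t. regular_dist (\<lambda>x. f (x, t)) \<psi>)"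
    and "set_integrable lebesgue {\<alpha>..\<beta>} (slice_deriv \<psi>)"
proof -
  have gK: "set_integrable lebesgue (K \<times> {\<alpha>..\<beta>}) g" by (rule g_cylinder[OF K(1) _ K(2)]) simp
  have c\<psi>: "continuous_on (K \<times> {\<alpha>..\<beta>}) (\<lambda>z. \<psi> (fst z))"
    by (rule continuous_on_subset[OF smooth_on_continuous[OF smooth_on_fst[OF \<psi>(1)]]]) auto
  have z1: "\<psi> (fst z) = 0" if "fst z \<notin> K" for z
    using that \<psi>(2) not_in_supp[of "fst z" \<psi>] by auto
  have z3: "adj \<psi> z = 0" if "fst z \<notin> K" for z
    using that \<psi>(2) adj_outside[of z \<psi>] by auto
  show "set_integrable lebesgue {\<alpha>..\<beta>} (\<lambda>t. regular_dist (\<lambda>x. f (x, t)) \<psi>)"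
    using Fubini_cylinder(2)[OF K(1) f_cylinder[OF K] c\<psi> z1] by simp
  have "set_integrable lebesgue {\<alpha>..\<beta>} (\<lambda>t. regular_dist (\<lambda>x. g (x, t)) \<psi>)"
    using Fubini_cylinder(2)[OF K(1) gK c\<psi> z1] by simp
  moreover have "set_integrable lebesgue {\<alpha>..\<beta>} (\<lambda>t. regular_dist (\<lambda>x. f (x, t)) (\<lambda>x. adj \<psi> (x, t)))"
    by (rule Fubini_cylinder(2)[OF K(1) f_cylinder[OF K] continuous_on_subset[OF continuous_adj[OF \<psi>(1)] K(2)] z3])
  ultimately show "set_integrable lebesgue {\<alpha>..\<beta>} (slice_deriv \<psi>)"
    unfolding slice_deriv_def by (rule set_integral_add(1))
qed

lemma slice_primitive:
  assumes \<psi>: "smooth_on UNIV \<psi>" "supp \<psi> \<subseteq> K" and K: "compact K" "K \<times> {\<alpha>..\<beta>} \<subseteq> W" and "\<alpha> < \<beta>"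
  shows "\<exists>c. AE t in lebesgue. t \<in> {\<alpha><..<\<beta>} \<longrightarrow>
    regular_dist (\<lambda>x. f (x, t)) \<psi> = c + (LINT s:{\<alpha>..t}|lebesgue. slice_deriv \<psi> s)"
proof -
  let ?i = "indicator {\<alpha>..\<beta>} :: real \<Rightarrow> real"
  let ?h = "\<lambda>t. ?i t *\<^sub>R regular_dist (\<lambda>x. f (x, t)) \<psi>"
  let ?k = "\<lambda>t. ?i t *\<^sub>R slice_deriv \<psi> t"
  have "\<exists>c. AE t in lebesgue. t \<in> {\<alpha><..<\<beta>} \<longrightarrow> ?h t = c + (LINT s:{\<alpha>..t}|lebesgue. ?k s)"
  proof (rule du_Bois_Reymond[OF _ _ \<open>\<alpha> < \<beta>\<close>])
    fix \<eta> :: "real \<Rightarrow> complex" assume "\<eta> \<in> test_functions {\<alpha><..<\<beta>}"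
    from weak_product[OF \<psi> K this]
    show "(LINT t|lebesgue. ?h t * dir_deriv 1 \<eta> t) + (LINT t|lebesgue. ?k t * \<eta> t) = 0"
      by (simp add: set_lebesgue_integral_def)
  qed (use slice_integrable[OF \<psi> K] in \<open>simp_all add: set_integrable_def\<close>)
  then obtain c where c: "AE t in lebesgue. t \<in> {\<alpha><..<\<beta>} \<longrightarrow> ?h t = c + (LINT s:{\<alpha>..t}|lebesgue. ?k s)"
    by blast
  have eq: "(LINT s:{\<alpha>..t}|lebesgue. ?k s) = (LINT s:{\<alpha>..t}|lebesgue. slice_deriv \<psi> s)" if "t \<in> {\<alpha><..<\<beta>}" for t
    unfolding set_lebesgue_integral_def
    by (intro Bochner_Integration.integral_cong) (use that in \<open>auto simp: indicator_def\<close>)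
  show ?thesis
    by (rule exI[of _ c], use c in eventually_elim) (auto simp: eq)
qed

end

section \<open>Slices as distributions\<close>

lemma set_integral_subset_mono:
  fixes F :: "'a \<Rightarrow> real"
  assumes "set_integrable M B F" "A \<subseteq> B" "A \<in> sets M" "\<And>x. 0 \<le> F x"
  shows "(LINT x:A|M. F x) \<le> (LINT x:B|M. F x)"
  unfolding set_lebesgue_integral_def
  by (rule integral_mono[OF set_integrable_subset[OF assms(1,3,2), unfolded set_integrable_def]
        assms(1)[unfolded set_integrable_def]])
    (use assms(2,4) in \<open>auto simp: indicator_def\<close>)

lemma set_integral_Icc_eq_HK:
  fixes k :: "real \<Rightarrow> 'a::euclidean_space"
  assumes "set_integrable lebesgue {\<alpha>..\<beta>} k" "\<alpha> \<le> s" "t \<le> \<beta>"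
  shows "(LINT \<sigma>:{s..t}|lebesgue. k \<sigma>) = integral {s..t} k"
  using assms by (intro set_lebesgue_integral_eq_integral(2) set_integrable_subset[OF assms(1)]) auto

lemma primitive_continuous:
  fixes k :: "real \<Rightarrow> 'a::euclidean_space"
  assumes "set_integrable lebesgue {\<alpha>..\<beta>} k"
  shows "continuous_on {\<alpha>..\<beta>} (\<lambda>t. LINT s:{\<alpha>..t}|lebesgue. k s)"
proof -
  have "continuous_on {\<alpha>..\<beta>} (\<lambda>t. integral {\<alpha>..t} k)"
    by (rule indefinite_integral_continuous_1[OF set_lebesgue_integral_eq_integral(1)[OF assms]])
  then show ?thesis
    by (rule continuous_on_eq) (use set_integral_Icc_eq_HK[OF assms] in auto)
qed

lemma primitive_diff:
  fixes k :: "real \<Rightarrow> 'a::euclidean_space"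
  assumes "set_integrable lebesgue {\<alpha>..\<beta>} k" "\<alpha> \<le> s" "s \<le> t" "t \<le> \<beta>"
  shows "(LINT \<sigma>:{\<alpha>..t}|lebesgue. k \<sigma>) - (LINT \<sigma>:{\<alpha>..s}|lebesgue. k \<sigma>) = (LINT \<sigma>:{s..t}|lebesgue. k \<sigma>)"
proof -
  have "k integrable_on {\<alpha>..t}"
    using assms by (intro set_lebesgue_integral_eq_integral(1) set_integrable_subset[OF assms(1)]) auto
  from Henstock_Kurzweil_Integration.integral_combine[OF assms(2,3) this]
  have "integral {\<alpha>..s} k + integral {s..t} k = integral {\<alpha>..t} k" .
  then show ?thesis
    using assms by (simp add: set_integral_Icc_eq_HK[OF assms(1)] algebra_simps)
qed

text \<open>The set where two continuous functions differ is open, and a nonempty open set is not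
  negligible.\<close>

lemma AE_eq_continuous_imp_eq:
  fixes H1 H2 :: "real \<Rightarrow> complex"
  assumes "continuous_on {\<alpha><..<\<beta>} H1" "continuous_on {\<alpha><..<\<beta>} H2"
    and "AE t in lebesgue. t \<in> {\<alpha><..<\<beta>} \<longrightarrow> H1 t = H2 t" and "t \<in> {\<alpha><..<\<beta>}"
  shows "H1 t = H2 t"
proof (rule ccontr)
  assume ne: "H1 t \<noteq> H2 t"
  define S where "S = {\<alpha><..<\<beta>} \<inter> (\<lambda>t. H1 t - H2 t) -` (- {0})"
  have "open S"
    unfolding S_def using assms(1,2) by (intro continuous_open_preimage continuous_on_diff) auto
  moreover have "t \<in> S" using ne assms(4) by (simp add: S_def)
  ultimately have "\<not> negligible S" using open_not_negligible by blast
  moreover have "negligible S"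
  proof -
    obtain N where N: "{t \<in> space lebesgue. \<not> (t \<in> {\<alpha><..<\<beta>} \<longrightarrow> H1 t = H2 t)} \<subseteq> N"
      "emeasure lebesgue N = 0" "N \<in> sets lebesgue"
      using assms(3) by (rule AE_E)
    then have "negligible N" unfolding negligible_iff_null_sets by (intro null_setsI)
    moreover have "S \<subseteq> N" using N(1) by (auto simp: S_def)
    ultimately show ?thesis by (rule negligible_subset)
  qed
  ultimately show False by blast
qed

text \<open>A whole e-neighbourhood of the compact cylinder lies in \<open>W\<close>; half of e for
  each factor suffices, as the product distance is at most the sum.\<close>

lemma compact_cylinder_tube:
  fixes W :: "('a::euclidean_space \<times> real) set"
  assumes "compact K" "open W" "K \<times> {\<alpha>..\<beta>} \<subseteq> W" "\<alpha> \<le> \<beta>"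
  obtains \<epsilon> where "\<epsilon> > 0" "\<And>x. x \<in> K \<Longrightarrow> ball x \<epsilon> \<times> {\<alpha> - \<epsilon><..<\<beta> + \<epsilon>} \<subseteq> W"
proof -
  have "compact (K \<times> {\<alpha>..\<beta>})" using assms(1) by (intro compact_Times) auto
  from compact_subset_open_imp_ball_epsilon_subset[OF this assms(2,3)]
  obtain e where e: "e > 0" "(\<Union>z\<in>K \<times> {\<alpha>..\<beta>}. ball z e) \<subseteq> W" by blast
  show ?thesis
  proof (rule that[of "e/2"])
    fix x assume x: "x \<in> K"
    show "ball x (e/2) \<times> {\<alpha> - e/2<..<\<beta> + e/2} \<subseteq> W"
    proof safe
      fix y s assume y: "y \<in> ball x (e/2)" and s: "s \<in> {\<alpha> - e/2<..<\<beta> + e/2}"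
      \<comment> \<open>The point of the interval nearest to s.\<close>
      define t where "t = max \<alpha> (min \<beta> s)"
      have t: "t \<in> {\<alpha>..\<beta>}" "dist t s < e/2" using s e(1) assms(4) by (auto simp: t_def dist_real_def max_def min_def)
      have "dist (x, t) (y, s) \<le> dist x y + dist t s"
        unfolding dist_Pair_Pair by (rule sqrt_sum_squares_le_sum) auto
      also have "\<dots> < e" using y t(2) by simp
      finally have "(y, s) \<in> ball (x, t) e" by simp
      then show "(y, s) \<in> W" using e(2) x t(1) by blast
    qed
  qed (use e in simp)
qed

lemma regular_dist_add:
  assumes "set_integrable lebesgue K f" "compact K" "supp \<phi> \<subseteq> K" "supp \<psi> \<subseteq> K"
    and "continuous_on K \<phi>" "continuous_on K \<psi>"
  shows "regular_dist f (\<lambda>x. \<phi> x + \<psi> x) = regular_dist f \<phi> + regular_dist f \<psi>"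
proof -
  have K: "K \<in> sets lebesgue" by (rule fmeasurableD[OF lmeasurable_compact[OF assms(2)]])
  have i: "set_integrable lebesgue K (\<lambda>x. f x * \<theta> x)" if c: "continuous_on K \<theta>" for \<theta>
  proof -
    obtain B where "\<And>x. x \<in> K \<Longrightarrow> norm (\<theta> x) \<le> B"
      using compact_norm_bound[OF assms(2) c] by blast
    from set_integrable_mult_bounded[OF assms(1) c this K] show ?thesis .
  qed
  have "supp (\<lambda>x. \<phi> x + \<psi> x) \<subseteq> K"
  proof (rule supp_subset_closed[OF compact_imp_closed[OF assms(2)]])
    fix x assume "x \<notin> K"
    then have "x \<notin> supp \<phi>" "x \<notin> supp \<psi>" using assms(3,4) by blast+
    then show "\<phi> x + \<psi> x = 0" using not_in_supp[of x \<phi>] not_in_supp[of x \<psi>] by simp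
  qed
  from regular_dist_set[OF this, of f] show ?thesis
    unfolding regular_dist_set[OF assms(3)] regular_dist_set[OF assms(4)] distrib_left
    using set_integral_add(2)[OF i[OF assms(5)] i[OF assms(6)]] by simp
qed

lemma regular_dist_cmult_left: "regular_dist f (\<lambda>x. c * \<phi> x) = c * regular_dist f \<phi>"
  using regular_dist_cmult[of f \<phi> c] by (simp add: mult.commute)

context transport_equation
begin

abbreviation "f_slice \<psi> t \<equiv> regular_dist (\<lambda>x. f (x, t)) \<psi>"

text \<open>The given continuous function and the primitive from \<open>slice_primitive\<close> both
  represent the pairing almost everywhere, so they agree at every time. Stated for any continuous
  version, the lemma serves the constructed family and an arbitrary one alike.\<close>

lemma slice_increment:
  assumes \<psi>: "smooth_on UNIV \<psi>" "supp \<psi> \<subseteq> K" and K: "compact K" "K \<times> {\<alpha>..\<beta>} \<subseteq> W"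
    and \<Phi>: "continuous_on {\<alpha><..<\<beta>} \<Phi>" "AE t in lebesgue. t \<in> {\<alpha><..<\<beta>} \<longrightarrow> \<Phi> t = f_slice \<psi> t"
    and st: "\<alpha> < s" "s \<le> t" "t < \<beta>"
  shows "\<Phi> t - \<Phi> s = (LINT \<sigma>:{s..t}|lebesgue. slice_deriv \<psi> \<sigma>)"
proof -
  have "\<alpha> < \<beta>" using st by simp
  obtain c where c: "AE t in lebesgue. t \<in> {\<alpha><..<\<beta>} \<longrightarrow>
      f_slice \<psi> t = c + (LINT s:{\<alpha>..t}|lebesgue. slice_deriv \<psi> s)"
    using slice_primitive[OF \<psi> K \<open>\<alpha> < \<beta>\<close>] by blast
  note k = slice_integrable(2)[OF \<psi> K]
  have "continuous_on {\<alpha><..<\<beta>} (\<lambda>t. c + (LINT s:{\<alpha>..t}|lebesgue. slice_deriv \<psi> s))"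
    by (intro continuous_on_add continuous_on_const continuous_on_subset[OF primitive_continuous[OF k]]) auto
  moreover have "AE t in lebesgue. t \<in> {\<alpha><..<\<beta>} \<longrightarrow> \<Phi> t = c + (LINT s:{\<alpha>..t}|lebesgue. slice_deriv \<psi> s)"
    using \<Phi>(2) c by eventually_elim simp
  ultimately have "\<Phi> t = c + (LINT s:{\<alpha>..t}|lebesgue. slice_deriv \<psi> s)" if "t \<in> {\<alpha><..<\<beta>}" for t
    using AE_eq_continuous_imp_eq[OF \<Phi>(1)] that by blast
  then show ?thesis
    using primitive_diff[OF k, of s t] st by simp
qed

lemma slice_continuous_version:
  assumes \<psi>: "smooth_on UNIV \<psi>" "supp \<psi> \<subseteq> K" and K: "compact K" "K \<times> {\<alpha>..\<beta>} \<subseteq> W" and "\<alpha> < \<beta>"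
  obtains \<Phi> where "continuous_on {\<alpha><..<\<beta>} \<Phi>" "AE t in lebesgue. t \<in> {\<alpha><..<\<beta>} \<longrightarrow> \<Phi> t = f_slice \<psi> t"
proof -
  obtain c where c: "AE t in lebesgue. t \<in> {\<alpha><..<\<beta>} \<longrightarrow>
      f_slice \<psi> t = c + (LINT s:{\<alpha>..t}|lebesgue. slice_deriv \<psi> s)"
    using slice_primitive[OF \<psi> K \<open>\<alpha> < \<beta>\<close>] by blast
  note k = slice_integrable(2)[OF \<psi> K]
  show ?thesis
  proof (rule that)
    show "continuous_on {\<alpha><..<\<beta>} (\<lambda>t. c + (LINT s:{\<alpha>..t}|lebesgue. slice_deriv \<psi> s))"
      by (intro continuous_on_add continuous_on_const continuous_on_subset[OF primitive_continuous[OF k]]) auto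
    show "AE t in lebesgue. t \<in> {\<alpha><..<\<beta>} \<longrightarrow> c + (LINT s:{\<alpha>..t}|lebesgue. slice_deriv \<psi> s) = f_slice \<psi> t"
      using c by eventually_elim simp
  qed
qed

section \<open>Seminorm estimates for the adjoint term\<close>

lemma adj_slice:
  assumes "K \<times> {t} \<subseteq> W" "supp \<psi> \<subseteq> K" "smooth_on UNIV \<psi>"
  shows "adj \<psi> (x, t) = (\<Sum>j\<in>UNIV. dir_deriv (axis j 1) (\<lambda>x. a j (x, t) * \<psi> x) x)"
proof (cases "x \<in> supp \<psi>")
  case True
  then have W: "(x, t) \<in> W" using assms by auto
  have "dir_deriv (axis j 1) (\<lambda>x. a j (x, t) * \<psi> x) x = dir_deriv (axis j 1, 0) (\<lambda>z. a j z * \<psi> (fst z)) (x, t)" for j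
    using dir_deriv_eqI[OF slice_has_derivative[OF smooth_on_differentiable[OF smooth_a_mult[OF assms(3)] W]]] by simp
  then show ?thesis by (simp add: adj_def)
next
  case False
  have "dir_deriv (axis j 1) (\<lambda>x. a j (x, t) * \<psi> x) x = dir_deriv (axis j 1) (\<lambda>x. 0) x" for j
    using False by (intro dir_deriv_cong[of "- supp \<psi>"]) (auto intro: not_in_supp)
  then show ?thesis using False by (simp add: adj_outside)
qed

text \<open>Only x-derivatives are listed, because seminorms of \<open>adj \<psi>\<close> are taken
  at fixed time. As functions on \<open>W\<close> they can be bounded by compactness in (x, t), for
  all times together.\<close>

definition coeff_bounded :: "nat \<Rightarrow> real \<Rightarrow> ((real^'n) \<times> real) set \<Rightarrow> bool" where
  "coeff_bounded m A S \<longleftrightarrow> A \<ge> 0 \<and> (\<forall>j. \<forall>es\<in>multi_indices m. \<forall>z\<in>S.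
     norm (iter_deriv (map (\<lambda>e. (e, 0)) es) (a j) z) \<le> A)"

lemma coeff_boundedI:
  assumes "\<And>j es. es \<in> multi_indices m \<Longrightarrow> \<exists>B. \<forall>z\<in>S. norm (iter_deriv (map (\<lambda>e. (e, 0)) es) (a j) z) \<le> B"
  obtains A where "coeff_bounded m A S"
proof -
  have "\<forall>p\<in>UNIV \<times> multi_indices m. \<exists>B. \<forall>z\<in>S. norm (iter_deriv (map (\<lambda>e. (e, 0)) (snd p)) (a (fst p)) z) \<le> B"
    using assms by auto
  from bchoice[OF this] obtain B where
    B: "\<forall>p\<in>UNIV \<times> multi_indices m. \<forall>z\<in>S. norm (iter_deriv (map (\<lambda>e. (e, 0)) (snd p)) (a (fst p)) z) \<le> B p"
    by (rule exE)
  have "coeff_bounded m (\<Sum>p\<in>UNIV \<times> multi_indices m. \<bar>B p\<bar>) S"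
    unfolding coeff_bounded_def
  proof (intro conjI allI ballI)
    fix j and es :: "(real^'n) list" and z assume *: "es \<in> multi_indices m" "z \<in> S"
    then have "norm (iter_deriv (map (\<lambda>e. (e, 0)) es) (a j) z) \<le> B (j, es)" using B by force
    also have "\<dots> \<le> \<bar>B (j, es)\<bar>" by simp
    also have "\<dots> \<le> (\<Sum>p\<in>UNIV \<times> multi_indices m. \<bar>B p\<bar>)"
      using * by (intro member_le_sum) (auto simp: finite_multi_indices)
    finally show "norm (iter_deriv (map (\<lambda>e. (e, 0)) es) (a j) z) \<le> (\<Sum>p\<in>UNIV \<times> multi_indices m. \<bar>B p\<bar>)" .
  qed (simp add: sum_nonneg)
  then show ?thesis using that by blast
qed

lemma map_zero_in_Basis: "es \<in> multi_indices m \<Longrightarrow> set (map (\<lambda>e. (e, 0::real)) es) \<subseteq> Basis"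
  by (auto simp: multi_indices_def Basis_prod_def)

lemma coeff_bounded_compact:
  assumes "compact S" "S \<subseteq> W"
  obtains A where "coeff_bounded m A S"
proof (rule coeff_boundedI)
  fix j and es :: "(real^'n) list" assume "es \<in> multi_indices m"
  then have c: "continuous_on S (iter_deriv (map (\<lambda>e. (e, 0)) es) (a j))"
    using assms(2) by (intro continuous_on_subset[OF smooth_on_continuous[OF smooth_on_iter_deriv[OF smooth_a map_zero_in_Basis]]])
  obtain B where "B > 0" "\<And>z. z \<in> S \<Longrightarrow> norm (iter_deriv (map (\<lambda>e. (e, 0)) es) (a j) z) \<le> B"
    using compact_norm_bound[OF assms(1) c] by blast
  then show "\<exists>B. \<forall>z\<in>S. norm (iter_deriv (map (\<lambda>e. (e, 0)) es) (a j) z) \<le> B"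
    by (intro exI[of _ B] ballI)
qed (rule that)

text \<open>The outer cardinality comes from the sum over multi-indices in the seminorm,
  \<open>CARD('n')\<close> from the sum over j, and the rest from
  \<open>Ck_seminorm_dir_deriv_mult_le\<close> for a single j.\<close>

definition adj_const :: "nat \<Rightarrow> real" where
  "adj_const m = card (multi_indices m :: (real^'n) list set) * (CARD('n) * (card (multi_indices m :: (real^'n) list set) * 2 ^ Suc m))"

lemma adj_const_nonneg: "adj_const m \<ge> 0"
  by (simp add: adj_const_def)

text \<open>At each fixed t the adjoint term is again a test function, at the cost of one derivative
  of \<psi>. That it stays within the support of \<psi> allows the estimates to be iterated over one
  compact set.\<close>

lemma adj_slice_test:
  assumes W: "K \<times> {t} \<subseteq> W" and \<psi>: "\<psi> \<in> test_functions UNIV" "supp \<psi> \<subseteq> K"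
  shows "(\<lambda>x. adj \<psi> (x, t)) \<in> test_functions {x. (x, t) \<in> W}"
    and "supp (\<lambda>x. adj \<psi> (x, t)) \<subseteq> supp \<psi>"
    and "coeff_bounded (Suc m) A (K \<times> {t}) \<Longrightarrow>
      Ck_seminorm m (\<lambda>x. adj \<psi> (x, t)) \<le> adj_const m * A * Ck_seminorm (Suc m) \<psi>"
proof -
  let ?\<Omega> = "{x. (x, t) \<in> W}"
  have \<Omega>: "open ?\<Omega>" by (rule open_slice[OF open_W])
  have \<psi>\<Omega>: "\<psi> \<in> test_functions ?\<Omega>" using W \<psi> by (intro test_functions_mono[OF \<psi>(1)]) auto
  define T where "T j = dir_deriv (axis j 1) (\<lambda>x. a j (x, t) * \<psi> x)" for j
  have eq: "(\<lambda>x. adj \<psi> (x, t)) = (\<lambda>x. \<Sum>j\<in>UNIV. T j x)"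
    using adj_slice[OF W \<psi>(2) test_functions_smooth[OF \<psi>(1)]] by (simp add: T_def)
  have axB: "axis j (1::real) \<in> Basis" for j :: 'n by (simp add: axis_in_Basis_iff)
  have T: "T j \<in> test_functions ?\<Omega>" for j
    unfolding T_def
    by (intro test_functions_dir_deriv test_functions_mult \<psi>\<Omega> \<Omega> smooth_on_slice open_W smooth_a axB)
  show "(\<lambda>x. adj \<psi> (x, t)) \<in> test_functions ?\<Omega>"
    unfolding eq by (intro test_functions_sum T)
  show "supp (\<lambda>x. adj \<psi> (x, t)) \<subseteq> supp \<psi>"
    by (rule supp_subset_closed) (auto intro: adj_outside)
  assume A: "coeff_bounded (Suc m) A (K \<times> {t})"
  let ?N = "real (card (multi_indices m :: (real^'n) list set))"
  have TC: "Ck_seminorm m (T j) \<le> ?N * (2 ^ Suc m * A * Ck_seminorm (Suc m) \<psi>)" for j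
    unfolding T_def
  proof (rule Ck_seminorm_dir_deriv_mult_le[OF \<psi>\<Omega> \<Omega> smooth_on_slice[OF open_W smooth_a] axB])
    show "A \<ge> 0" using A by (simp add: coeff_bounded_def)
    fix es :: "(real^'n) list" and x assume es: "es \<in> multi_indices (Suc m)" and x: "x \<in> supp \<psi>"
    then have "(x, t) \<in> W" "set es \<subseteq> Basis" using W \<psi>(2) by (auto simp: multi_indices_def)
    then have "iter_deriv es (\<lambda>x. a j (x, t)) x = iter_deriv (map (\<lambda>e. (e, 0)) es) (a j) (x, t)"
      by (intro iter_deriv_slice[OF open_W smooth_a])
    then show "norm (iter_deriv es (\<lambda>x. a j (x, t)) x) \<le> A"
      using A es x \<psi>(2) by (auto simp: coeff_bounded_def)
  qed
  have "Ck_seminorm m (\<lambda>x. adj \<psi> (x, t)) \<le> ?N * (\<Sum>j\<in>(UNIV::'n set). ?N * (2 ^ Suc m * A * Ck_seminorm (Suc m) \<psi>))"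
  proof (rule Ck_seminorm_le)
    fix es :: "(real^'n) list" and x assume es: "es \<in> multi_indices m"
    have "iter_deriv es (\<lambda>x. adj \<psi> (x, t)) x = (\<Sum>j\<in>UNIV. iter_deriv es (T j) x)"
      unfolding eq using es T test_functions_smooth
      by (intro iter_deriv_sum[OF open_UNIV]) (auto simp: multi_indices_def)
    also have "norm \<dots> \<le> (\<Sum>j\<in>UNIV. norm (iter_deriv es (T j) x))" by (rule norm_sum)
    also have "\<dots> \<le> (\<Sum>j\<in>(UNIV::'n set). ?N * (2 ^ Suc m * A * Ck_seminorm (Suc m) \<psi>))"
      by (intro sum_mono order_trans[OF norm_iter_deriv_le_Ck_seminorm[OF T es] TC])
    finally show "norm (iter_deriv es (\<lambda>x. adj \<psi> (x, t)) x) \<le> (\<Sum>j\<in>(UNIV::'n set). ?N * (2 ^ Suc m * A * Ck_seminorm (Suc m) \<psi>))" .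
  qed
  also have "\<dots> = adj_const m * A * Ck_seminorm (Suc m) \<psi>"
    by (simp add: adj_const_def algebra_simps)
  finally show "Ck_seminorm m (\<lambda>x. adj \<psi> (x, t)) \<le> adj_const m * A * Ck_seminorm (Suc m) \<psi>" .
qed

text \<open>The slice masses of f and g have finite integrals over the time interval. The pairings
  with \<psi> cost its supremum, the adjoint term one derivative more: hence the order one.\<close>

lemma slice_bounds_compact:
  assumes K: "compact K" "K \<times> {\<alpha>..\<beta>} \<subseteq> W"
  obtains C where "C \<ge> 0"
    "\<And>\<psi>. \<psi> \<in> test_functions UNIV \<Longrightarrow> supp \<psi> \<subseteq> K \<Longrightarrow>
      (LINT t:{\<alpha>..\<beta>}|lebesgue. norm (f_slice \<psi> t)) \<le> C * Ck_seminorm 1 \<psi>"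
    "\<And>\<psi>. \<psi> \<in> test_functions UNIV \<Longrightarrow> supp \<psi> \<subseteq> K \<Longrightarrow>
      (LINT t:{\<alpha>..\<beta>}|lebesgue. norm (slice_deriv \<psi> t)) \<le> C * Ck_seminorm 1 \<psi>"
proof -
  have cK: "compact (K \<times> {\<alpha>..\<beta>})" using K(1) by (intro compact_Times) auto
  obtain A where A: "coeff_bounded (Suc 0) A (K \<times> {\<alpha>..\<beta>})"
    using coeff_bounded_compact[OF cK K(2)] by blast
  then have A0: "A \<ge> 0" by (simp add: coeff_bounded_def)
  have gK: "set_integrable lebesgue (K \<times> {\<alpha>..\<beta>}) g" by (rule g_cylinder[OF K(1) _ K(2)]) simp
  note mf = slice_mass_integrable[OF f_cylinder[OF K]] and mg = slice_mass_integrable[OF gK]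
  define Mf where "Mf = (LINT t:{\<alpha>..\<beta>}|lebesgue. slice_mass K f t)"
  define Mg where "Mg = (LINT t:{\<alpha>..\<beta>}|lebesgue. slice_mass K g t)"
  have M0: "Mf \<ge> 0" "Mg \<ge> 0"
    unfolding Mf_def Mg_def set_lebesgue_integral_def by (auto intro!: integral_nonneg_AE simp: slice_mass_nonneg)
  have Ks: "K \<in> sets lebesgue" by (rule fmeasurableD[OF lmeasurable_compact[OF K(1)]])
  show ?thesis
  \<comment> \<open>\<open>Mf\<close> bounds the pairing itself; \<open>Mg\<close> and the last
    summand bound the two parts of \<open>slice_deriv\<close>.\<close>
  proof (rule that[of "Mf + Mg + adj_const 0 * A * Mf"])
    show "Mf + Mg + adj_const 0 * A * Mf \<ge> 0" using M0 A0 adj_const_nonneg by simp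
    fix \<psi> assume \<psi>: "\<psi> \<in> test_functions UNIV" "supp \<psi> \<subseteq> K"
    have s: "smooth_on UNIV \<psi>" by (rule test_functions_smooth[OF \<psi>(1)])
    note i = slice_integrable[OF s \<psi>(2) K]
    let ?P = "Ck_seminorm 1 \<psi>"
    have P0: "?P \<ge> 0" by (rule Ck_seminorm_nonneg[OF \<psi>(1)])
    have fb: "norm (f_slice \<phi> t) \<le> B * slice_mass K f t"
      if "set_integrable lebesgue K (\<lambda>x. f (x, t))" "\<phi> \<in> test_functions \<Omega>" "supp \<phi> \<subseteq> K" "\<And>x. norm (\<phi> x) \<le> B" for \<phi> \<Omega> B t
      using norm_regular_dist_le[OF that(1) Ks test_functions_continuous[OF that(2)] that(3,4)]
      by (simp add: slice_mass_def)
    have gb: "norm (regular_dist (\<lambda>x. g (x, t)) \<psi>) \<le> ?P * slice_mass K g t"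
      if "set_integrable lebesgue K (\<lambda>x. g (x, t))" for t
      using norm_regular_dist_le[OF that Ks test_functions_continuous[OF \<psi>(1)] \<psi>(2) norm_le_Ck_seminorm[OF \<psi>(1), of _ 1]]
      by (simp add: slice_mass_def)
    have f1: "AE t in lebesgue. t \<in> {\<alpha>..\<beta>} \<longrightarrow> norm (f_slice \<psi> t) \<le> ?P * slice_mass K f t"
      using mf(1) by eventually_elim (use fb[OF _ \<psi> norm_le_Ck_seminorm[OF \<psi>(1), of _ 1]] in auto)
    have k1: "AE t in lebesgue. t \<in> {\<alpha>..\<beta>} \<longrightarrow>
        norm (slice_deriv \<psi> t) \<le> ?P * slice_mass K g t + (adj_const 0 * A * ?P) * slice_mass K f t"
      using mf(1) mg(1)
    proof eventually_elim
      case (elim t)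
      show ?case
      proof
        assume t: "t \<in> {\<alpha>..\<beta>}"
        have Kt: "K \<times> {t} \<subseteq> W" using K(2) t by auto
        have At: "coeff_bounded (Suc 0) A (K \<times> {t})" using A t by (auto simp: coeff_bounded_def)
        note adj = adj_slice_test[OF Kt \<psi>]
        have "norm (adj \<psi> (x, t)) \<le> adj_const 0 * A * ?P" for x
          using norm_le_Ck_seminorm[OF adj(1), of x 0] adj(3)[OF At] by simp
        from fb[OF _ adj(1) subset_trans[OF adj(2) \<psi>(2)] this]
        have "norm (f_slice (\<lambda>x. adj \<psi> (x, t)) t) \<le> (adj_const 0 * A * ?P) * slice_mass K f t"
          using elim t by simp
        with gb[of t] show "norm (slice_deriv \<psi> t) \<le> ?P * slice_mass K g t + (adj_const 0 * A * ?P) * slice_mass K f t"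
          unfolding slice_deriv_def using elim t by (intro norm_triangle_mono) auto
      qed
    qed
    have "(LINT t:{\<alpha>..\<beta>}|lebesgue. norm (f_slice \<psi> t)) \<le> (LINT t:{\<alpha>..\<beta>}|lebesgue. ?P * slice_mass K f t)"
      by (rule set_integral_mono_AE[OF set_integrable_norm[OF i(1)] set_integrable_mult_right[OF mf(2)] f1])
    also have "\<dots> = Mf * ?P" by (simp add: Mf_def)
    also have "\<dots> \<le> (Mf + Mg + adj_const 0 * A * Mf) * ?P"
      using M0 A0 adj_const_nonneg P0 by (intro mult_right_mono) auto
    finally show "(LINT t:{\<alpha>..\<beta>}|lebesgue. norm (f_slice \<psi> t)) \<le> (Mf + Mg + adj_const 0 * A * Mf) * ?P" .
    have "(LINT t:{\<alpha>..\<beta>}|lebesgue. norm (slice_deriv \<psi> t)) \<le>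
        (LINT t:{\<alpha>..\<beta>}|lebesgue. ?P * slice_mass K g t + (adj_const 0 * A * ?P) * slice_mass K f t)"
      by (rule set_integral_mono_AE[OF set_integrable_norm[OF i(2)]
            set_integral_add(1)[OF set_integrable_mult_right[OF mg(2)] set_integrable_mult_right[OF mf(2)]] k1])
    also have "\<dots> = ?P * Mg + (adj_const 0 * A * ?P) * Mf"
      using set_integral_add(2)[OF set_integrable_mult_right[OF mg(2), of ?P] set_integrable_mult_right[OF mf(2), of "adj_const 0 * A * ?P"]]
      by (simp add: Mf_def Mg_def)
    also have "\<dots> \<le> (Mf + Mg + adj_const 0 * A * Mf) * ?P"
      using mult_nonneg_nonneg[OF M0(1) P0] by (simp add: algebra_simps)
    finally show "(LINT t:{\<alpha>..\<beta>}|lebesgue. norm (slice_deriv \<psi> t)) \<le> (Mf + Mg + adj_const 0 * A * Mf) * ?P" .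
  qed
qed

text \<open>Formulated through the germ at t of a continuous version, so no compact set or fixed
  interval enters, and the values found in different cylinders fit together to one family.\<close>

definition slice_value :: "(real^'n \<Rightarrow> complex) \<Rightarrow> real \<Rightarrow> complex \<Rightarrow> bool" where
  "slice_value \<psi> t v \<longleftrightarrow> (\<exists>\<epsilon>>0. \<exists>H. continuous_on {t - \<epsilon><..<t + \<epsilon>} H \<and> H t = v \<and>
     (AE s in lebesgue. s \<in> {t - \<epsilon><..<t + \<epsilon>} \<longrightarrow> H s = f_slice \<psi> s))"

definition slice_fam :: "real \<Rightarrow> (real^'n \<Rightarrow> complex) \<Rightarrow> complex" where
  "slice_fam t \<psi> = (THE v. slice_value \<psi> t v)"

lemma slice_value_unique:
  assumes "slice_value \<psi> t v" "slice_value \<psi> t w"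
  shows "v = w"
proof -
  obtain d H where H: "d > 0" "continuous_on {t - d<..<t + d} H" "H t = v"
     "AE s in lebesgue. s \<in> {t - d<..<t + d} \<longrightarrow> H s = f_slice \<psi> s"
    using assms(1) unfolding slice_value_def by blast
  obtain e G where G: "e > 0" "continuous_on {t - e<..<t + e} G" "G t = w"
     "AE s in lebesgue. s \<in> {t - e<..<t + e} \<longrightarrow> G s = f_slice \<psi> s"
    using assms(2) unfolding slice_value_def by blast
  define m where "m = min d e"
  have "H t = G t"
  proof (rule AE_eq_continuous_imp_eq)
    show "continuous_on {t - m<..<t + m} H"
      by (rule continuous_on_subset[OF H(2)]) (auto simp: m_def)
    show "continuous_on {t - m<..<t + m} G"
      by (rule continuous_on_subset[OF G(2)]) (auto simp: m_def)
    show "AE s in lebesgue. s \<in> {t - m<..<t + m} \<longrightarrow> H s = G s"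
      using H(4) G(4) by eventually_elim (auto simp: m_def)
    show "t \<in> {t - m<..<t + m}" using H(1) G(1) by (auto simp: m_def)
  qed
  then show ?thesis using H(3) G(3) by simp
qed

lemma slice_fam_eq_value:
  assumes "slice_value \<psi> t v"
  shows "slice_fam t \<psi> = v"
  unfolding slice_fam_def by (rule the_equality, rule assms, rule slice_value_unique[OF _ assms])

lemma slice_value_interval:
  assumes "continuous_on {\<alpha><..<\<beta>} \<Phi>" "AE t in lebesgue. t \<in> {\<alpha><..<\<beta>} \<longrightarrow> \<Phi> t = f_slice \<psi> t" "t \<in> {\<alpha><..<\<beta>}"
  shows "slice_value \<psi> t (\<Phi> t)"
  unfolding slice_value_def
proof (intro exI conjI)
  let ?\<epsilon> = "min (t - \<alpha>) (\<beta> - t)"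
  have sub: "{t - ?\<epsilon><..<t + ?\<epsilon>} \<subseteq> {\<alpha><..<\<beta>}" by auto
  show "?\<epsilon> > 0" using assms(3) by auto
  show "continuous_on {t - ?\<epsilon><..<t + ?\<epsilon>} \<Phi>" by (rule continuous_on_subset[OF assms(1) sub])
  show "AE s in lebesgue. s \<in> {t - ?\<epsilon><..<t + ?\<epsilon>} \<longrightarrow> \<Phi> s = f_slice \<psi> s"
    using assms(2) by eventually_elim (use sub in blast)
qed (rule refl)

lemma slice_fam_cylinder:
  assumes \<psi>: "smooth_on UNIV \<psi>" "supp \<psi> \<subseteq> K" and K: "compact K" "K \<times> {\<alpha>..\<beta>} \<subseteq> W" and "\<alpha> < \<beta>"
  shows "continuous_on {\<alpha><..<\<beta>} (\<lambda>t. slice_fam t \<psi>)"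
    and "AE t in lebesgue. t \<in> {\<alpha><..<\<beta>} \<longrightarrow> slice_fam t \<psi> = f_slice \<psi> t"
    and "t \<in> {\<alpha><..<\<beta>} \<Longrightarrow> slice_value \<psi> t (slice_fam t \<psi>)"
proof -
  obtain \<Phi> where \<Phi>: "continuous_on {\<alpha><..<\<beta>} \<Phi>" "AE t in lebesgue. t \<in> {\<alpha><..<\<beta>} \<longrightarrow> \<Phi> t = f_slice \<psi> t"
    using slice_continuous_version[OF \<psi> K \<open>\<alpha> < \<beta>\<close>] by blast
  have v: "slice_value \<psi> t (\<Phi> t)" if "t \<in> {\<alpha><..<\<beta>}" for t
    by (rule slice_value_interval[OF \<Phi> that])
  then have eq: "slice_fam t \<psi> = \<Phi> t" if "t \<in> {\<alpha><..<\<beta>}" for t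
    using that by (intro slice_fam_eq_value)
  show "continuous_on {\<alpha><..<\<beta>} (\<lambda>t. slice_fam t \<psi>)"
    by (rule continuous_on_eq[OF \<Phi>(1)]) (simp add: eq)
  show "AE t in lebesgue. t \<in> {\<alpha><..<\<beta>} \<longrightarrow> slice_fam t \<psi> = f_slice \<psi> t"
    using \<Phi>(2) by eventually_elim (simp add: eq)
  show "slice_value \<psi> t (slice_fam t \<psi>)" if "t \<in> {\<alpha><..<\<beta>}"
    using v[OF that] eq[OF that] by simp
qed

text \<open>The value at t differs from the value at any s by at most the variation over the
  interval. Averaging over s replaces the value at s by the pairing with f, which equals it almost
  everywhere.\<close>

lemma slice_fam_norm_le:
  assumes \<psi>: "smooth_on UNIV \<psi>" "supp \<psi> \<subseteq> K" and K: "compact K" "K \<times> {\<alpha>..\<beta>} \<subseteq> W" and t: "t \<in> {\<alpha><..<\<beta>}"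
  shows "norm (slice_fam t \<psi>) \<le> (LINT s:{\<alpha>..\<beta>}|lebesgue. norm (f_slice \<psi> s)) / (\<beta> - \<alpha>) +
    (LINT s:{\<alpha>..\<beta>}|lebesgue. norm (slice_deriv \<psi> s))"
proof -
  have "\<alpha> < \<beta>" using t by auto
  note F = slice_fam_cylinder[OF \<psi> K \<open>\<alpha> < \<beta>\<close>]
  note i = slice_integrable[OF \<psi> K]
  define M where "M = (LINT s:{\<alpha>..\<beta>}|lebesgue. norm (slice_deriv \<psi> s))"
  have inc: "norm (LINT \<sigma>:{s..s'}|lebesgue. slice_deriv \<psi> \<sigma>) \<le> M" if "\<alpha> \<le> s" "s' \<le> \<beta>" for s s'
  proof -
    have "set_integrable lebesgue {s..s'} (slice_deriv \<psi>)"
      using that by (intro set_integrable_subset[OF i(2)]) auto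
    then have "norm (LINT \<sigma>:{s..s'}|lebesgue. slice_deriv \<psi> \<sigma>) \<le> (LINT \<sigma>:{s..s'}|lebesgue. norm (slice_deriv \<psi> \<sigma>))"
      by (rule set_integral_norm_bound)
    also have "\<dots> \<le> M"
      unfolding M_def using that
      by (intro set_integral_subset_mono[OF set_integrable_norm[OF i(2)]]) auto
    finally show ?thesis .
  qed
  have le: "norm (slice_fam t \<psi>) \<le> norm (slice_fam s \<psi>) + M" if s: "s \<in> {\<alpha><..<\<beta>}" for s
  proof (cases "s \<le> t")
    case True
    have "norm (slice_fam t \<psi> - slice_fam s \<psi>) \<le> M"
      using slice_increment[OF \<psi> K F(1,2), of s t] inc[of s t] True s t by simp
    then show ?thesis using norm_triangle_ineq2[of "slice_fam t \<psi>" "slice_fam s \<psi>"] by linarith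
  next
    case False
    have "norm (slice_fam s \<psi> - slice_fam t \<psi>) \<le> M"
      using slice_increment[OF \<psi> K F(1,2), of t s] inc[of t s] False s t by simp
    then show ?thesis using norm_triangle_ineq3[of "slice_fam s \<psi>" "slice_fam t \<psi>"] by linarith
  qed
  have AE: "AE s in lebesgue. s \<in> {\<alpha>..\<beta>} \<longrightarrow> norm (slice_fam t \<psi>) \<le> norm (f_slice \<psi> s) + M"
  proof -
    have "AE s in lebesgue. s \<noteq> \<alpha> \<and> s \<noteq> \<beta>"
      using AE_lborel_singleton[of \<alpha>] AE_lborel_singleton[of \<beta>] unfolding lebesgue_AE_lborel
      by eventually_elim simp
    then show ?thesis
      using F(2)
    proof eventually_elim
      case (elim s)
      show ?case
      proof
        assume "s \<in> {\<alpha>..\<beta>}"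
        then have "s \<in> {\<alpha><..<\<beta>}" using elim(1) by simp
        with le[of s] elim(2) show "norm (slice_fam t \<psi>) \<le> norm (f_slice \<psi> s) + M" by simp
      qed
    qed
  qed
  have c: "set_integrable lebesgue {\<alpha>..\<beta>} (\<lambda>s. c)" for c :: real
    using absolutely_integrable_on_const[of "{\<alpha>..\<beta>}" c] by simp
  have "(LINT s:{\<alpha>..\<beta>}|lebesgue. norm (slice_fam t \<psi>)) \<le> (LINT s:{\<alpha>..\<beta>}|lebesgue. norm (f_slice \<psi> s) + M)"
    by (rule set_integral_mono_AE[OF c set_integral_add(1)[OF set_integrable_norm[OF i(1)] c] AE])
  also have "\<dots> = (LINT s:{\<alpha>..\<beta>}|lebesgue. norm (f_slice \<psi> s)) + (LINT s:{\<alpha>..\<beta>}|lebesgue. M)"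
    by (rule set_integral_add(2)[OF set_integrable_norm[OF i(1)] c])
  finally have "(\<beta> - \<alpha>) * norm (slice_fam t \<psi>) \<le> (LINT s:{\<alpha>..\<beta>}|lebesgue. norm (f_slice \<psi> s)) + (\<beta> - \<alpha>) * M"
    using \<open>\<alpha> < \<beta>\<close> by (simp add: set_lebesgue_integral_def)
  then show ?thesis
    unfolding M_def[symmetric] using \<open>\<alpha> < \<beta>\<close> by (simp add: field_simps)
qed

lemma slice_tube:
  assumes "compact K" "K \<subseteq> {x. (x, t) \<in> W}"
  obtains \<epsilon> where "\<epsilon> > 0" "K \<times> {t - \<epsilon>..t + \<epsilon>} \<subseteq> W"
proof -
  have "K \<times> {t..t} \<subseteq> W" using assms(2) by auto
  from compact_cylinder_tube[OF assms(1) open_W this order_refl]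
  obtain \<epsilon> where \<epsilon>: "\<epsilon> > 0" "\<And>x. x \<in> K \<Longrightarrow> ball x \<epsilon> \<times> {t - \<epsilon><..<t + \<epsilon>} \<subseteq> W" by blast
  have "K \<times> {t - \<epsilon>/2..t + \<epsilon>/2} \<subseteq> W"
  proof safe
    fix x s assume "x \<in> K" "s \<in> {t - \<epsilon>/2..t + \<epsilon>/2}"
    then have "(x, s) \<in> ball x \<epsilon> \<times> {t - \<epsilon><..<t + \<epsilon>}" using \<epsilon>(1) by auto
    then show "(x, s) \<in> W" using \<epsilon>(2) \<open>x \<in> K\<close> by blast
  qed
  then show ?thesis using that[of "\<epsilon>/2"] \<epsilon>(1) by simp
qed

text \<open>Additivity holds for the pairing at almost every time, and a sum of continuous versions
  is a continuous version, so it holds at the given time t.\<close>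

lemma slice_fam_add:
  assumes "\<phi> \<in> test_functions {x. (x, t) \<in> W}" "\<psi> \<in> test_functions {x. (x, t) \<in> W}"
  shows "slice_fam t (\<lambda>x. \<phi> x + \<psi> x) = slice_fam t \<phi> + slice_fam t \<psi>"
proof -
  define K where "K = supp \<phi> \<union> supp \<psi>"
  have K: "compact K" "K \<subseteq> {x. (x, t) \<in> W}" and sub: "supp \<phi> \<subseteq> K" "supp \<psi> \<subseteq> K"
    unfolding K_def using assms by (auto simp: test_functions_def)
  obtain \<epsilon> where \<epsilon>: "\<epsilon> > 0" "K \<times> {t - \<epsilon>..t + \<epsilon>} \<subseteq> W" using slice_tube[OF K] by blast
  have t: "t - \<epsilon> < t + \<epsilon>" "t \<in> {t - \<epsilon><..<t + \<epsilon>}" using \<epsilon>(1) by auto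
  note F = slice_fam_cylinder[OF test_functions_smooth[OF assms(1)] sub(1) K(1) \<epsilon>(2) t(1)]
  note G = slice_fam_cylinder[OF test_functions_smooth[OF assms(2)] sub(2) K(1) \<epsilon>(2) t(1)]
  have "slice_value (\<lambda>x. \<phi> x + \<psi> x) t (slice_fam t \<phi> + slice_fam t \<psi>)"
  proof (rule slice_value_interval[OF continuous_on_add[OF F(1) G(1)] _ t(2)])
    show "AE s in lebesgue. s \<in> {t - \<epsilon><..<t + \<epsilon>} \<longrightarrow> slice_fam s \<phi> + slice_fam s \<psi> = f_slice (\<lambda>x. \<phi> x + \<psi> x) s"
      using F(2) G(2) slice_mass_integrable(1)[OF f_cylinder[OF K(1) \<epsilon>(2)]]
    proof eventually_elim
      case (elim s)
      then show ?case
        using regular_dist_add[OF _ K(1) sub test_functions_continuous[OF assms(1)] test_functions_continuous[OF assms(2)], of "\<lambda>x. f (x, s)"]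
        by auto
    qed
  qed
  then show ?thesis by (rule slice_fam_eq_value)
qed

lemma slice_fam_cmult:
  assumes "\<phi> \<in> test_functions {x. (x, t) \<in> W}"
  shows "slice_fam t (\<lambda>x. c * \<phi> x) = c * slice_fam t \<phi>"
proof -
  have K: "compact (supp \<phi>)" "supp \<phi> \<subseteq> {x. (x, t) \<in> W}"
    using assms by (auto simp: test_functions_def)
  obtain \<epsilon> where \<epsilon>: "\<epsilon> > 0" "supp \<phi> \<times> {t - \<epsilon>..t + \<epsilon>} \<subseteq> W" using slice_tube[OF K] by blast
  have t: "t - \<epsilon> < t + \<epsilon>" "t \<in> {t - \<epsilon><..<t + \<epsilon>}" using \<epsilon>(1) by auto
  note F = slice_fam_cylinder[OF test_functions_smooth[OF assms(1)] order_refl K(1) \<epsilon>(2) t(1)]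
  have "slice_value (\<lambda>x. c * \<phi> x) t (c * slice_fam t \<phi>)"
  proof (rule slice_value_interval[OF continuous_on_mult_left[OF F(1)] _ t(2)])
    show "AE s in lebesgue. s \<in> {t - \<epsilon><..<t + \<epsilon>} \<longrightarrow> c * slice_fam s \<phi> = f_slice (\<lambda>x. c * \<phi> x) s"
      using F(2) by eventually_elim (simp add: regular_dist_cmult_left)
  qed
  then show ?thesis by (rule slice_fam_eq_value)
qed

lemma slice_fam_bound:
  assumes K: "compact K" "K \<subseteq> {x. (x, t) \<in> W}"
  obtains C where "C \<ge> 0" "\<And>\<psi>. \<psi> \<in> test_functions UNIV \<Longrightarrow> supp \<psi> \<subseteq> K \<Longrightarrow>
    norm (slice_fam t \<psi>) \<le> C * Ck_seminorm 1 \<psi>"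
proof -
  obtain \<epsilon> where \<epsilon>: "\<epsilon> > 0" "K \<times> {t - \<epsilon>..t + \<epsilon>} \<subseteq> W" using slice_tube[OF K] by blast
  have t: "t \<in> {t - \<epsilon><..<t + \<epsilon>}" using \<epsilon>(1) by auto
  from slice_bounds_compact[OF K(1) \<epsilon>(2)] obtain C where C: "C \<ge> 0"
    "\<And>\<psi>. \<psi> \<in> test_functions UNIV \<Longrightarrow> supp \<psi> \<subseteq> K \<Longrightarrow>
      (LINT t:{t - \<epsilon>..t + \<epsilon>}|lebesgue. norm (f_slice \<psi> t)) \<le> C * Ck_seminorm 1 \<psi>"
    "\<And>\<psi>. \<psi> \<in> test_functions UNIV \<Longrightarrow> supp \<psi> \<subseteq> K \<Longrightarrow>
      (LINT t:{t - \<epsilon>..t + \<epsilon>}|lebesgue. norm (slice_deriv \<psi> t)) \<le> C * Ck_seminorm 1 \<psi>"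
    by metis
  show ?thesis
  \<comment> \<open>The first summand is the mean over an interval of length 2 \<epsilon>, the
    second the variation.\<close>
  proof (rule that[of "C / (2 * \<epsilon>) + C"])
    show "C / (2 * \<epsilon>) + C \<ge> 0" using C(1) \<epsilon>(1) by simp
    fix \<psi> assume \<psi>: "\<psi> \<in> test_functions UNIV" "supp \<psi> \<subseteq> K"
    have "norm (slice_fam t \<psi>) \<le> (C * Ck_seminorm 1 \<psi>) / (t + \<epsilon> - (t - \<epsilon>)) + C * Ck_seminorm 1 \<psi>"
      using \<epsilon>(1)
      by (intro order_trans[OF slice_fam_norm_le[OF test_functions_smooth[OF \<psi>(1)] \<psi>(2) K(1) \<epsilon>(2) t]]
          add_mono divide_right_mono C \<psi>) simp
    then show "norm (slice_fam t \<psi>) \<le> (C / (2 * \<epsilon>) + C) * Ck_seminorm 1 \<psi>"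
      by (simp add: algebra_simps)
  qed
qed

lemma slice_fam_distribution: "distribution {x. (x, t) \<in> W} (slice_fam t)"
  unfolding distribution_def
proof (intro conjI ballI allI impI)
  fix K assume "compact K \<and> K \<subseteq> {x. (x, t) \<in> W}"
  then have K: "compact K" "K \<subseteq> {x. (x, t) \<in> W}" by auto
  obtain C where C: "\<And>\<psi>. \<psi> \<in> test_functions UNIV \<Longrightarrow> supp \<psi> \<subseteq> K \<Longrightarrow>
    norm (slice_fam t \<psi>) \<le> C * Ck_seminorm 1 \<psi>"
    using slice_fam_bound[OF K] by metis
  show "\<exists>C k. \<forall>\<phi>\<in>test_functions {x. (x, t) \<in> W}. supp \<phi> \<subseteq> K \<longrightarrow> norm (slice_fam t \<phi>) \<le> C * Ck_seminorm k \<phi>"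
    using C test_functions_mono[OF _ subset_UNIV] by (intro exI[of _ C] exI[of _ 1]) blast
qed (simp_all add: slice_fam_add slice_fam_cmult)

text \<open>At a time outside the null set belonging to \<open>D\<close>, both sides are continuous
  in \<psi> for the C^1 seminorm: the left by \<open>slice_fam_bound\<close>, the right by
  integrability of f(.,t) on \<open>K\<close>. Hence equality passes from \<open>D\<close> to every
  \<psi>.\<close>

lemma slice_fam_AE:
  assumes K: "compact K" "K \<times> {\<alpha>..\<beta>} \<subseteq> W" and "\<alpha> < \<beta>"
  shows "AE t in lebesgue. t \<in> {\<alpha><..<\<beta>} \<longrightarrow> set_integrable lebesgue K (\<lambda>x. f (x, t)) \<and>
    (\<forall>\<psi>\<in>test_functions UNIV. supp \<psi> \<subseteq> K \<longrightarrow> slice_fam t \<psi> = f_slice \<psi> t)"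
proof -
  obtain D where D: "countable D" "D \<subseteq> {\<phi>\<in>test_functions UNIV. supp \<phi> \<subseteq> K}"
    "\<And>\<phi> \<epsilon>. \<phi> \<in> test_functions UNIV \<Longrightarrow> supp \<phi> \<subseteq> K \<Longrightarrow> \<epsilon> > 0 \<Longrightarrow>
       \<exists>\<phi>'\<in>D. Ck_seminorm 1 (\<lambda>x. \<phi> x + (-1) * \<phi>' x) < \<epsilon>"
    using countable_Ck_dense[OF K(1), of UNIV 1] by blast
  have "AE t in lebesgue. \<forall>\<phi>\<in>D. t \<in> {\<alpha><..<\<beta>} \<longrightarrow> slice_fam t \<phi> = f_slice \<phi> t"
    unfolding AE_ball_countable[OF D(1)]
  proof
    fix \<phi> assume "\<phi> \<in> D"
    then have "smooth_on UNIV \<phi>" "supp \<phi> \<subseteq> K" using D(2) test_functions_smooth by auto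
    from slice_fam_cylinder(2)[OF this K \<open>\<alpha> < \<beta>\<close>]
    show "AE t in lebesgue. t \<in> {\<alpha><..<\<beta>} \<longrightarrow> slice_fam t \<phi> = f_slice \<phi> t" .
  qed
  then show ?thesis
    using slice_mass_integrable(1)[OF f_cylinder[OF K]]
  proof eventually_elim
    case (elim t)
    show ?case
    proof (intro impI conjI ballI)
      assume t: "t \<in> {\<alpha><..<\<beta>}"
      show int: "set_integrable lebesgue K (\<lambda>x. f (x, t))" using elim t by auto
      have Kt: "K \<subseteq> {x. (x, t) \<in> W}" using K(2) t by auto
      have Ks: "K \<in> sets lebesgue" by (rule fmeasurableD[OF lmeasurable_compact[OF K(1)]])
      obtain C where C: "C \<ge> 0" "\<And>\<psi>. \<psi> \<in> test_functions UNIV \<Longrightarrow> supp \<psi> \<subseteq> K \<Longrightarrow>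
          norm (slice_fam t \<psi>) \<le> C * Ck_seminorm 1 \<psi>"
        using slice_fam_bound[OF K(1) Kt] by metis
      define M where "M = slice_mass K f t"
      have M0: "M \<ge> 0" by (simp add: M_def slice_mass_nonneg)
      fix \<psi> assume \<psi>: "\<psi> \<in> test_functions UNIV" "supp \<psi> \<subseteq> K"
      have small: "norm (slice_fam t \<psi> - f_slice \<psi> t) \<le> (C + M) * \<epsilon>" if \<epsilon>: "\<epsilon> > 0" for \<epsilon>
      proof -
        obtain \<phi> where \<phi>: "\<phi> \<in> D" "Ck_seminorm 1 (\<lambda>x. \<psi> x + (-1) * \<phi> x) < \<epsilon>" using D(3)[OF \<psi> \<epsilon>] by blast
        have \<phi>t: "\<phi> \<in> test_functions UNIV" "supp \<phi> \<subseteq> K" using \<phi>(1) D(2) by auto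
        define \<theta> where "\<theta> = (\<lambda>x. \<psi> x + (-1) * \<phi> x)"
        have n\<phi>: "(\<lambda>x. (-1) * \<phi> x) \<in> test_functions UNIV" by (rule test_functions_cmult[OF \<phi>t(1)])
        have n\<phi>s: "supp (\<lambda>x. (-1) * \<phi> x) \<subseteq> K" using \<phi>t(2) by simp
        have \<theta>: "\<theta> \<in> test_functions UNIV" unfolding \<theta>_def by (rule test_functions_add[OF \<psi>(1) n\<phi>])
        have \<theta>s: "supp \<theta> \<subseteq> K"
        proof (rule supp_subset_closed[OF compact_imp_closed[OF K(1)]])
          fix x assume "x \<notin> K"
          then have "x \<notin> supp \<psi>" "x \<notin> supp \<phi>" using \<psi>(2) \<phi>t(2) by blast+
          then show "\<theta> x = 0" using not_in_supp[of x \<psi>] not_in_supp[of x \<phi>] by (simp add: \<theta>_def)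
        qed
        have W: "\<psi> \<in> test_functions {x. (x, t) \<in> W}" "\<phi> \<in> test_functions {x. (x, t) \<in> W}"
          "(\<lambda>x. (-1) * \<phi> x) \<in> test_functions {x. (x, t) \<in> W}"
          using \<psi> \<phi>t n\<phi> n\<phi>s Kt by (blast intro: test_functions_mono)+
        have "slice_fam t \<theta> = slice_fam t \<psi> + slice_fam t (\<lambda>x. (-1) * \<phi> x)"
          unfolding \<theta>_def by (rule slice_fam_add[OF W(1,3)])
        also have "\<dots> = slice_fam t \<psi> - slice_fam t \<phi>"
          unfolding slice_fam_cmult[OF W(2)] by simp
        finally have e1: "slice_fam t \<theta> = slice_fam t \<psi> - slice_fam t \<phi>" .
        have "f_slice \<theta> t = f_slice \<psi> t + f_slice (\<lambda>x. (-1) * \<phi> x) t"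
          unfolding \<theta>_def
          by (rule regular_dist_add[OF int K(1) \<psi>(2) n\<phi>s test_functions_continuous[OF \<psi>(1)] test_functions_continuous[OF n\<phi>]])
        also have "\<dots> = f_slice \<psi> t - f_slice \<phi> t"
          unfolding regular_dist_cmult_left by simp
        finally have "slice_fam t \<psi> - f_slice \<psi> t = slice_fam t \<theta> - f_slice \<theta> t"
          using e1 elim(1) \<phi>(1) t by simp
        also have "norm \<dots> \<le> C * Ck_seminorm 1 \<theta> + Ck_seminorm 1 \<theta> * M"
        proof (rule order_trans[OF norm_triangle_ineq4], rule add_mono)
          show "norm (slice_fam t \<theta>) \<le> C * Ck_seminorm 1 \<theta>" by (rule C(2)[OF \<theta> \<theta>s])
          show "norm (f_slice \<theta> t) \<le> Ck_seminorm 1 \<theta> * M"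
            unfolding M_def slice_mass_def
            by (rule norm_regular_dist_le[OF int Ks test_functions_continuous[OF \<theta>] \<theta>s norm_le_Ck_seminorm[OF \<theta>]])
        qed
        also have "\<dots> = (C + M) * Ck_seminorm 1 \<theta>" by (simp add: algebra_simps)
        also have "\<dots> \<le> (C + M) * \<epsilon>"
          using \<phi>(2) C(1) M0 by (intro mult_left_mono) (auto simp: \<theta>_def)
        finally show ?thesis .
      qed
      have "norm (slice_fam t \<psi> - f_slice \<psi> t) \<le> 0"
      proof (rule field_le_epsilon)
        fix e :: real assume e: "e > 0"
        have "(C + M) * (e / (C + M + 1)) \<le> e"
          using C(1) M0 e by (simp add: field_simps)
        then show "norm (slice_fam t \<psi> - f_slice \<psi> t) \<le> 0 + e"
          using small[of "e / (C + M + 1)"] C(1) M0 e by simp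
      qed
      then show "slice_fam t \<psi> = f_slice \<psi> t" by simp
    qed
  qed
qed

end

section \<open>Slice families\<close>

text \<open>A countable exhaustion of the ball, so that null sets can be united. The point of
  \<open>K\<close> farthest from the centre decides how large n must be, and n + 2 keeps the radii
  positive.\<close>

lemma compact_subset_smaller_cball:
  fixes K :: "'a::euclidean_space set"
  assumes "compact K" "K \<subseteq> ball c r" "r > 0"
  obtains N :: nat where "\<And>n. n \<ge> N \<Longrightarrow> K \<subseteq> cball c (r - r / real (n + 2))"
proof (cases "K = {}")
  case True
  then show ?thesis using that by blast
next
  case False
  obtain y where y: "y \<in> K" "\<forall>x\<in>K. dist c x \<le> dist c y"
    using continuous_attains_sup[OF assms(1) False continuous_on_dist[OF continuous_on_const continuous_on_id]]
    by blast
  then have "r - dist c y > 0" using assms(2) by auto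
  then have "(r - dist c y) / r > 0" using assms(3) by simp
  then obtain N where N: "inverse (real (Suc N)) < (r - dist c y) / r" using reals_Archimedean by blast
  show ?thesis
  proof (rule that[of N], rule subsetI)
    fix n x assume n: "N \<le> n" and x: "x \<in> K"
    have "r / real (n + 2) \<le> r * inverse (real (Suc N))"
      unfolding divide_inverse using n assms(3) by (intro mult_left_mono le_imp_inverse_le) auto
    also have "\<dots> \<le> r - dist c y" using N assms(3) by (simp add: field_simps)
    finally show "x \<in> cball c (r - r / real (n + 2))" using y(2) x by fastforce
  qed
qed

lemma open_interval_exhaust:
  assumes "t \<in> {\<alpha><..<\<beta>}"
  obtains N :: nat where "\<And>n. n \<ge> N \<Longrightarrow> t \<in> {\<alpha> + 1 / real (Suc n)<..<\<beta> - 1 / real (Suc n)}"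
proof -
  have "min (t - \<alpha>) (\<beta> - t) > 0" using assms by auto
  then obtain N where N: "inverse (real (Suc N)) < min (t - \<alpha>) (\<beta> - t)" using reals_Archimedean by blast
  show ?thesis
  proof (rule that[of N])
    fix n assume "N \<le> n"
    then have "1 / real (Suc n) \<le> inverse (real (Suc N))" by (simp add: field_simps)
    then show "t \<in> {\<alpha> + 1 / real (Suc n)<..<\<beta> - 1 / real (Suc n)}" using N by (auto simp del: of_nat_Suc)
  qed
qed

lemma regular_dist_sum:
  assumes "set_integrable lebesgue K f" "compact K" "finite I"
    and "\<And>i. i \<in> I \<Longrightarrow> supp (\<phi> i) \<subseteq> K" "\<And>i. i \<in> I \<Longrightarrow> continuous_on K (\<phi> i)"
  shows "regular_dist f (\<lambda>x. \<Sum>i\<in>I. \<phi> i x) = (\<Sum>i\<in>I. regular_dist f (\<phi> i))"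
  using assms(3-5)
proof (induction I rule: finite_induct)
  case empty
  show ?case by (simp add: regular_dist_def)
next
  case (insert i I)
  have "supp (\<lambda>x. \<Sum>i\<in>I. \<phi> i x) \<subseteq> K"
  proof (rule supp_subset_closed[OF compact_imp_closed[OF assms(2)]])
    fix x assume x: "x \<notin> K"
    have "\<phi> i x = 0" if "i \<in> I" for i
      using insert.prems(1)[of i] that x by (intro not_in_supp) auto
    then show "(\<Sum>i\<in>I. \<phi> i x) = 0" by simp
  qed
  moreover have "continuous_on K (\<lambda>x. \<Sum>i\<in>I. \<phi> i x)"
    using insert.prems by (intro continuous_on_sum) auto
  ultimately have "regular_dist f (\<lambda>x. \<phi> i x + (\<Sum>i\<in>I. \<phi> i x)) = regular_dist f (\<phi> i) + regular_dist f (\<lambda>x. \<Sum>i\<in>I. \<phi> i x)"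
    using insert.prems by (intro regular_dist_add[OF assms(1,2)]) auto
  then show ?case using insert by simp
qed

text \<open>A one-sided Cauchy criterion. The bound depends on the later time only, so letting s
  tend to 0 along a sequence bounds the distance of \<phi>(t) from the limit by R(t).\<close>

lemma tendsto_at_right_if_modulus:
  fixes \<phi> :: "real \<Rightarrow> complex"
  assumes "\<delta> > 0" "\<And>s t. 0 < s \<Longrightarrow> s \<le> t \<Longrightarrow> t < \<delta> \<Longrightarrow> norm (\<phi> t - \<phi> s) \<le> R t"
    and R: "(R \<longlongrightarrow> 0) (at_right 0)"
  obtains L where "(\<phi> \<longlongrightarrow> L) (at_right 0)"
proof -
  have small: "\<exists>b>0. b < \<delta> \<and> (\<forall>t. 0 < t \<and> t < b \<longrightarrow> R t < e)" if e: "e > 0" for e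
  proof -
    obtain b where b: "b > 0" "\<And>t. 0 < t \<Longrightarrow> t < b \<Longrightarrow> R t < e"
      using order_tendstoD(2)[OF R e] unfolding eventually_at_right_field by blast
    show ?thesis using b assms(1) by (intro exI[of _ "min b (\<delta>/2)"]) auto
  qed
  define x where "x n = \<delta> / real (n + 2)" for n
  have x: "0 < x n" "x n < \<delta>" for n using assms(1) by (auto simp: x_def field_simps intro!: add_pos_nonneg)
  have x0: "x \<longlonglongrightarrow> 0"
    unfolding x_def by (rule LIMSEQ_ignore_initial_segment[OF lim_const_over_n])
  have "Cauchy (\<lambda>n. \<phi> (x n))"
  proof (rule CauchyI)
    fix e :: real assume "e > 0"
    then obtain b where b: "b > 0" "b < \<delta>" "\<And>t. 0 < t \<Longrightarrow> t < b \<Longrightarrow> R t < e" using small by blast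
    obtain N where N: "\<And>n. n \<ge> N \<Longrightarrow> x n < b"
      using order_tendstoD(2)[OF x0 b(1)] unfolding eventually_sequentially by blast
    have "norm (\<phi> (x m) - \<phi> (x n)) < e" if "m \<ge> N" "n \<ge> N" for m n
    proof (cases "x n \<le> x m")
      case True
      have "norm (\<phi> (x m) - \<phi> (x n)) \<le> R (x m)" by (rule assms(2)[OF x(1) True x(2)])
      also have "\<dots> < e" by (rule b(3)[OF x(1) N[OF that(1)]])
      finally show ?thesis .
    next
      case False
      then have "norm (\<phi> (x n) - \<phi> (x m)) \<le> R (x n)" by (intro assms(2) x) auto
      also have "\<dots> < e" by (rule b(3)[OF x(1) N[OF that(2)]])
      finally show ?thesis by (simp add: norm_minus_commute)
    qed
    then show "\<exists>M. \<forall>m\<ge>M. \<forall>n\<ge>M. norm (\<phi> (x m) - \<phi> (x n)) < e" by blast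
  qed
  then obtain L where L: "(\<lambda>n. \<phi> (x n)) \<longlonglongrightarrow> L" using Cauchy_convergent_iff convergent_def by blast
  have "norm (\<phi> t - L) \<le> R t" if t: "0 < t" "t < \<delta>" for t
  proof (rule tendsto_upperbound)
    show "(\<lambda>n. norm (\<phi> t - \<phi> (x n))) \<longlonglongrightarrow> norm (\<phi> t - L)" by (intro tendsto_intros L)
    show "\<forall>\<^sub>F n in sequentially. norm (\<phi> t - \<phi> (x n)) \<le> R t"
      using order_tendstoD(2)[OF x0 t(1)] by eventually_elim (use assms(2) x(1) t(2) in auto)
  qed simp
  then have "\<forall>\<^sub>F t in at_right 0. norm (\<phi> t - L) \<le> R t"
    unfolding eventually_at_right_field using assms(1) by blast
  then have "((\<lambda>t. \<phi> t - L) \<longlongrightarrow> 0) (at_right 0)"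
    by (rule Lim_null_comparison[OF _ R])
  then have "(\<phi> \<longlongrightarrow> L) (at_right 0)" by (simp add: LIM_zero_iff)
  then show ?thesis by (rule that)
qed

lemma powr_set_integral:
  fixes s t p :: real
  assumes "0 < s" "s \<le> t" "p \<noteq> 1"
  shows "set_integrable lebesgue {s..t} (\<lambda>\<sigma>. \<sigma> powr (- p))"
    and "(LINT \<sigma>:{s..t}|lebesgue. \<sigma> powr (- p)) = (t powr (1 - p) - s powr (1 - p)) / (1 - p)"
proof -
  have "continuous_on {s..t} (\<lambda>\<sigma>. \<sigma> powr (- p))"
    by (rule continuous_on_powr[OF continuous_on_id continuous_on_const]) (use assms(1) in auto)
  then show i: "set_integrable lebesgue {s..t} (\<lambda>\<sigma>. \<sigma> powr (- p))"
    by (rule absolutely_integrable_continuous_real)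
  have "((\<lambda>\<sigma>. \<sigma> powr (- p)) has_integral (t powr (1 - p) / (1 - p) - s powr (1 - p) / (1 - p))) {s..t}"
  proof (rule fundamental_theorem_of_calculus[OF assms(2)])
    fix x assume "x \<in> {s..t}"
    then have "x > 0" using assms(1) by auto
    then have "((\<lambda>x. x powr (1 - p) / (1 - p)) has_real_derivative ((1 - p) * x powr (1 - p - 1)) / (1 - p)) (at x within {s..t})"
      by (intro DERIV_cdivide DERIV_subset[OF has_real_derivative_powr]) auto
    then show "((\<lambda>x. x powr (1 - p) / (1 - p)) has_vector_derivative x powr - p) (at x within {s..t})"
      using assms(3) by (simp add: has_real_derivative_iff_has_vector_derivative)
  qed
  then show "(LINT \<sigma>:{s..t}|lebesgue. \<sigma> powr (- p)) = (t powr (1 - p) - s powr (1 - p)) / (1 - p)"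
    using set_lebesgue_integral_eq_integral(2)[OF i] by (simp add: integral_unique diff_divide_distrib)
qed

lemma distribution_subset:
  assumes "distribution \<Omega> u" "\<Omega>' \<subseteq> \<Omega>"
  shows "distribution \<Omega>' u"
proof -
  have sub: "\<phi> \<in> test_functions \<Omega>" if "\<phi> \<in> test_functions \<Omega>'" for \<phi>
    using that assms(2) by (auto simp: test_functions_def)
  show ?thesis
    unfolding distribution_def
  proof (intro conjI ballI allI impI)
    fix K assume "compact K \<and> K \<subseteq> \<Omega>'"
    then have "compact K" "K \<subseteq> \<Omega>" using assms(2) by auto
    from distribution_bound[OF assms(1) this] obtain C k where
      "\<forall>\<phi>\<in>test_functions \<Omega>. supp \<phi> \<subseteq> K \<longrightarrow> norm (u \<phi>) \<le> C * Ck_seminorm k \<phi>" by blast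
    then show "\<exists>C k. \<forall>\<phi>\<in>test_functions \<Omega>'. supp \<phi> \<subseteq> K \<longrightarrow> norm (u \<phi>) \<le> C * Ck_seminorm k \<phi>"
      using sub by blast
  qed (use distribution_add[OF assms(1)] distribution_cmult[OF assms(1)] sub in blast)+
qed

lemma distribution_bound_nonneg:
  assumes "distribution \<Omega> u" "compact K" "K \<subseteq> \<Omega>"
  obtains C k where "C \<ge> 0" "\<And>\<phi>. \<phi> \<in> test_functions UNIV \<Longrightarrow> supp \<phi> \<subseteq> K \<Longrightarrow> norm (u \<phi>) \<le> C * Ck_seminorm k \<phi>"
proof -
  from distribution_bound[OF assms] obtain C k where
    C: "\<forall>\<phi>\<in>test_functions \<Omega>. supp \<phi> \<subseteq> K \<longrightarrow> norm (u \<phi>) \<le> C * Ck_seminorm k \<phi>" by blast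
  show ?thesis
  proof (rule that[of "\<bar>C\<bar>" k])
    fix \<phi> assume \<phi>: "\<phi> \<in> test_functions UNIV" "supp \<phi> \<subseteq> K"
    then have "\<phi> \<in> test_functions \<Omega>" using assms(3) by (blast intro: test_functions_mono)
    then have "norm (u \<phi>) \<le> C * Ck_seminorm k \<phi>" using C \<phi>(2) by blast
    also have "\<dots> \<le> \<bar>C\<bar> * Ck_seminorm k \<phi>"
      by (intro mult_right_mono Ck_seminorm_nonneg[OF \<phi>(1)]) simp
    finally show "norm (u \<phi>) \<le> \<bar>C\<bar> * Ck_seminorm k \<phi>" .
  qed simp
qed

section \<open>Existence of a slice family\<close>

context transport_equation
begin

text \<open>This gives the choice in \<open>slice_dist\<close> its meaning. The cylinders in the
  definition are open, so compact cylinders inside them are used: continuity is checked near each t,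
  and the null sets come from a countable exhaustion.\<close>

lemma slice_fam_is_slice_family: "is_slice_family W f slice_fam"
  unfolding is_slice_family_def
proof (intro conjI allI impI ballI)
  show "distribution {x. (x, t) \<in> W} (slice_fam t)" for t by (rule slice_fam_distribution)
next
  fix c r \<alpha> \<beta> \<psi>
  assume "0 < r \<and> ball c r \<times> {\<alpha><..<\<beta>} \<subseteq> W"
  then have r: "r > 0" and sub: "ball c r \<times> {\<alpha><..<\<beta>} \<subseteq> W" by auto
  assume \<psi>: "\<psi> \<in> test_functions (ball c r)"
  show "continuous_on {\<alpha><..<\<beta>} (\<lambda>t. slice_fam t \<psi>)"
    unfolding continuous_on_eq_continuous_at[OF open_greaterThanLessThan]
  proof
    fix t assume t: "t \<in> {\<alpha><..<\<beta>}"
    define p where "p = (\<alpha> + t) / 2"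
    define q where "q = (t + \<beta>) / 2"
    have pq: "\<alpha> < p" "p < t" "t < q" "q < \<beta>" using t by (auto simp: p_def q_def)
    have "supp \<psi> \<times> {p..q} \<subseteq> W"
      using test_functions_supp[OF \<psi>] pq by (intro subset_trans[OF _ sub] Sigma_mono) auto
    from slice_fam_cylinder(1)[OF test_functions_smooth[OF \<psi>] order_refl test_functions_compact[OF \<psi>] this]
    have "continuous_on {p<..<q} (\<lambda>t. slice_fam t \<psi>)" using pq by simp
    then show "isCont (\<lambda>t. slice_fam t \<psi>) t"
      unfolding continuous_on_eq_continuous_at[OF open_greaterThanLessThan] using pq by simp
  qed
next
  fix c r \<alpha> \<beta>
  assume "0 < r \<and> ball c r \<times> {\<alpha><..<\<beta>} \<subseteq> W"
  then have r: "r > 0" and sub: "ball c r \<times> {\<alpha><..<\<beta>} \<subseteq> W" by auto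
  define K where "K n = cball c (r - r / real (n + 2))" for n
  define p where "p n = \<alpha> + 1 / real (Suc n)" for n
  define q where "q n = \<beta> - 1 / real (Suc n)" for n
  define good where "good t n \<longleftrightarrow> set_integrable lebesgue (K n) (\<lambda>x. f (x, t)) \<and>
    (\<forall>\<psi>\<in>test_functions UNIV. supp \<psi> \<subseteq> K n \<longrightarrow> slice_fam t \<psi> = f_slice \<psi> t)" for t n
  have "AE t in lebesgue. t \<in> {p n<..<q n} \<longrightarrow> good t n" for n
  proof (cases "p n < q n")
    case True
    have pos: "r / real (n + 2) > 0" "1 / real (Suc n) > 0" using r by auto
    have "{p n..q n} \<subseteq> {\<alpha><..<\<beta>}"
    proof
      show "t \<in> {\<alpha><..<\<beta>}" if "t \<in> {p n..q n}" for t
        using that pos(2) unfolding p_def q_def atLeastAtMost_iff greaterThanLessThan_iff by linarith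
    qed
    moreover have "K n \<subseteq> ball c r"
    proof
      show "x \<in> ball c r" if "x \<in> K n" for x
        using that pos(1) unfolding K_def mem_cball mem_ball by linarith
    qed
    ultimately have "K n \<times> {p n..q n} \<subseteq> W" by (intro subset_trans[OF _ sub] Sigma_mono)
    from slice_fam_AE[OF _ this True] show ?thesis unfolding good_def by (simp add: K_def)
  qed simp
  then have "AE t in lebesgue. \<forall>n. t \<in> {p n<..<q n} \<longrightarrow> good t n"
    unfolding AE_all_countable by blast
  then show "AE t in lebesgue. t \<in> {\<alpha><..<\<beta>} \<longrightarrow>
      locally_integrable_on (\<lambda>x. f (x, t)) (ball c r) \<and>
      (\<forall>\<psi>\<in>test_functions (ball c r). slice_fam t \<psi> = f_slice \<psi> t)"
  proof eventually_elim
    case (elim t)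
    show ?case
    proof
      assume t: "t \<in> {\<alpha><..<\<beta>}"
      obtain N where N: "\<And>n. n \<ge> N \<Longrightarrow> t \<in> {p n<..<q n}"
        using open_interval_exhaust[OF t] unfolding p_def q_def by blast
      have cover: "\<exists>n. C \<subseteq> K n \<and> good t n" if C: "compact C" "C \<subseteq> ball c r" for C
      proof -
        obtain M where M: "\<And>n. n \<ge> M \<Longrightarrow> C \<subseteq> K n"
          using compact_subset_smaller_cball[OF C r] unfolding K_def by blast
        show ?thesis using M[of "max M N"] N[of "max M N"] elim by (intro exI[of _ "max M N"]) simp
      qed
      show "locally_integrable_on (\<lambda>x. f (x, t)) (ball c r) \<and>
          (\<forall>\<psi>\<in>test_functions (ball c r). slice_fam t \<psi> = f_slice \<psi> t)"
        unfolding locally_integrable_on_def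
      proof (intro conjI allI impI ballI)
        fix C assume "compact C \<and> C \<subseteq> ball c r"
        then have C: "compact C" "C \<subseteq> ball c r" by auto
        obtain n where n: "C \<subseteq> K n" "good t n" using cover[OF C] by blast
        show "set_integrable lebesgue C (\<lambda>x. f (x, t))"
          using n(2) unfolding good_def
          by (intro set_integrable_subset[OF _ fmeasurableD[OF lmeasurable_compact[OF C(1)]] n(1)]) simp
      next
        fix \<psi> assume \<psi>: "\<psi> \<in> test_functions (ball c r)"
        obtain n where n: "supp \<psi> \<subseteq> K n" "good t n"
          using cover[OF test_functions_compact[OF \<psi>] test_functions_supp[OF \<psi>]] by blast
        have "\<psi> \<in> test_functions UNIV" by (rule test_functions_mono[OF \<psi> subset_UNIV])
        then show "slice_fam t \<psi> = f_slice \<psi> t" using n unfolding good_def by blast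
      qed
    qed
  qed
qed

end

text \<open>About the family picked by \<open>slice_dist\<close> nothing is known beyond
  \<open>is_slice_family\<close>, so the remaining estimates are proved for an arbitrary such
  \<open>F\<close>.\<close>

locale slice_family_transport = transport_equation W a f g
  for W :: "((real^'n) \<times> real) set" and a f g +
  fixes F :: "real \<Rightarrow> (real^'n \<Rightarrow> complex) \<Rightarrow> complex"
  assumes fam: "is_slice_family W f F"
begin

lemma F_distribution: "t > 0 \<Longrightarrow> distribution {x. (x, t) \<in> W} (F t)"
  using fam unfolding is_slice_family_def by blast

text \<open>\<open>is_slice_family\<close> relates \<open>F\<close> to f on balls only. A partition
  of unity with balls small enough for \<open>W\<close>, together with linearity of
  \<open>F t\<close>, carries continuity and the almost everywhere identity to all of
  \<open>K\<close>.\<close>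

lemma F_cylinder:
  assumes K: "compact K" "K \<times> {\<alpha>..\<beta>} \<subseteq> W" and "0 \<le> \<alpha>" "\<alpha> < \<beta>"
  shows "\<psi> \<in> test_functions UNIV \<Longrightarrow> supp \<psi> \<subseteq> K \<Longrightarrow> continuous_on {\<alpha><..<\<beta>} (\<lambda>t. F t \<psi>)"
    and "AE t in lebesgue. t \<in> {\<alpha><..<\<beta>} \<longrightarrow> (\<forall>\<psi>\<in>test_functions UNIV. supp \<psi> \<subseteq> K \<longrightarrow> F t \<psi> = f_slice \<psi> t)"
proof -
  obtain \<epsilon> where \<epsilon>: "\<epsilon> > 0" "\<And>x. x \<in> K \<Longrightarrow> ball x \<epsilon> \<times> {\<alpha> - \<epsilon><..<\<beta> + \<epsilon>} \<subseteq> W"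
    using compact_cylinder_tube[OF K(1) open_W K(2)] assms(4) by (metis less_imp_le)
  obtain C where C: "finite C" "C \<subseteq> K"
    "\<And>\<psi> \<Omega>. \<psi> \<in> test_functions \<Omega> \<Longrightarrow> supp \<psi> \<subseteq> K \<Longrightarrow>
      \<exists>\<psi>s. (\<forall>c\<in>C. \<psi>s c \<in> test_functions (ball c \<epsilon>) \<and> supp (\<psi>s c) \<subseteq> supp \<psi>) \<and>
        \<psi> = (\<lambda>x. \<Sum>c\<in>C. \<psi>s c x)"
    using test_function_partition[OF K(1) \<epsilon>(1)] by blast
  have cyl: "\<epsilon> > 0 \<and> ball c \<epsilon> \<times> {\<alpha><..<\<beta>} \<subseteq> W" if "c \<in> C" for c
    using \<epsilon> C(2) that by (intro conjI subset_trans[OF _ \<epsilon>(2)[of c]] Sigma_mono) auto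
  have Fsum: "F t (\<lambda>x. \<Sum>c\<in>C. \<psi>s c x) = (\<Sum>c\<in>C. F t (\<psi>s c))"
    if "t \<in> {\<alpha><..<\<beta>}" "\<forall>c\<in>C. \<psi>s c \<in> test_functions (ball c \<epsilon>) \<and> supp (\<psi>s c) \<subseteq> K" for t \<psi>s
  proof (rule distribution_sum[OF F_distribution])
    \<comment> \<open>\<open>F t\<close> is known to be a distribution for t > 0 only; hence the
      assumption 0 \<le> \<alpha>.\<close>
    show "t > 0" using that(1) assms(3) by auto
    fix c assume c: "c \<in> C"
    have "supp (\<psi>s c) \<subseteq> {x. (x, t) \<in> W}" using that c K(2) by fastforce
    then show "\<psi>s c \<in> test_functions {x. (x, t) \<in> W}"
      using that(2) c by (blast intro: test_functions_mono)
  qed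
  show "continuous_on {\<alpha><..<\<beta>} (\<lambda>t. F t \<psi>)" if \<psi>: "\<psi> \<in> test_functions UNIV" "supp \<psi> \<subseteq> K"
  proof -
    obtain \<psi>s where \<psi>s: "\<forall>c\<in>C. \<psi>s c \<in> test_functions (ball c \<epsilon>) \<and> supp (\<psi>s c) \<subseteq> supp \<psi>"
      "\<psi> = (\<lambda>x. \<Sum>c\<in>C. \<psi>s c x)" using C(3)[OF \<psi>] by blast
    have s: "\<forall>c\<in>C. \<psi>s c \<in> test_functions (ball c \<epsilon>) \<and> supp (\<psi>s c) \<subseteq> K"
      using \<psi>s(1) \<psi>(2) by blast
    have "continuous_on {\<alpha><..<\<beta>} (\<lambda>t. \<Sum>c\<in>C. F t (\<psi>s c))"
      using fam cyl \<psi>s(1) unfolding is_slice_family_def by (intro continuous_on_sum) blast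
    then show ?thesis
      by (rule continuous_on_eq) (simp add: \<psi>s(2) Fsum[OF _ s])
  qed
  have "AE t in lebesgue. t \<in> {\<alpha><..<\<beta>} \<longrightarrow> (\<forall>\<psi>\<in>test_functions (ball c \<epsilon>). F t \<psi> = f_slice \<psi> t)" if "c \<in> C" for c
  proof -
    have "AE t in lebesgue. t \<in> {\<alpha><..<\<beta>} \<longrightarrow> locally_integrable_on (\<lambda>x. f (x, t)) (ball c \<epsilon>) \<and>
        (\<forall>\<psi>\<in>test_functions (ball c \<epsilon>). F t \<psi> = f_slice \<psi> t)"
      using fam cyl[OF that] unfolding is_slice_family_def by blast
    then show ?thesis by eventually_elim blast
  qed
  then have "AE t in lebesgue. \<forall>c\<in>C. t \<in> {\<alpha><..<\<beta>} \<longrightarrow> (\<forall>\<psi>\<in>test_functions (ball c \<epsilon>). F t \<psi> = f_slice \<psi> t)"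
    using C(1) by (intro AE_finite_allI) auto
  then show "AE t in lebesgue. t \<in> {\<alpha><..<\<beta>} \<longrightarrow> (\<forall>\<psi>\<in>test_functions UNIV. supp \<psi> \<subseteq> K \<longrightarrow> F t \<psi> = f_slice \<psi> t)"
    using slice_mass_integrable(1)[OF f_cylinder[OF K]]
  proof eventually_elim
    case (elim t)
    show ?case
    proof (intro impI ballI)
      fix \<psi> assume t: "t \<in> {\<alpha><..<\<beta>}" and \<psi>: "\<psi> \<in> test_functions UNIV" "supp \<psi> \<subseteq> K"
      obtain \<psi>s where \<psi>s: "\<forall>c\<in>C. \<psi>s c \<in> test_functions (ball c \<epsilon>) \<and> supp (\<psi>s c) \<subseteq> supp \<psi>"
        "\<psi> = (\<lambda>x. \<Sum>c\<in>C. \<psi>s c x)" using C(3)[OF \<psi>] by blast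
      have s: "\<forall>c\<in>C. \<psi>s c \<in> test_functions (ball c \<epsilon>) \<and> supp (\<psi>s c) \<subseteq> K"
        using \<psi>s(1) \<psi>(2) by blast
      have int: "set_integrable lebesgue K (\<lambda>x. f (x, t))" using elim(2) t by auto
      have "F t \<psi> = (\<Sum>c\<in>C. F t (\<psi>s c))" unfolding \<psi>s(2) by (rule Fsum[OF t s])
      also have "\<dots> = (\<Sum>c\<in>C. f_slice (\<psi>s c) t)"
        using elim(1) t s by (intro sum.cong) auto
      also have "\<dots> = f_slice \<psi> t"
        unfolding \<psi>s(2) using s by (intro regular_dist_sum[OF int K(1) C(1), symmetric] test_functions_continuous) auto
      finally show "F t \<psi> = f_slice \<psi> t" .
    qed
  qed
qed

lemma F_increment:
  assumes K: "compact K" "K \<times> {\<alpha>..\<beta>} \<subseteq> W" and "0 \<le> \<alpha>"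
    and \<psi>: "\<psi> \<in> test_functions UNIV" "supp \<psi> \<subseteq> K" and st: "\<alpha> < s" "s \<le> t" "t < \<beta>"
  shows "F t \<psi> - F s \<psi> = (LINT \<sigma>:{s..t}|lebesgue. slice_deriv \<psi> \<sigma>)"
proof -
  have ab: "\<alpha> < \<beta>" using st by simp
  have "AE t in lebesgue. t \<in> {\<alpha><..<\<beta>} \<longrightarrow> F t \<psi> = f_slice \<psi> t"
    using F_cylinder(2)[OF K assms(3) ab] by eventually_elim (use \<psi> in blast)
  from slice_increment[OF test_functions_smooth[OF \<psi>(1)] \<psi>(2) K F_cylinder(1)[OF K assms(3) ab \<psi>] this st]
  show ?thesis .
qed

text \<open>The half-open cylinder is not compact; countably many compact ones, with times from
  1/(n+1) on, still leave a single null set.\<close>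

lemma F_AE_near_zero:
  assumes K: "compact K" "K \<times> {0<..\<delta>} \<subseteq> W"
  shows "AE t in lebesgue. t \<in> {0<..<\<delta>} \<longrightarrow> (\<forall>\<psi>\<in>test_functions UNIV. supp \<psi> \<subseteq> K \<longrightarrow> F t \<psi> = f_slice \<psi> t)"
proof -
  define P where "P t \<longleftrightarrow> (\<forall>\<psi>\<in>test_functions UNIV. supp \<psi> \<subseteq> K \<longrightarrow> F t \<psi> = f_slice \<psi> t)" for t
  have "AE t in lebesgue. t \<in> {1 / real (Suc n)<..<\<delta>} \<longrightarrow> P t" for n
  proof (cases "1 / real (Suc n) < \<delta>")
    case True
    have pos: "1 / real (Suc n) > 0" by simp
    have "{1 / real (Suc n)..\<delta>} \<subseteq> {0<..\<delta>}"
    proof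
      show "t \<in> {0<..\<delta>}" if "t \<in> {1 / real (Suc n)..\<delta>}" for t
        using that pos unfolding atLeastAtMost_iff greaterThanAtMost_iff by linarith
    qed
    then have "K \<times> {1 / real (Suc n)..\<delta>} \<subseteq> W"
      by (intro subset_trans[OF _ K(2)] Sigma_mono order_refl)
    with pos show ?thesis
      using F_cylinder(2)[OF K(1) _ _ True] unfolding P_def by (simp del: of_nat_Suc)
  qed simp
  then have "AE t in lebesgue. \<forall>n. t \<in> {1 / real (Suc n)<..<\<delta>} \<longrightarrow> P t"
    unfolding AE_all_countable by blast
  then have "AE t in lebesgue. t \<in> {0<..<\<delta>} \<longrightarrow> P t"
  proof eventually_elim
    case (elim t)
    show ?case
    proof
      assume t: "t \<in> {0<..<\<delta>}"
      then obtain n where "inverse (real (Suc n)) < t" using reals_Archimedean[of t] by auto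
      then show "P t" using elim t by (auto simp: inverse_eq_divide simp del: of_nat_Suc)
    qed
  qed
  then show ?thesis unfolding P_def .
qed

end

section \<open>The boundary value\<close>

locale boundary_trace = slice_family_transport "upper_part U" a f g F
  for U :: "((real^'n) \<times> real) set" and a f g F +
  fixes X :: "(real^'n) set"
  assumes open_U: "open U" and X_U: "X \<times> {0} \<subseteq> U"
    and upto: "\<And>j. smooth_upto (X \<times> {0}) (upper_part U) (a j)"
    and moderate: "\<And>K. compact K \<Longrightarrow> K \<subseteq> X \<Longrightarrow>
           \<exists>N::nat. \<exists>C>0. \<exists>\<delta>>0. AE t in lebesgue. 0 < t \<and> t < \<delta> \<longrightarrow>
             (\<lambda>x. f (x, t)) absolutely_integrable_on K \<and>
             (LINT x:K|lebesgue. norm (f (x, t))) \<le> C / t ^ N"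
begin

section \<open>Cylinders touching t = 0\<close>

lemma cylinder_near:
  assumes "compact K" "K \<subseteq> X"
  obtains \<delta> where "\<delta> > 0" "\<delta> < 1" "K \<times> {0<..\<delta>} \<subseteq> upper_part U"
proof -
  have "K \<times> {0..0} \<subseteq> U" using assms(2) X_U by auto
  from compact_cylinder_tube[OF assms(1) open_U this order_refl]
  obtain \<epsilon> where \<epsilon>: "\<epsilon> > 0" "\<And>x. x \<in> K \<Longrightarrow> ball x \<epsilon> \<times> {0 - \<epsilon><..<0 + \<epsilon>} \<subseteq> U" by blast
  \<comment> \<open>Times below 1 make negative powers of t at least 1, which later absorbs additive
    constants.\<close>
  define \<delta> where "\<delta> = min (\<epsilon> / 2) (1 / 2)"
  have \<delta>: "\<delta> > 0" "\<delta> < 1" "\<delta> < \<epsilon>" using \<epsilon>(1) by (auto simp: \<delta>_def)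
  have "K \<times> {0<..\<delta>} \<subseteq> upper_part U"
  proof safe
    fix x t assume x: "x \<in> K" and t: "t \<in> {0<..\<delta>}"
    then have "(x, t) \<in> ball x \<epsilon> \<times> {0 - \<epsilon><..<0 + \<epsilon>}" using \<epsilon>(1) \<delta> by auto
    then have "(x, t) \<in> U" using \<epsilon>(2)[OF x] by blast
    then show "(x, t) \<in> upper_part U" using t by (simp add: upper_part_def)
  qed
  then show ?thesis using that \<delta> by blast
qed

text \<open>The set itself is not compact, but each derivative has an extension h that is continuous
  down to t = 0, and \<open>K \<times> {0..\<delta>}\<close> is compact.\<close>

lemma coeff_bounded_near:
  assumes K: "compact K" "K \<subseteq> X" and sub: "K \<times> {0<..\<delta>} \<subseteq> upper_part U"
  obtains A where "coeff_bounded m A (K \<times> {0<..\<delta>})"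
proof (rule coeff_boundedI)
  fix j and es :: "(real^'n) list" assume es: "es \<in> multi_indices m"
  let ?es = "map (\<lambda>e. (e, 0::real)) es"
  have "set ?es \<subseteq> Basis" by (rule map_zero_in_Basis[OF es])
  then obtain h where h: "continuous_on (X \<times> {0} \<union> upper_part U) h" "\<forall>z\<in>upper_part U. h z = iter_deriv ?es (a j) z"
    using upto[of j] unfolding smooth_upto_def by blast
  have "(x, t) \<in> X \<times> {0} \<union> upper_part U" if "x \<in> K" "t \<in> {0..\<delta>}" for x t
    using that K(2) sub by (cases "t = 0") auto
  then have "K \<times> {0..\<delta>} \<subseteq> X \<times> {0} \<union> upper_part U" by blast
  then have c: "continuous_on (K \<times> {0..\<delta>}) h" by (rule continuous_on_subset[OF h(1)])
  have "compact (K \<times> {0..\<delta>})" using K(1) by (intro compact_Times) auto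
  from compact_norm_bound[OF this c] obtain B where B: "\<And>z. z \<in> K \<times> {0..\<delta>} \<Longrightarrow> norm (h z) \<le> B" by blast
  show "\<exists>B. \<forall>z\<in>K \<times> {0<..\<delta>}. norm (iter_deriv ?es (a j) z) \<le> B"
  proof (intro exI[of _ B] ballI)
    fix z assume z: "z \<in> K \<times> {0<..\<delta>}"
    then have "z \<in> K \<times> {0..\<delta>}" by auto
    moreover have "h z = iter_deriv ?es (a j) z" using h(2) z sub by blast
    ultimately show "norm (iter_deriv ?es (a j) z) \<le> B" using B[of z] by simp
  qed
qed (rule that)

text \<open>For almost every \<^term>\<open>t\<close> near 0 the estimate holds for all test functions at once, so it may be
  applied to the time-dependent test function \<^term>\<open>\<lambda>x. adj \<psi> (x, t)\<close>.\<close>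

definition growth_le :: "(real^'n) set \<Rightarrow> real \<Rightarrow> nat \<Rightarrow> bool" where
  "growth_le K p m \<longleftrightarrow> (\<exists>C\<ge>0. \<exists>\<delta>>0. AE t in lebesgue. t \<in> {0<..<\<delta>} \<longrightarrow>
     (\<forall>\<psi>\<in>test_functions UNIV. supp \<psi> \<subseteq> K \<longrightarrow> norm (f_slice \<psi> t) \<le> C * t powr (- p) * Ck_seminorm m \<psi>))"

lemma growth_start:
  assumes K: "compact K" "K \<subseteq> X"
  obtains n :: nat where "growth_le K (real n + 1 / 2) 0"
proof -
  obtain N :: nat and C \<delta> where C: "C > 0" "\<delta> > 0" "AE t in lebesgue. 0 < t \<and> t < \<delta> \<longrightarrow>
             (\<lambda>x. f (x, t)) absolutely_integrable_on K \<and>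
             (LINT x:K|lebesgue. norm (f (x, t))) \<le> C / t ^ N"
    using moderate[OF K] by blast
  have Ks: "K \<in> sets lebesgue" by (rule fmeasurableD[OF lmeasurable_compact[OF K(1)]])
  \<comment> \<open>For t < 1 the power t^(-N) may be replaced by the larger t^(-N-1/2);
    half-integer exponents never meet the critical value 1.\<close>
  have "AE t in lebesgue. t \<in> {0<..<min \<delta> 1} \<longrightarrow> (\<forall>\<psi>\<in>test_functions UNIV. supp \<psi> \<subseteq> K \<longrightarrow>
      norm (f_slice \<psi> t) \<le> C * t powr (- (real N + 1 / 2)) * Ck_seminorm 0 \<psi>)"
    using C(3)
  proof eventually_elim
    case (elim t)
    show ?case
    proof (intro impI ballI)
      fix \<psi> assume t: "t \<in> {0<..<min \<delta> 1}" and \<psi>: "\<psi> \<in> test_functions UNIV" "supp \<psi> \<subseteq> K"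
      have int: "(\<lambda>x. f (x, t)) absolutely_integrable_on K" "(LINT x:K|lebesgue. norm (f (x, t))) \<le> C / t ^ N"
        using elim t by auto
      have P0: "Ck_seminorm 0 \<psi> \<ge> 0" by (rule Ck_seminorm_nonneg[OF \<psi>(1)])
      have "norm (f_slice \<psi> t) \<le> Ck_seminorm 0 \<psi> * (LINT x:K|lebesgue. norm (f (x, t)))"
        by (rule norm_regular_dist_le[OF int(1) Ks test_functions_continuous[OF \<psi>(1)] \<psi>(2) norm_le_Ck_seminorm[OF \<psi>(1)]])
      also have "\<dots> \<le> Ck_seminorm 0 \<psi> * (C / t ^ N)"
        by (rule mult_left_mono[OF int(2) P0])
      also have "C / t ^ N = C * t powr (- real N)"
        using t by (simp add: powr_minus powr_realpow divide_inverse)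
      also have "Ck_seminorm 0 \<psi> * (C * t powr (- real N)) \<le> Ck_seminorm 0 \<psi> * (C * t powr (- (real N + 1 / 2)))"
        using t C(1) by (intro mult_left_mono P0 powr_mono') auto
      finally show "norm (f_slice \<psi> t) \<le> C * t powr (- (real N + 1 / 2)) * Ck_seminorm 0 \<psi>"
        by (simp add: mult_ac)
    qed
  qed
  then have "growth_le K (real N + 1 / 2) 0"
    unfolding growth_le_def using C(1,2) by (intro exI[of _ C] conjI exI[of _ "min \<delta> 1"]) auto
  then show ?thesis by (rule that)
qed

text \<open>The growth bound is applied to \<open>adj \<psi>\<close> at almost every time and
  integrated. The slice mass of g is integrable down to 0, so only the power of \<sigma> can blow
  up.\<close>

lemma increment_estimate:
  assumes K: "compact K" "K \<subseteq> X" and growth: "growth_le K p m" and "p \<noteq> 1"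
  obtains C \<delta> where "C \<ge> 0" "\<delta> > 0" "\<delta> < 1" "K \<times> {0<..\<delta>} \<subseteq> upper_part U"
    "\<And>s t \<psi>. 0 < s \<Longrightarrow> s \<le> t \<Longrightarrow> t < \<delta> \<Longrightarrow> \<psi> \<in> test_functions UNIV \<Longrightarrow> supp \<psi> \<subseteq> K \<Longrightarrow>
      norm (F t \<psi> - F s \<psi>) \<le> Ck_seminorm (Suc m) \<psi> *
        ((LINT \<sigma>:{s..t}|lebesgue. slice_mass K g \<sigma>) + C * (LINT \<sigma>:{s..t}|lebesgue. \<sigma> powr (- p)))"
proof -
  obtain \<delta>1 where \<delta>1: "\<delta>1 > 0" "\<delta>1 < 1" "K \<times> {0<..\<delta>1} \<subseteq> upper_part U"
    by (rule cylinder_near[OF K])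
  obtain A where A: "coeff_bounded (Suc m) A (K \<times> {0<..\<delta>1})"
    by (rule coeff_bounded_near[OF K \<delta>1(3)])
  then have A0: "A \<ge> 0" by (simp add: coeff_bounded_def)
  obtain B \<delta>2 where B: "B \<ge> 0" "\<delta>2 > 0" "AE t in lebesgue. t \<in> {0<..<\<delta>2} \<longrightarrow>
     (\<forall>\<psi>\<in>test_functions UNIV. supp \<psi> \<subseteq> K \<longrightarrow> norm (f_slice \<psi> t) \<le> B * t powr (- p) * Ck_seminorm m \<psi>)"
    using growth unfolding growth_le_def by blast
  define \<delta> where "\<delta> = min \<delta>1 \<delta>2"
  have \<delta>: "\<delta> > 0" "\<delta> < 1" "\<delta> \<le> \<delta>1" "\<delta> \<le> \<delta>2" using \<delta>1 B(2) by (auto simp: \<delta>_def)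
  \<comment> \<open>\<open>B\<close> comes from the growth bound, the other factor from the seminorm
    of the adjoint term.\<close>
  define C where "C = B * (adj_const m * A)"
  have C0: "C \<ge> 0" using B(1) A0 adj_const_nonneg by (simp add: C_def)
  have Ks: "K \<in> sets lebesgue" by (rule fmeasurableD[OF lmeasurable_compact[OF K(1)]])
  have sub: "K \<times> {0<..\<delta>} \<subseteq> upper_part U"
    using \<delta>(3) by (intro subset_trans[OF _ \<delta>1(3)] Sigma_mono) auto
  have "set_integrable lebesgue (K \<times> {0<..\<delta>}) g" by (rule g_cylinder[OF K(1) _ sub]) simp
  note mg = slice_mass_integrable[OF this]
  show ?thesis
  proof (rule that[OF C0 \<delta>(1,2) sub])
    fix s t \<psi> assume st: "0 < s" "s \<le> t" "t < \<delta>" and \<psi>: "\<psi> \<in> test_functions UNIV" "supp \<psi> \<subseteq> K"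
    let ?P = "Ck_seminorm (Suc m) \<psi>"
    have P0: "?P \<ge> 0" by (rule Ck_seminorm_nonneg[OF \<psi>(1)])
    \<comment> \<open>\<open>F_increment\<close> requires s to lie strictly inside the time
      interval, so the cylinder begins at s/2.\<close>
    have sub2: "K \<times> {s/2..\<delta>} \<subseteq> upper_part U"
      using st by (intro subset_trans[OF _ sub] Sigma_mono) auto
    note i = slice_integrable(2)[OF test_functions_smooth[OF \<psi>(1)] \<psi>(2) K(1) sub2]
    have ist: "set_integrable lebesgue {s..t} (slice_deriv \<psi>)"
      using st by (intro set_integrable_subset[OF i]) auto
    have mst: "set_integrable lebesgue {s..t} (slice_mass K g)"
      using st by (intro set_integrable_subset[OF mg(2)]) auto
    note pst = powr_set_integral(1)[OF st(1,2) \<open>p \<noteq> 1\<close>]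
    have AE: "AE \<sigma> in lebesgue. \<sigma> \<in> {s..t} \<longrightarrow>
        norm (slice_deriv \<psi> \<sigma>) \<le> ?P * slice_mass K g \<sigma> + (?P * C) * \<sigma> powr (- p)"
      using mg(1) B(3)
    proof eventually_elim
      case (elim \<sigma>)
      show ?case
      proof
        assume \<sigma>: "\<sigma> \<in> {s..t}"
        have Kt: "K \<times> {\<sigma>} \<subseteq> upper_part U" using sub \<sigma> st by (intro subset_trans[OF _ sub] Sigma_mono) auto
        have At: "coeff_bounded (Suc m) A (K \<times> {\<sigma>})"
          using A \<sigma> st \<delta>(3) by (auto simp: coeff_bounded_def)
        note adj = adj_slice_test[OF Kt \<psi>]
        have "norm (regular_dist (\<lambda>x. g (x, \<sigma>)) \<psi>) \<le> ?P * slice_mass K g \<sigma>"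
          unfolding slice_mass_def using elim(1) \<sigma> st
          by (intro norm_regular_dist_le[OF _ Ks test_functions_continuous[OF \<psi>(1)] \<psi>(2) norm_le_Ck_seminorm[OF \<psi>(1)]]) auto
        moreover have "norm (f_slice (\<lambda>x. adj \<psi> (x, \<sigma>)) \<sigma>) \<le> (?P * C) * \<sigma> powr (- p)"
        proof -
          have "norm (f_slice (\<lambda>x. adj \<psi> (x, \<sigma>)) \<sigma>) \<le> B * \<sigma> powr (- p) * Ck_seminorm m (\<lambda>x. adj \<psi> (x, \<sigma>))"
            using elim(2) \<sigma> st \<delta>(4) adj(2) \<psi>(2) test_functions_mono[OF adj(1) subset_UNIV] by auto
          also have "\<dots> \<le> B * \<sigma> powr (- p) * (adj_const m * A * ?P)"
            using B(1) by (intro mult_left_mono adj(3)[OF At]) auto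
          finally show ?thesis by (simp add: C_def mult_ac)
        qed
        ultimately show "norm (slice_deriv \<psi> \<sigma>) \<le> ?P * slice_mass K g \<sigma> + (?P * C) * \<sigma> powr (- p)"
          unfolding slice_deriv_def by (rule norm_triangle_mono)
      qed
    qed
    have "F t \<psi> - F s \<psi> = (LINT \<sigma>:{s..t}|lebesgue. slice_deriv \<psi> \<sigma>)"
      using st by (intro F_increment[OF K(1) sub2 _ \<psi>]) auto
    also have "norm \<dots> \<le> (LINT \<sigma>:{s..t}|lebesgue. norm (slice_deriv \<psi> \<sigma>))"
      by (rule set_integral_norm_bound[OF ist])
    also have "\<dots> \<le> (LINT \<sigma>:{s..t}|lebesgue. ?P * slice_mass K g \<sigma> + (?P * C) * \<sigma> powr (- p))"
      by (rule set_integral_mono_AE[OF set_integrable_norm[OF ist]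
            set_integral_add(1)[OF set_integrable_mult_right[OF mst] set_integrable_mult_right[OF pst]] AE])
    also have "\<dots> = ?P * ((LINT \<sigma>:{s..t}|lebesgue. slice_mass K g \<sigma>) + C * (LINT \<sigma>:{s..t}|lebesgue. \<sigma> powr (- p)))"
      using set_integral_add(2)[OF set_integrable_mult_right[OF mst, of ?P] set_integrable_mult_right[OF pst, of "?P * C"]]
      by (simp add: algebra_simps)
    finally show "norm (F t \<psi> - F s \<psi>) \<le> ?P *
        ((LINT \<sigma>:{s..t}|lebesgue. slice_mass K g \<sigma>) + C * (LINT \<sigma>:{s..t}|lebesgue. \<sigma> powr (- p)))" .
  qed
qed

text \<open>The increment is taken between s and a fixed time t0. At t0 the slice is just some
  distribution, of an order k0 unrelated to m; hence the maximum in the choice of k.\<close>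

lemma bound_from_increment:
  assumes K: "compact K" "K \<subseteq> X" and growth: "growth_le K p m" and "p \<noteq> 1"
  obtains M t0 k where "M \<ge> 0" "t0 > 0" "t0 < 1" "K \<times> {0<..t0} \<subseteq> upper_part U"
    "\<And>s \<psi>. 0 < s \<Longrightarrow> s < t0 \<Longrightarrow> \<psi> \<in> test_functions UNIV \<Longrightarrow> supp \<psi> \<subseteq> K \<Longrightarrow>
      norm (F s \<psi>) \<le> Ck_seminorm k \<psi> * (M + M * ((t0 powr (1 - p) - s powr (1 - p)) / (1 - p)))"
proof -
  obtain C \<delta> where C: "C \<ge> 0" "\<delta> > 0" "\<delta> < 1" "K \<times> {0<..\<delta>} \<subseteq> upper_part U"
    "\<And>s t \<psi>. 0 < s \<Longrightarrow> s \<le> t \<Longrightarrow> t < \<delta> \<Longrightarrow> \<psi> \<in> test_functions UNIV \<Longrightarrow> supp \<psi> \<subseteq> K \<Longrightarrow>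
      norm (F t \<psi> - F s \<psi>) \<le> Ck_seminorm (Suc m) \<psi> *
        ((LINT \<sigma>:{s..t}|lebesgue. slice_mass K g \<sigma>) + C * (LINT \<sigma>:{s..t}|lebesgue. \<sigma> powr (- p)))"
    using increment_estimate[OF K growth \<open>p \<noteq> 1\<close>] by blast
  define t0 where "t0 = \<delta> / 2"
  have t0: "t0 > 0" "t0 < \<delta>" "t0 < 1" using C(2,3) by (auto simp: t0_def)
  have "K \<subseteq> {x. (x, t0) \<in> upper_part U}" using C(4) t0 by auto
  from distribution_bound_nonneg[OF F_distribution[OF t0(1)] K(1) this]
  obtain C0 k0 where C0: "C0 \<ge> 0"
    "\<And>\<psi>. \<psi> \<in> test_functions UNIV \<Longrightarrow> supp \<psi> \<subseteq> K \<Longrightarrow> norm (F t0 \<psi>) \<le> C0 * Ck_seminorm k0 \<psi>"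
    by blast
  have "set_integrable lebesgue (K \<times> {0<..\<delta>}) g" by (rule g_cylinder[OF K(1) _ C(4)]) simp
  note mg = slice_mass_integrable(2)[OF this]
  define Mg where "Mg = (LINT \<sigma>:{0<..\<delta>}|lebesgue. slice_mass K g \<sigma>)"
  have Mg0: "Mg \<ge> 0"
    unfolding Mg_def set_lebesgue_integral_def by (auto intro!: integral_nonneg_AE simp: slice_mass_nonneg)
  \<comment> \<open>Merged so that one constant serves both summands.\<close>
  define M where "M = C0 + Mg + C"
  define k where "k = max k0 (Suc m)"
  show ?thesis
  proof (rule that[of M t0 k])
    show "M \<ge> 0" "t0 > 0" "t0 < 1" using C0(1) Mg0 C(1) t0 by (auto simp: M_def)
    show "K \<times> {0<..t0} \<subseteq> upper_part U" using t0 by (intro subset_trans[OF _ C(4)] Sigma_mono) auto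
    fix s \<psi> assume s: "0 < s" "s < t0" and \<psi>: "\<psi> \<in> test_functions UNIV" "supp \<psi> \<subseteq> K"
    define I where "I = (t0 powr (1 - p) - s powr (1 - p)) / (1 - p)"
    have I: "(LINT \<sigma>:{s..t0}|lebesgue. \<sigma> powr (- p)) = I"
      unfolding I_def using s by (intro powr_set_integral(2) \<open>p \<noteq> 1\<close>) auto
    then have I0: "I \<ge> 0"
      unfolding set_lebesgue_integral_def by (auto intro!: integral_nonneg_AE)
    let ?P = "Ck_seminorm k \<psi>"
    have P0: "?P \<ge> 0" by (rule Ck_seminorm_nonneg[OF \<psi>(1)])
    have "(LINT \<sigma>:{s..t0}|lebesgue. slice_mass K g \<sigma>) \<le> Mg"
      unfolding Mg_def using s t0 by (intro set_integral_subset_mono[OF mg]) (auto simp: slice_mass_nonneg)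
    then have le: "(LINT \<sigma>:{s..t0}|lebesgue. slice_mass K g \<sigma>) + C * (LINT \<sigma>:{s..t0}|lebesgue. \<sigma> powr (- p)) \<le> Mg + C * I"
      by (simp add: I)
    have "norm (F s \<psi>) \<le> norm (F t0 \<psi>) + norm (F t0 \<psi> - F s \<psi>)"
      using norm_triangle_ineq4[of "F t0 \<psi>" "F t0 \<psi> - F s \<psi>"] by simp
    also have "\<dots> \<le> C0 * ?P + ?P * (Mg + C * I)"
    proof (rule add_mono)
      show "norm (F t0 \<psi>) \<le> C0 * ?P"
        by (rule order_trans[OF C0(2)[OF \<psi>] mult_left_mono[OF Ck_seminorm_mono[OF \<psi>(1)] C0(1)]]) (simp add: k_def)
      have "norm (F t0 \<psi> - F s \<psi>) \<le> Ck_seminorm (Suc m) \<psi> * (Mg + C * I)"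
        using s t0 by (intro order_trans[OF C(5) mult_left_mono[OF le]] \<psi> Ck_seminorm_nonneg[OF \<psi>(1)]) auto
      also have "\<dots> \<le> ?P * (Mg + C * I)"
        using Mg0 C(1) I0 by (intro mult_right_mono Ck_seminorm_mono[OF \<psi>(1)]) (auto simp: k_def)
      finally show "norm (F t0 \<psi> - F s \<psi>) \<le> ?P * (Mg + C * I)" .
    qed
    also have "\<dots> = ?P * (C0 + Mg + C * I)" by (simp add: algebra_simps)
    also have "\<dots> \<le> ?P * (M + M * I)"
      using C0(1) Mg0 C(1) I0 by (intro mult_left_mono P0 add_mono mult_right_mono) (auto simp: M_def)
    finally show "norm (F s \<psi>) \<le> ?P * (M + M * ((t0 powr (1 - p) - s powr (1 - p)) / (1 - p)))"
      unfolding I_def .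
  qed
qed

text \<open>The integral of \<sigma>^(-q-1) from t to t0 is at most t^(-q)/q, which gains one power
  of t, possibly at a higher order of the seminorm. The bound for \<open>F\<close> is turned back
  into one for the pairing at almost every t, ready for the next round.\<close>

lemma growth_step:
  assumes K: "compact K" "K \<subseteq> X" and growth: "growth_le K (q + 1) m" and q: "q \<ge> 1 / 2"
  obtains k where "growth_le K q k"
proof -
  have "q + 1 \<noteq> 1" using q by simp
  from bound_from_increment[OF K growth this] obtain M t0 k where M: "M \<ge> 0" "t0 > 0" "t0 < 1" "K \<times> {0<..t0} \<subseteq> upper_part U"
    "\<And>s \<psi>. 0 < s \<Longrightarrow> s < t0 \<Longrightarrow> \<psi> \<in> test_functions UNIV \<Longrightarrow> supp \<psi> \<subseteq> K \<Longrightarrow>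
      norm (F s \<psi>) \<le> Ck_seminorm k \<psi> * (M + M * ((t0 powr (1 - (q + 1)) - s powr (1 - (q + 1))) / (1 - (q + 1))))"
    by blast
  have "AE t in lebesgue. t \<in> {0<..<t0} \<longrightarrow> (\<forall>\<psi>\<in>test_functions UNIV. supp \<psi> \<subseteq> K \<longrightarrow>
      norm (f_slice \<psi> t) \<le> (3 * M) * t powr (- q) * Ck_seminorm k \<psi>)"
    using F_AE_near_zero[OF K(1) M(4)]
  proof eventually_elim
    case (elim t)
    show ?case
    proof (intro impI ballI)
      fix \<psi> assume t: "t \<in> {0<..<t0}" and \<psi>: "\<psi> \<in> test_functions UNIV" "supp \<psi> \<subseteq> K"
      \<comment> \<open>The constant term is absorbed by t^(-q); together with 1/q \<le> 2 this
        gives the factor 3 below.\<close>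
      have one: "1 \<le> t powr (- q)"
        using t M(3) q powr_mono'[of "- q" 0 t] by simp
      have "(t0 powr (- q) - t powr (- q)) / (- q) = (t powr (- q) - t0 powr (- q)) / q"
        by (simp add: minus_divide_left[symmetric] diff_divide_distrib)
      also have "\<dots> \<le> t powr (- q) / q"
        using q by (intro divide_right_mono) auto
      also have "\<dots> \<le> 2 * t powr (- q)"
      proof -
        have "t powr (- q) * 1 \<le> t powr (- q) * (2 * q)" using q by (intro mult_left_mono) auto
        then show ?thesis using q by (simp add: field_simps)
      qed
      finally have I: "(t0 powr (- q) - t powr (- q)) / (- q) \<le> 2 * t powr (- q)" .
      have "norm (f_slice \<psi> t) = norm (F t \<psi>)" using elim t \<psi> by simp
      also have "\<dots> \<le> Ck_seminorm k \<psi> * (M + M * ((t0 powr (- q) - t powr (- q)) / (- q)))"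
        using M(5)[of t \<psi>] t \<psi> by simp
      also have "\<dots> \<le> Ck_seminorm k \<psi> * (M * t powr (- q) + M * (2 * t powr (- q)))"
        using mult_left_mono[OF one M(1)]
        by (intro mult_left_mono Ck_seminorm_nonneg[OF \<psi>(1)] add_mono mult_left_mono[OF I M(1)]) simp
      finally show "norm (f_slice \<psi> t) \<le> (3 * M) * t powr (- q) * Ck_seminorm k \<psi>"
        by (simp add: algebra_simps)
    qed
  qed
  then have "growth_le K q k"
    unfolding growth_le_def using M(1,2) by (intro exI[of _ "3 * M"] conjI exI[of _ t0]) auto
  then show ?thesis by (rule that)
qed

text \<open>Induction on the integer part of the exponent, with the order k generalised because each
  step changes it.\<close>

lemma growth_half:
  assumes K: "compact K" "K \<subseteq> X"
  obtains m where "growth_le K (1 / 2) m"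
proof -
  have "\<exists>m. growth_le K (1 / 2) m" if "growth_le K (real n + 1 / 2) k" for n k
    using that
  proof (induction n arbitrary: k)
    case 0
    then show ?case by auto
  next
    case (Suc n)
    then have "growth_le K ((real n + 1 / 2) + 1) k" by (simp add: algebra_simps)
    from growth_step[OF K this] obtain k' where "growth_le K (real n + 1 / 2) k'" by auto
    then show ?case by (rule Suc.IH)
  qed
  then show ?thesis using growth_start[OF K] that by metis
qed

text \<open>At exponent 1/2 the integral of \<sigma>^(-1/2) converges at 0, so the bound no longer
  depends on t.\<close>

lemma F_bounded_near_zero:
  assumes K: "compact K" "K \<subseteq> X"
  obtains C \<delta> k where "C \<ge> 0" "\<delta> > 0"
    "\<forall>t\<in>{0<..<\<delta>}. \<forall>\<psi>\<in>test_functions UNIV. supp \<psi> \<subseteq> K \<longrightarrow> norm (F t \<psi>) \<le> C * Ck_seminorm k \<psi>"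
proof -
  obtain m where m: "growth_le K (1 / 2) m" by (rule growth_half[OF K])
  have "(1 / 2 :: real) \<noteq> 1" by simp
  from bound_from_increment[OF K m this] obtain M t0 k where M: "M \<ge> 0" "t0 > 0" "t0 < 1" "K \<times> {0<..t0} \<subseteq> upper_part U"
    "\<And>s \<psi>. 0 < s \<Longrightarrow> s < t0 \<Longrightarrow> \<psi> \<in> test_functions UNIV \<Longrightarrow> supp \<psi> \<subseteq> K \<Longrightarrow>
      norm (F s \<psi>) \<le> Ck_seminorm k \<psi> * (M + M * ((t0 powr (1 - 1 / 2) - s powr (1 - 1 / 2)) / (1 - 1 / 2)))"
    by blast
  show ?thesis
  proof (rule that[of "M + M * (t0 powr (1 / 2) / (1 / 2))" t0 k])
    show "M + M * (t0 powr (1 / 2) / (1 / 2)) \<ge> 0" using M(1) by simp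
    have "norm (F t \<psi>) \<le> (M + M * (t0 powr (1 / 2) / (1 / 2))) * Ck_seminorm k \<psi>"
      if t: "0 < t" "t < t0" and \<psi>: "\<psi> \<in> test_functions UNIV" "supp \<psi> \<subseteq> K" for t \<psi>
    proof -
      have "norm (F t \<psi>) \<le> Ck_seminorm k \<psi> * (M + M * ((t0 powr (1 / 2) - t powr (1 / 2)) / (1 / 2)))"
        using M(5)[OF t \<psi>] by simp
      also have "\<dots> \<le> Ck_seminorm k \<psi> * (M + M * (t0 powr (1 / 2) / (1 / 2)))"
        using M(1) by (intro mult_left_mono Ck_seminorm_nonneg[OF \<psi>(1)] add_left_mono divide_right_mono) auto
      finally show ?thesis
        by (simp add: mult.commute)
    qed
    then show "\<forall>t\<in>{0<..<t0}. \<forall>\<psi>\<in>test_functions UNIV. supp \<psi> \<subseteq> K \<longrightarrow>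
        norm (F t \<psi>) \<le> (M + M * (t0 powr (1 / 2) / (1 / 2))) * Ck_seminorm k \<psi>"
      by simp
  qed (rule M(2))
qed

text \<open>With exponent 1/2 the increment between s and t has a bound that depends on t alone and
  tends to 0.\<close>

lemma F_convergent:
  assumes \<psi>: "\<psi> \<in> test_functions X"
  obtains L where "((\<lambda>t. F t \<psi>) \<longlongrightarrow> L) (at_right 0)"
proof -
  define K where "K = supp \<psi>"
  have K: "compact K" "K \<subseteq> X" unfolding K_def by (rule test_functions_compact[OF \<psi>], rule test_functions_supp[OF \<psi>])
  have \<psi>U: "\<psi> \<in> test_functions UNIV" "supp \<psi> \<subseteq> K" using test_functions_mono[OF \<psi> subset_UNIV] by (auto simp: K_def)
  obtain m where m: "growth_le K (1 / 2) m" by (rule growth_half[OF K])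
  have "(1 / 2 :: real) \<noteq> 1" by simp
  from increment_estimate[OF K m this] obtain C \<delta> where C: "C \<ge> 0" "\<delta> > 0" "\<delta> < 1" "K \<times> {0<..\<delta>} \<subseteq> upper_part U"
    "\<And>s t \<psi>. 0 < s \<Longrightarrow> s \<le> t \<Longrightarrow> t < \<delta> \<Longrightarrow> \<psi> \<in> test_functions UNIV \<Longrightarrow> supp \<psi> \<subseteq> K \<Longrightarrow>
      norm (F t \<psi> - F s \<psi>) \<le> Ck_seminorm (Suc m) \<psi> *
        ((LINT \<sigma>:{s..t}|lebesgue. slice_mass K g \<sigma>) + C * (LINT \<sigma>:{s..t}|lebesgue. \<sigma> powr (- (1 / 2))))"
    by blast
  let ?P = "Ck_seminorm (Suc m) \<psi>"
  have P0: "?P \<ge> 0" by (rule Ck_seminorm_nonneg[OF \<psi>])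
  have "set_integrable lebesgue (K \<times> {0<..\<delta>}) g" by (rule g_cylinder[OF K(1) _ C(4)]) simp
  note mg = slice_mass_integrable(2)[OF this]
  \<comment> \<open>The slice mass of g is controlled for positive times only. Set to 0 at \<sigma>
    \<le> 0, it is integrable on the closed interval, and its primitive is continuous at 0.\<close>
  define G where "G \<sigma> = indicator {0<..} \<sigma> * slice_mass K g \<sigma>" for \<sigma>
  have "(\<lambda>\<sigma>. indicator {0..\<delta>} \<sigma> *\<^sub>R G \<sigma>) = (\<lambda>\<sigma>. indicator {0<..\<delta>} \<sigma> *\<^sub>R slice_mass K g \<sigma>)"
    by (auto simp: G_def indicator_def fun_eq_iff)
  then have G: "set_integrable lebesgue {0..\<delta>} G"
    using mg by (simp add: set_integrable_def)
  \<comment> \<open>The two parts are the mass of g up to time t and the integral of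
    \<sigma>^(-1/2), which is at most 2 sqrt t.\<close>
  define R where "R t = ?P * ((LINT \<sigma>:{0..t}|lebesgue. G \<sigma>) + C * (2 * sqrt t))" for t
  have "((\<lambda>t. LINT \<sigma>:{0..t}|lebesgue. G \<sigma>) \<longlongrightarrow> (LINT \<sigma>:{0..0}|lebesgue. G \<sigma>)) (at 0 within {0..\<delta>})"
    by (rule primitive_continuous[OF G, unfolded continuous_on_def, rule_format]) (use C(2) in simp)
  moreover have "(LINT \<sigma>:{0..0}|lebesgue. G \<sigma>) = 0"
  proof -
    have "(\<lambda>\<sigma>. indicator {0..0} \<sigma> *\<^sub>R G \<sigma>) = (\<lambda>\<sigma>. 0)" by (auto simp: G_def indicator_def fun_eq_iff)
    then show ?thesis unfolding set_lebesgue_integral_def by simp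
  qed
  ultimately have "((\<lambda>t. LINT \<sigma>:{0..t}|lebesgue. G \<sigma>) \<longlongrightarrow> 0) (at_right 0)"
    using at_within_Icc_at_right[OF C(2)] by simp
  moreover have "((\<lambda>t. sqrt t) \<longlongrightarrow> sqrt 0) (at_right 0)"
    by (intro tendsto_real_sqrt tendsto_ident_at)
  ultimately have "(R \<longlongrightarrow> ?P * (0 + C * (2 * sqrt 0))) (at_right 0)"
    unfolding R_def by (intro tendsto_mult tendsto_add tendsto_const)
  then have R: "(R \<longlongrightarrow> 0) (at_right 0)" by simp
  have "norm (F t \<psi> - F s \<psi>) \<le> R t" if st: "0 < s" "s \<le> t" "t < \<delta>" for s t
  proof -
    have "(LINT \<sigma>:{s..t}|lebesgue. slice_mass K g \<sigma>) = (LINT \<sigma>:{s..t}|lebesgue. G \<sigma>)"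
      unfolding set_lebesgue_integral_def
      by (intro Bochner_Integration.integral_cong refl) (use st in \<open>auto simp: G_def indicator_def\<close>)
    also have "\<dots> \<le> (LINT \<sigma>:{0..t}|lebesgue. G \<sigma>)"
      using st by (intro set_integral_subset_mono set_integrable_subset[OF G]) (auto simp: G_def slice_mass_nonneg)
    finally have 1: "(LINT \<sigma>:{s..t}|lebesgue. slice_mass K g \<sigma>) \<le> (LINT \<sigma>:{0..t}|lebesgue. G \<sigma>)" .
    have "(LINT \<sigma>:{s..t}|lebesgue. \<sigma> powr (- (1 / 2))) = (t powr (1 - 1 / 2) - s powr (1 - 1 / 2)) / (1 - 1 / 2)"
      using st by (intro powr_set_integral(2)) auto
    also have "\<dots> \<le> 2 * sqrt t" using st by (simp add: powr_half_sqrt)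
    finally have 2: "(LINT \<sigma>:{s..t}|lebesgue. \<sigma> powr (- (1 / 2))) \<le> 2 * sqrt t" .
    show ?thesis
      unfolding R_def
      by (rule order_trans[OF C(5)[OF st \<psi>U]]) (intro mult_left_mono add_mono 1 2 P0 C(1))
  qed
  from tendsto_at_right_if_modulus[OF C(2) this R] that show ?thesis by blast
qed

section \<open>The limit distribution and uniform bounds\<close>

definition trace :: "(real^'n \<Rightarrow> complex) \<Rightarrow> complex" where
  "trace \<psi> = Lim (at_right 0) (\<lambda>t. F t \<psi>)"

lemma trace_tendsto: "\<psi> \<in> test_functions X \<Longrightarrow> ((\<lambda>t. F t \<psi>) \<longlongrightarrow> trace \<psi>) (at_right 0)"
  unfolding trace_def using F_convergent tendsto_Lim[OF trivial_limit_at_right_real] by metis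

lemma trace_norm_le:
  assumes "\<psi> \<in> test_functions X" "\<delta> > 0" "\<And>t. 0 < t \<Longrightarrow> t < \<delta> \<Longrightarrow> norm (F t \<psi>) \<le> B"
  shows "norm (trace \<psi>) \<le> B"
proof (rule tendsto_upperbound[OF tendsto_norm[OF trace_tendsto[OF assms(1)]]])
  show "\<forall>\<^sub>F t in at_right 0. norm (F t \<psi>) \<le> B"
    unfolding eventually_at_right_field using assms(2,3) by blast
qed simp

lemma eventually_slice:
  assumes "compact K" "K \<subseteq> X"
  shows "\<forall>\<^sub>F t in at_right 0. t > 0 \<and> K \<subseteq> {x. (x, t) \<in> upper_part U}"
proof -
  obtain \<delta> where \<delta>: "\<delta> > 0" "K \<times> {0<..\<delta>} \<subseteq> upper_part U" using cylinder_near[OF assms] by blast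
  show ?thesis
    unfolding eventually_at_right_field using \<delta> by (intro exI[of _ \<delta>]) auto
qed

text \<open>\<open>F s\<close> is linear on the functions at hand once their supports lie in the
  slice at height s, which holds for small s; linearity then passes to the limit. The seminorm bound
  passes because it is uniform near t = 0.\<close>

lemma trace_distribution: "distribution X trace"
  unfolding distribution_def
proof (intro conjI ballI allI impI)
  fix \<phi> \<psi> assume t: "\<phi> \<in> test_functions X" "\<psi> \<in> test_functions X"
  have "((\<lambda>t. F t (\<lambda>x. \<phi> x + \<psi> x)) \<longlongrightarrow> trace \<phi> + trace \<psi>) (at_right 0)"
  proof (rule Lim_transform_eventually[OF tendsto_add[OF trace_tendsto[OF t(1)] trace_tendsto[OF t(2)]]])
    show "\<forall>\<^sub>F s in at_right 0. F s \<phi> + F s \<psi> = F s (\<lambda>x. \<phi> x + \<psi> x)"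
      using eventually_slice[OF test_functions_compact[OF t(1)] test_functions_supp[OF t(1)]]
        eventually_slice[OF test_functions_compact[OF t(2)] test_functions_supp[OF t(2)]]
    proof eventually_elim
      case (elim s)
      show ?case
        using elim t test_functions_mono by (intro distribution_add[OF F_distribution, symmetric]) blast+
    qed
  qed
  then show "trace (\<lambda>x. \<phi> x + \<psi> x) = trace \<phi> + trace \<psi>"
    by (rule tendsto_unique[OF trivial_limit_at_right_real trace_tendsto[OF test_functions_add[OF t]]])
next
  fix c \<phi> assume t: "\<phi> \<in> test_functions X"
  have "((\<lambda>t. F t (\<lambda>x. c * \<phi> x)) \<longlongrightarrow> c * trace \<phi>) (at_right 0)"
  proof (rule Lim_transform_eventually[OF tendsto_mult[OF tendsto_const trace_tendsto[OF t]]])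
    show "\<forall>\<^sub>F s in at_right 0. c * F s \<phi> = F s (\<lambda>x. c * \<phi> x)"
      using eventually_slice[OF test_functions_compact[OF t] test_functions_supp[OF t]]
    proof eventually_elim
      case (elim s)
      show ?case
        using elim t test_functions_mono by (intro distribution_cmult[OF F_distribution, symmetric]) blast+
    qed
  qed
  then show "trace (\<lambda>x. c * \<phi> x) = c * trace \<phi>"
    by (rule tendsto_unique[OF trivial_limit_at_right_real trace_tendsto[OF test_functions_cmult[OF t]]])
next
  fix K assume "compact K \<and> K \<subseteq> X"
  then have K: "compact K" "K \<subseteq> X" by auto
  obtain C \<delta> k where C: "C \<ge> 0" "\<delta> > 0"
    "\<forall>t\<in>{0<..<\<delta>}. \<forall>\<psi>\<in>test_functions UNIV. supp \<psi> \<subseteq> K \<longrightarrow> norm (F t \<psi>) \<le> C * Ck_seminorm k \<psi>"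
    using F_bounded_near_zero[OF K] by blast
  show "\<exists>C k. \<forall>\<phi>\<in>test_functions X. supp \<phi> \<subseteq> K \<longrightarrow> norm (trace \<phi>) \<le> C * Ck_seminorm k \<phi>"
  proof (intro exI[of _ C] exI[of _ k] ballI impI)
    fix \<phi> assume \<phi>: "\<phi> \<in> test_functions X" "supp \<phi> \<subseteq> K"
    show "norm (trace \<phi>) \<le> C * Ck_seminorm k \<phi>"
      using C(3) \<phi>(2) test_functions_mono[OF \<phi>(1) subset_UNIV] by (intro trace_norm_le[OF \<phi>(1) C(2)]) auto
  qed
qed

text \<open>Near t = 0 a uniform bound is at hand. For later times up to T the slices are compared
  with the single distribution \<open>F T\<close>, through the integral of
  \<open>slice_deriv\<close> over a compact cylinder.\<close>

lemma F_uniformly_bounded: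
  assumes T: "T > 0" "X \<times> {0<..T} \<subseteq> upper_part U"
  shows "uniformly_bounded_dists X ((\<lambda>t. if t = 0 then trace else F t) ` {0..T})"
proof -
  have slice: "X \<subseteq> {x. (x, t) \<in> upper_part U}" if "t \<in> {0<..T}" for t
    using T(2) that by auto
  have dist: "distribution X (F t)" if "t \<in> {0<..T}" for t
    using that by (intro distribution_subset[OF F_distribution slice]) auto
  have bound: "\<exists>C k. \<forall>t\<in>{0..T}. \<forall>\<phi>\<in>test_functions X. supp \<phi> \<subseteq> K \<longrightarrow>
      norm ((if t = 0 then trace else F t) \<phi>) \<le> C * Ck_seminorm k \<phi>" if K: "compact K" "K \<subseteq> X" for K
  proof -
    obtain C1 \<delta> k1 where C1: "C1 \<ge> 0" "\<delta> > 0"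
      "\<forall>t\<in>{0<..<\<delta>}. \<forall>\<psi>\<in>test_functions UNIV. supp \<psi> \<subseteq> K \<longrightarrow> norm (F t \<psi>) \<le> C1 * Ck_seminorm k1 \<psi>"
      using F_bounded_near_zero[OF K] by blast
    \<comment> \<open>Any time before both \<delta> and T would do; the cylinder then starts at s/2,
      strictly before every t \<ge> \<delta>.\<close>
    define s where "s = min \<delta> T / 2"
    have s: "0 < s" "s < \<delta>" "s < T" using C1(2) T(1) by (auto simp: s_def)
    have "K \<times> {s..T} \<subseteq> upper_part U"
      using s K(2) by (intro subset_trans[OF _ T(2)] Sigma_mono) auto
    \<comment> \<open>\<open>F_increment\<close> needs T inside an open time interval. Openness of
      \<open>upper_part U\<close> and compactness of \<open>K\<close> allow the cylinder to be
      prolonged beyond T.\<close>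
    from compact_cylinder_tube[OF K(1) open_W this] s(3)
    obtain \<epsilon> where \<epsilon>: "\<epsilon> > 0" "\<And>x. x \<in> K \<Longrightarrow> ball x \<epsilon> \<times> {s - \<epsilon><..<T + \<epsilon>} \<subseteq> upper_part U"
      by (metis less_imp_le)
    have cyl: "K \<times> {s/2..T + \<epsilon>/2} \<subseteq> upper_part U"
    proof safe
      fix x t assume x: "x \<in> K" and t: "t \<in> {s/2..T + \<epsilon>/2}"
      show "(x, t) \<in> upper_part U"
      proof (cases "t \<le> T")
        case True
        then show ?thesis using x t s(1) K(2) T(2) by auto
      next
        case False
        then have "(x, t) \<in> ball x \<epsilon> \<times> {s - \<epsilon><..<T + \<epsilon>}" using t \<epsilon>(1) s(3) by auto
        then show ?thesis using \<epsilon>(2)[OF x] by blast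
      qed
    qed
    obtain C2 where C2: "C2 \<ge> 0"
      "\<And>\<psi>. \<psi> \<in> test_functions UNIV \<Longrightarrow> supp \<psi> \<subseteq> K \<Longrightarrow>
        (LINT t:{s/2..T + \<epsilon>/2}|lebesgue. norm (slice_deriv \<psi> t)) \<le> C2 * Ck_seminorm 1 \<psi>"
      using slice_bounds_compact[OF K(1) cyl] by metis
    have "T \<in> {0<..T}" using T(1) by simp
    from distribution_bound_nonneg[OF F_distribution[OF T(1)] K(1) subset_trans[OF K(2) slice[OF this]]]
    obtain C3 k3 where C3: "C3 \<ge> 0"
      "\<And>\<psi>. \<psi> \<in> test_functions UNIV \<Longrightarrow> supp \<psi> \<subseteq> K \<Longrightarrow> norm (F T \<psi>) \<le> C3 * Ck_seminorm k3 \<psi>"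
      by blast
    define k where "k = max k1 (max 1 k3)"
    show ?thesis
    proof (intro exI[of _ "C1 + (C3 + C2)"] exI[of _ k] ballI impI)
      fix t \<phi> assume t: "t \<in> {0..T}" and \<phi>: "\<phi> \<in> test_functions X" "supp \<phi> \<subseteq> K"
      have \<phi>U: "\<phi> \<in> test_functions UNIV" by (rule test_functions_mono[OF \<phi>(1) subset_UNIV])
      let ?P = "Ck_seminorm k \<phi>"
      have P0: "?P \<ge> 0" by (rule Ck_seminorm_nonneg[OF \<phi>(1)])
      have P: "Ck_seminorm k1 \<phi> \<le> ?P" "Ck_seminorm 1 \<phi> \<le> ?P" "Ck_seminorm k3 \<phi> \<le> ?P"
        by (auto intro!: Ck_seminorm_mono[OF \<phi>(1)] simp: k_def)
      have near: "norm (F t \<phi>) \<le> C1 * ?P" if "0 < t" "t < \<delta>" for t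
      proof -
        have "norm (F t \<phi>) \<le> C1 * Ck_seminorm k1 \<phi>" using C1(3) that \<phi>U \<phi>(2) by simp
        then show ?thesis using mult_left_mono[OF P(1) C1(1)] by linarith
      qed
      have total: "C1 * ?P \<le> (C1 + (C3 + C2)) * ?P" "(C3 + C2) * ?P \<le> (C1 + (C3 + C2)) * ?P"
        using C1(1) C2(1) C3(1) P0 by (auto intro!: mult_right_mono)
      consider "t = 0" | "0 < t" "t < \<delta>" | "\<delta> \<le> t" using t by fastforce
      then show "norm ((if t = 0 then trace else F t) \<phi>) \<le> (C1 + (C3 + C2)) * ?P"
      proof cases
        case 1
        then show ?thesis using trace_norm_le[OF \<phi>(1) C1(2) near] total(1) by simp
      next
        case 2
        then show ?thesis using near[OF 2] total(1) by simp
      next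
        case 3
        have st: "s/2 < t" "t \<le> T" "T < T + \<epsilon>/2" using 3 s t \<epsilon>(1) by auto
        note i = slice_integrable(2)[OF test_functions_smooth[OF \<phi>U] \<phi>(2) K(1) cyl]
        have it: "set_integrable lebesgue {t..T} (slice_deriv \<phi>)"
          using st by (intro set_integrable_subset[OF i]) auto
        have "F T \<phi> - F t \<phi> = (LINT \<sigma>:{t..T}|lebesgue. slice_deriv \<phi> \<sigma>)"
          using s(1) by (intro F_increment[OF K(1) cyl _ \<phi>U \<phi>(2) st]) auto
        also have "norm \<dots> \<le> (LINT \<sigma>:{t..T}|lebesgue. norm (slice_deriv \<phi> \<sigma>))"
          by (rule set_integral_norm_bound[OF it])
        also have "\<dots> \<le> (LINT \<sigma>:{s/2..T + \<epsilon>/2}|lebesgue. norm (slice_deriv \<phi> \<sigma>))"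
          using st by (intro set_integral_subset_mono[OF set_integrable_norm[OF i]]) auto
        also have "\<dots> \<le> C2 * Ck_seminorm 1 \<phi>" by (rule C2(2)[OF \<phi>U \<phi>(2)])
        also have "\<dots> \<le> C2 * ?P" by (rule mult_left_mono[OF P(2) C2(1)])
        finally have "norm (F T \<phi> - F t \<phi>) \<le> C2 * ?P" .
        moreover have "norm (F T \<phi>) \<le> C3 * ?P"
          using C3(2)[OF \<phi>U \<phi>(2)] mult_left_mono[OF P(3) C3(1)] by linarith
        moreover have "norm (F t \<phi>) \<le> norm (F T \<phi>) + norm (F T \<phi> - F t \<phi>)"
          using norm_triangle_ineq4[of "F T \<phi>" "F T \<phi> - F t \<phi>"] by simp
        ultimately have "norm (F t \<phi>) \<le> (C3 + C2) * ?P" by (simp add: distrib_right)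
        then show ?thesis using total(2) 3 C1(2) by simp
      qed
    qed
  qed
  show ?thesis
    unfolding uniformly_bounded_dists_def
  proof (intro conjI ballI allI impI)
    fix u assume "u \<in> (\<lambda>t. if t = 0 then trace else F t) ` {0..T}"
    then show "distribution X u" using dist trace_distribution by (auto split: if_splits)
  next
    fix K assume "compact K \<and> K \<subseteq> X"
    then show "\<exists>C k. \<forall>u\<in>(\<lambda>t. if t = 0 then trace else F t) ` {0..T}.
        \<forall>\<phi>\<in>test_functions X. supp \<phi> \<subseteq> K \<longrightarrow> norm (u \<phi>) \<le> C * Ck_seminorm k \<phi>"
      using bound[of K] by (simp only: ball_simps)
  qed
qed

end

theorem theorem1p1:
  fixes X :: "(real^'n) set"
    and U :: "((real^'n) \<times> real) set"
    and a :: "'n \<Rightarrow> (real^'n) \<times> real \<Rightarrow> complex"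
    and f :: "(real^'n) \<times> real \<Rightarrow> complex"
  assumes "open X"
    and "open U"
    and "X \<times> {0} \<subseteq> U"
    and "\<And>j. smooth_upto (X \<times> {0}) (upper_part U) (a j)"
    and "locally_integrable_on f (upper_part U)"
    and "in_L1 (vector_field a (regular_dist f)) (upper_part U)"
    and "\<And>K. compact K \<Longrightarrow> K \<subseteq> X \<Longrightarrow>
           \<exists>N::nat. \<exists>C>0. \<exists>\<delta>>0. AE t in lebesgue. 0 < t \<and> t < \<delta> \<longrightarrow>
             (\<lambda>x. f (x, t)) absolutely_integrable_on K \<and>
             (LINT x:K|lebesgue. norm (f (x, t))) \<le> C / t ^ N"
  shows "\<exists>bf. distribution X bf \<and>
           (\<forall>\<psi>\<in>test_functions X.
              ((\<lambda>t. slice_dist (upper_part U) f t \<psi>) \<longlongrightarrow> bf \<psi>) (at_right 0)) \<and>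
           (\<forall>T>0. X \<times> {0<..T} \<subseteq> upper_part U \<longrightarrow>
              uniformly_bounded_dists X
                ((\<lambda>t. if t = 0 then bf else slice_dist (upper_part U) f t) ` {0..T}))"
proof -
  obtain g where g: "g absolutely_integrable_on upper_part U"
    "\<forall>\<phi>\<in>test_functions (upper_part U). vector_field a (regular_dist f) \<phi> = regular_dist g \<phi>"
    using assms(6) unfolding in_L1_def by blast
  have "open (U \<inter> snd -` {0<..})" using assms(2) by (intro open_Int open_vimage_snd) auto
  moreover have "upper_part U = U \<inter> snd -` {0<..}" by (auto simp: upper_part_def)
  ultimately have W: "open (upper_part U)" by simp
  interpret T: transport_equation "upper_part U" a f g
    by unfold_locales (use W g assms(4,5) in \<open>auto simp: smooth_upto_def\<close>)
  \<comment> \<open>The chosen family has the defining property because some family has it; this is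
    all that the boundary theory asks of it.\<close>
  have "is_slice_family (upper_part U) f (slice_dist (upper_part U) f)"
    unfolding slice_dist_def by (rule someI[of "is_slice_family (upper_part U) f", OF T.slice_fam_is_slice_family])
  then interpret B: boundary_trace U a f g "slice_dist (upper_part U) f" X
    by unfold_locales (use assms in auto)
  show ?thesis
    by (rule exI[of _ B.trace]) (blast intro: B.trace_distribution B.trace_tendsto B.F_uniformly_bounded)
qed

end
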